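(* Let $0<\beta<3$, $p=\frac{3+\beta}{3}$ and $\alpha\ge0$. Suppose that $u=\phi+q\,\mathcal{G}_\lambda\in\mathrm{Dom}(\mathcal{H})$, with $(\phi,q,\lambda)\in T$, is a bound state, i.e. there is $\omega\in\mathbb{R}$ such that $\mathcal{H}u+\omega u-(I_\beta*|u|^p)|u|^{p-2}u=0$ in $L^2$. If either $q=0$ or $\phi\equiv0$, then $u\equiv0$.
   Context: All function spaces are over $\mathbb{R}^3$ and consist of complex-valued functions. The Riesz potential is $$I_\beta(x)=\frac{\Gamma\left(\frac{3-\beta}{2}\right)}{\Gamma(\beta/2)\,\pi^{3/2}\,2^\beta}\,\frac{1}{|x|^{3-\beta}},\qquad x\in\mathbb{R}^3\setminus\{0\}.$$ For $\lambda>0$, $\mathcal{G}_\lambda(x)=\frac{1}{4\pi|x|}e^{-\sqrt\lambda|x|}$ is the fundamental solution of $-\Delta+\lambda$. Let $$T=\Big\{(\phi,q,\lambda)\in H^2\times\mathbb{C}\times(0,\infty):\ \phi(0)=\Big(\alpha+\tfrac{\sqrt\lambda}{4\pi}\Big)q\Big\},\qquad \mathrm{Dom}(\mathcal{H})=\{\phi+q\,\mathcal{G}_\lambda:(\phi,q,\lambda)\in T\}\subset L^2,$$ and let $\mathcal{H}:\mathrm{Dom}(\mathcal{H})\to L^2$ be the self-adjoint operator (realizing $-\Delta+\alpha\delta_0$) given by $\mathcal{H}[\phi+q\,\mathcal{G}_\lambda]=-\Delta\phi-q\lambda\,\mathcal{G}_\lambda$ for $(\phi,q,\lambda)\in T$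 (the value is independent of the representation of the argument). *)

theory Defs
  imports "HOL-Analysis.Analysis"
begin

text \<open>
  Elements of \<open>L\<^sup>2(\<real>\<^sup>3; \<complex>)\<close> are represented by Borel functions, and equality in \<open>L\<^sup>2\<close> is
  equality almost everywhere with respect to \<open>lborel\<close>. In particular \<open>L2\<close>, \<open>H2\<close> and
  \<open>Dom_H\<close> are closed under changing a function to an a.e. equal Borel function.
\<close>

definition L2 :: "(real^3 \<Rightarrow> complex) set" where
  "L2 = {f. f \<in> borel_measurable lborel \<and> integrable lborel (\<lambda>x. (norm (f x))\<^sup>2)}"

definition partial_deriv :: "3 \<Rightarrow> (real^3 \<Rightarrow> complex) \<Rightarrow> real^3 \<Rightarrow> complex" where
  "partial_deriv j f x = frechet_derivative f (at x) (axis j 1)"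

fun partial_derivs :: "3 list \<Rightarrow> (real^3 \<Rightarrow> complex) \<Rightarrow> real^3 \<Rightarrow> complex" where
  "partial_derivs [] f = f"
| "partial_derivs (j # js) f = partial_deriv j (partial_derivs js f)"

text \<open>
  \<open>C\<^sub>c\<^sup>\<infinity>(\<real>\<^sup>3; \<complex>)\<close>: differentiability of every iterated partial derivative also makes each of
  them continuous.
\<close>

definition test_functions :: "(real^3 \<Rightarrow> complex) set" where
  "test_functions = {\<psi>. (\<forall>js x. partial_derivs js \<psi> differentiable (at x)) \<and>
     (\<exists>K. compact K \<and> (\<forall>x. x \<notin> K \<longrightarrow> \<psi> x = 0))}"

text \<open>A multi-index is given as the list of its directions, so its order is the length.\<close>

definition is_weak_deriv ::
    "3 list \<Rightarrow> (real^3 \<Rightarrow> complex) \<Rightarrow> (real^3 \<Rightarrow> complex) \<Rightarrow> bool" where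
  "is_weak_deriv js f g \<longleftrightarrow> (\<forall>\<psi>\<in>test_functions.
     (LINT x|lborel. f x * partial_derivs js \<psi> x) =
     (-1) ^ length js * (LINT x|lborel. g x * \<psi> x))"

definition H2 :: "(real^3 \<Rightarrow> complex) set" where
  "H2 = {f \<in> L2. \<forall>js. length js \<le> 2 \<longrightarrow> (\<exists>g\<in>L2. is_weak_deriv js f g)}"

text \<open>The choice is unique up to a null set.\<close>

definition weak_deriv :: "3 list \<Rightarrow> (real^3 \<Rightarrow> complex) \<Rightarrow> real^3 \<Rightarrow> complex" where
  "weak_deriv js f = (SOME g. g \<in> L2 \<and> is_weak_deriv js f g)"

definition laplacian :: "(real^3 \<Rightarrow> complex) \<Rightarrow> real^3 \<Rightarrow> complex" where
  "laplacian f x = (\<Sum>j\<in>UNIV. weak_deriv [j, j] f x)"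

text \<open>
  The value of \<open>f \<in> H\<^sup>2\<close> at a point is that of its continuous representative, which exists by
  the Sobolev embedding and is unique.
\<close>

definition has_point_value :: "(real^3 \<Rightarrow> complex) \<Rightarrow> real^3 \<Rightarrow> complex \<Rightarrow> bool" where
  "has_point_value f x c \<longleftrightarrow>
     (\<exists>g. continuous_on UNIV g \<and> (AE y in lborel. g y = f y) \<and> g x = c)"

text \<open>The values of the next two kernels at the origin are irrelevant.\<close>

definition riesz_potential :: "real \<Rightarrow> real^3 \<Rightarrow> real" where
  "riesz_potential \<beta> x =
     Gamma ((3 - \<beta>) / 2) / (Gamma (\<beta> / 2) * pi powr (3 / 2) * 2 powr \<beta>) *
     (1 / norm x powr (3 - \<beta>))"

definition green :: "real \<Rightarrow> real^3 \<Rightarrow> complex" where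
  "green l x = of_real (1 / (4 * pi * norm x) * exp (- sqrt l * norm x))"

definition convolution :: "(real^3 \<Rightarrow> real) \<Rightarrow> (real^3 \<Rightarrow> real) \<Rightarrow> real^3 \<Rightarrow> real" where
  "convolution k f x = (LINT y|lborel. k (x - y) * f y)"

definition T :: "real \<Rightarrow> ((real^3 \<Rightarrow> complex) \<times> complex \<times> real) set" where
  "T \<alpha> = {(\<phi>, q, l). \<phi> \<in> H2 \<and> l > 0 \<and>
     has_point_value \<phi> 0 (of_real (\<alpha> + sqrt l / (4 * pi)) * q)}"

definition represents ::
    "(real^3 \<Rightarrow> complex) \<times> complex \<times> real \<Rightarrow> (real^3 \<Rightarrow> complex) \<Rightarrow> bool" where
  "represents = (\<lambda>(\<phi>, q, l) u. AE x in lborel. u x = \<phi> x + q * green l x)"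

definition Dom_H :: "real \<Rightarrow> (real^3 \<Rightarrow> complex) set" where
  "Dom_H \<alpha> = {u \<in> L2. \<exists>t\<in>T \<alpha>. represents t u}"

text \<open>
  The operator realizing \<open>-\<Delta> + \<alpha> \<delta>\<^sub>0\<close>. Up to a null set the value does not depend on the
  chosen representation of \<open>u \<in> Dom_H \<alpha>\<close>.
\<close>

definition op_H :: "real \<Rightarrow> (real^3 \<Rightarrow> complex) \<Rightarrow> real^3 \<Rightarrow> complex" where
  "op_H \<alpha> u = (case (SOME t. t \<in> T \<alpha> \<and> represents t u) of
     (\<phi>, q, l) \<Rightarrow> (\<lambda>x. - laplacian \<phi> x - q * of_real l * green l x))"

definition bound_state :: "real \<Rightarrow> real \<Rightarrow> real \<Rightarrow> (real^3 \<Rightarrow> complex) \<Rightarrow> bool" where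
  "bound_state \<alpha> \<beta> p u \<longleftrightarrow> u \<in> Dom_H \<alpha> \<and>
     (\<exists>\<omega>::real. AE x in lborel.
        op_H \<alpha> u x + of_real \<omega> * u x
        - of_real (convolution (riesz_potential \<beta>) (\<lambda>y. norm (u y) powr p) x)
          * of_real (norm (u x) powr (p - 2)) * u x = 0)"

end

theory Submission
  imports Defs
begin

text \<open>
  If \<open>\<phi> = 0\<close>, the boundary condition reads \<open>(\<alpha> + sqrt \<lambda> / 4 \<pi>) q = 0\<close>, hence \<open>q = 0\<close>. If \<open>q = 0\<close>, then every
  representation of \<open>u\<close> has \<open>q = 0\<close>, because \<open>green \<lambda>\<close> is unbounded at the origin, so \<open>u \<in> H\<^sup>2\<close> solves the
  Choquard equation without point interaction, \<open>n = (I * |u|\<^sup>p) |u|\<^sup>p\<^sup>-\<^sup>2 u\<close> with \<open>n = - \<Delta> u + \<omega> u\<close>.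

  For the lower critical exponent \<open>p\<close> both the \<open>L\<^sup>2\<close> norm and the Riesz energy
  \<open>D (u) = \<integral>\<integral> I (x - y) |u (x)|\<^sup>p |u (y)|\<^sup>p\<close> are invariant under the dilations \<open>t\<^sup>3\<^sup>/\<^sup>2 u (t x)\<close>, which forces
  \<open>\<integral> |\<nabla> u|\<^sup>2 = 0\<close>. Since \<open>x \<cdot> \<nabla> u\<close> need not be in \<open>L\<^sup>2\<close>, dilations are replaced by the
  bounded shears \<open>x \<mapsto> x - t \<xi> (x\<^sub>j) e\<^sub>j\<close> with \<open>\<xi> (s) = R sin (s / R)\<close>, and \<open>R\<close> tends to infinity at the end.
  Transporting \<open>u\<close> along a shear gives \<open>u\<^sub>t\<close> with
  \<open>Re \<langle>n, u\<^sub>t - u\<rangle> \<le> (D (u\<^sub>t) - D (u)) / 2 p\<close>, by Young's inequality and the positive definiteness of the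
  Riesz kernel (a mixture of Gaussians), so the nonlinear term is never differentiated. Dividing by \<open>t\<close>,
  the left side tends to \<open>Re \<langle>n, \<xi> (x\<^sub>j) \<partial>\<^sub>j u + \<xi>' (x\<^sub>j) u / 2\<rangle>\<close>, which is \<open>\<integral> |\<partial>\<^sub>j u|\<^sup>2\<close> in the limit of large \<open>R\<close>,
  whereas the sum over \<open>j\<close> of the right sides tends to \<open>0\<close>. Hence \<open>u\<close> is constant, and \<open>u (0) = 0\<close>.
\<close>

section \<open>Translations in \<open>L\<^sup>1\<close> and \<open>L\<^sup>2\<close>\<close>

text \<open>The obstacle is that the nonlinear term is known only through the equation: it equals
  the linear side \<open>N\<close>, which is in \<open>L2\<close>, and pairing \<open>N\<close> with
  \<open>g\<close> is what makes the Riesz energy finite. Since 1 < p < 2, the map z to |z|^(p-2) z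
  is not differentiable at 0, and no decay of the gradient is at hand, so a one-sided comparison for
  t > 0 replaces the first variation of the energy. It suffices because only an upper bound for the
  Dirichlet integral is wanted. A shear changes one coordinate by a function of that coordinate, so
  its Jacobian and its inverse are one-dimensional. Its displacement is at most t R, so the error of
  the first-order expansion is governed by continuity of translations of the gradient in
  \<open>L2\<close>. The amplitude 1 + (t/2) \<xi>' is the first-order part of (Jacobian)^(-1/2); it
  makes the transport isometric in \<open>L2\<close> to first order, which removes the term with
  \<omega>. The price is that a single shear does not preserve the energy to first order. The
  changes cancel only after summing over the three directions and letting R grow, by 6 (p/2 - 1) +
  (3 - \<beta>) = 0.\<close>

lemma nn_integral_lborel_translate:
  fixes f :: "'a::euclidean_space \<Rightarrow> ennreal"
  assumes [measurable]: "f \<in> borel_measurable borel"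
  shows "(\<integral>\<^sup>+x. f (x + a) \<partial>lborel) = (\<integral>\<^sup>+x. f x \<partial>lborel)"
proof -
  have "(\<integral>\<^sup>+x. f x \<partial>lborel) = (\<integral>\<^sup>+x. f x \<partial>distr lborel borel ((+) a))"
    by (simp add: lborel_distr_plus)
  also have "\<dots> = (\<integral>\<^sup>+x. f (a + x) \<partial>lborel)" by (subst nn_integral_distr) auto
  finally show ?thesis by (simp add: add.commute)
qed

lemma integral_lborel_translate:
  fixes f :: "'a::euclidean_space \<Rightarrow> 'b::{banach, second_countable_topology}"
  assumes [measurable]: "f \<in> borel_measurable borel"
  shows "(LINT x|lborel. f (x + a)) = (LINT x|lborel. f x)"
proof -
  have "(LINT x|lborel. f x) = (LINT x|distr lborel borel ((+) a). f x)"
    by (simp add: lborel_distr_plus)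
  also have "\<dots> = (LINT x|lborel. f (a + x))" by (subst integral_distr) auto
  finally show ?thesis by (simp add: add.commute)
qed

lemma integrable_lborel_translate:
  fixes f :: "'a::euclidean_space \<Rightarrow> 'b::{banach, second_countable_topology}"
  assumes "integrable lborel f"
  shows "integrable lborel (\<lambda>x. f (x + a))"
proof -
  have "integrable (distr lborel borel ((+) a)) f" using assms by (simp add: lborel_distr_plus)
  then have "integrable lborel (\<lambda>x. f (a + x))"
    by (rule integrable_distr[rotated]) simp
  then show ?thesis by (simp add: add.commute)
qed

text \<open>A set of finite measure is squeezed between a compact \<open>K\<close> and an open
  \<open>U\<close> with \<open>U - K\<close> of small measure, and a small translation keeps
  \<open>K\<close> inside \<open>U\<close>. Sums and dominated limits then reach every integrable
  function.\<close>

lemma L1_translation_continuous: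
  fixes f :: "'a::euclidean_space \<Rightarrow> 'b::{banach, second_countable_topology}"
  assumes "integrable lborel f" "e > 0"
  shows "\<exists>d>0. \<forall>h. norm h < d \<longrightarrow> (LINT x|lborel. norm (f (x + h) - f x)) < e"
  using assms
proof (induction arbitrary: e rule: integrable_induct)
  case (base A c)
  \<comment> \<open>Two integrals of the indicator of \<open>V\<close>, each at most 3/4 of
    \<open>e'\<close>, get multiplied by \<open>norm c\<close>; adding 1 to the norm covers c =
    0.\<close>
  define e' where "e' = e / (2 * (norm c + 1))"
  have e': "e' > 0" using base by (auto simp: e'_def add_nonneg_pos)
  have A: "A \<in> sets borel" "emeasure lborel A < \<infinity>" using base by auto
  \<comment> \<open>Inner regularity provides only a closed set. Cutting it with a large ball makes
    it compact, at the cost of a tail of \<open>A\<close> that shrinks to the empty set.\<close>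
  have "(\<lambda>n. emeasure lborel (A - cball 0 (real n))) \<longlonglongrightarrow> emeasure lborel (\<Inter>n. A - cball 0 (real n))"
  proof (intro Lim_emeasure_decseq)
    show "emeasure lborel (A - cball 0 (real n)) \<noteq> \<infinity>" for n
      using A emeasure_mono[of "A - cball 0 (real n)" A lborel] by (auto simp: top_unique)
  qed (use A in \<open>auto simp: decseq_def image_subset_iff\<close>)
  moreover have "(\<Inter>n. A - cball 0 (real n)) = {}"
    using real_arch_simple by (auto simp: dist_norm)
  ultimately have "(\<lambda>n. emeasure lborel (A - cball 0 (real n))) \<longlonglongrightarrow> 0"
    using emeasure_empty by metis
  then have "eventually (\<lambda>n. emeasure lborel (A - cball 0 (real n)) < ennreal (e'/4)) sequentially"
    using e' by (intro order_tendstoD(2)) (auto simp: ennreal_less_zero_iff)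
  then obtain n where n: "emeasure lborel (A - cball 0 (real n)) < ennreal (e'/4)"
    using eventually_happens' sequentially_bot by blast
  have Al: "A \<in> sets lebesgue" and e4: "e'/4 > 0" using A e' by auto
  obtain C where C: "closed C" "C \<subseteq> A" "A - C \<in> lmeasurable" "emeasure lebesgue (A - C) < ennreal (e'/4)"
    by (rule sets_lebesgue_inner_closed[OF Al e4])
  obtain U where U: "open U" "A \<subseteq> U" "U - A \<in> lmeasurable" "emeasure lebesgue (U - A) < ennreal (e'/4)"
    by (rule sets_lebesgue_outer_open[OF Al e4])
  define K where "K = C \<inter> cball 0 (real n)"
  have K: "compact K" "K \<subseteq> A" unfolding K_def using C by (auto simp: closed_Int_compact)
  define V where "V = U - K"
  have V: "V \<in> sets borel" unfolding V_def using U K by (intro sets.Diff borel_open borel_closed compact_imp_closed)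
  have "emeasure lborel V \<le> emeasure lborel ((U - A) \<union> (A - C) \<union> (A - cball 0 (real n)))"
    using U K C A by (intro emeasure_mono) (auto simp: V_def K_def)
  also have "\<dots> \<le> emeasure lborel (U - A) + emeasure lborel (A - C) + emeasure lborel (A - cball 0 (real n))"
    using U K C A by (intro order.trans[OF emeasure_subadditive] add_right_mono emeasure_subadditive) auto
  also have "\<dots> \<le> ennreal (e'/4) + ennreal (e'/4) + ennreal (e'/4)"
    using U C A n by (intro add_mono) (auto simp: emeasure_completion)
  also have "\<dots> = ennreal (3 * e' / 4)" using e' by (simp flip: ennreal_plus)
  finally have Vle: "emeasure lborel V \<le> ennreal (3 * e' / 4)" .
  have Vi: "integrable lborel (indicat_real V)"
    using V Vle by (intro integrable_real_indicator) (auto intro: le_less_trans)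
  have Vm: "(LINT x|lborel. indicat_real V x) \<le> 3 * e' / 4"
    using Vle V e' enn2real_leI[of "3 * e' / 4" "emeasure lborel V"] by (simp add: measure_def)
  obtain d where d: "d > 0" "\<And>x h. x \<in> K \<Longrightarrow> norm h < d \<Longrightarrow> x + h \<in> U"
  proof -
    have "K \<inter> - U = {}" "closed (- U)" using K U by auto
    then obtain d where d: "d > 0" "\<forall>x\<in>K. \<forall>y\<in>- U. d \<le> dist x y"
      using separate_compact_closed[OF K(1)] by blast
    have "x + h \<in> U" if "x \<in> K" "norm h < d" for x h
    proof (rule ccontr)
      assume "x + h \<notin> U"
      then have "d \<le> dist x (x + h)" using d(2) that(1) by blast
      then show False using that(2) by (simp add: dist_norm)
    qed
    then show ?thesis by (rule that[OF d(1)])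
  qed
  show ?case
  proof (intro exI[of _ d] conjI allI impI d(1))
    fix h :: 'a assume h: "norm h < d"
    \<comment> \<open>If exactly one of \<open>x\<close> and \<open>x + h\<close> is in
      \<open>A\<close>, then one of them is in \<open>V\<close>: either the point of
      \<open>A\<close> is outside \<open>K\<close>, or it is in \<open>K\<close> and the other point
      is still in \<open>U\<close>.\<close>
    have le: "norm (indicat_real A (x + h) *\<^sub>R c - indicat_real A x *\<^sub>R c)
        \<le> (indicat_real V (x + h) + indicat_real V x) * norm c" for x
      using d(2)[of x h] d(2)[of "x + h" "- h"] h U(2) K(2)
      by (auto simp: V_def indicator_def)
    have i: "integrable lborel (\<lambda>x. indicat_real V (x + h))" by (rule integrable_lborel_translate[OF Vi])
    have "(LINT x|lborel. norm (indicat_real A (x + h) *\<^sub>R c - indicat_real A x *\<^sub>R c))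
      \<le> (LINT x|lborel. (indicat_real V (x + h) + indicat_real V x) * norm c)"
    proof (rule integral_mono)
      show "integrable lborel (\<lambda>x. norm (indicat_real A (x + h) *\<^sub>R c - indicat_real A x *\<^sub>R c))"
        using A by (intro integrable_norm Bochner_Integration.integrable_diff
          integrable_scaleR_left integrable_lborel_translate integrable_real_indicator impI) auto
    qed (use i Vi le in auto)
    also have "\<dots> = ((LINT x|lborel. indicat_real V (x + h)) + (LINT x|lborel. indicat_real V x)) * norm c"
      using i Vi by simp
    also have "(LINT x|lborel. indicat_real V (x + h)) = (LINT x|lborel. indicat_real V x)"
      using V by (intro integral_lborel_translate) auto
    also have "((LINT x|lborel. indicat_real V x) + (LINT x|lborel. indicat_real V x)) * norm c
        \<le> (2 * e') * norm c" using Vm e' by (intro mult_right_mono) auto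
    also have "\<dots> = e * (norm c / (norm c + 1))"
      using norm_ge_zero[of c] by (simp add: e'_def divide_simps)
    also have "\<dots> < e * 1" using base.prems by (intro mult_strict_left_mono) (auto simp: divide_simps add_nonneg_pos)
    finally show "(LINT x|lborel. norm (indicat_real A (x + h) *\<^sub>R c - indicat_real A x *\<^sub>R c)) < e"
      by simp
  qed
next
  case (add f g)
  obtain d1 where d1: "d1 > 0" "\<And>h. norm h < d1 \<Longrightarrow> (LINT x|lborel. norm (f (x + h) - f x)) < e/2"
    using add.IH(1)[of "e/2"] add.prems by auto
  obtain d2 where d2: "d2 > 0" "\<And>h. norm h < d2 \<Longrightarrow> (LINT x|lborel. norm (g (x + h) - g x)) < e/2"
    using add.IH(2)[of "e/2"] add.prems by auto
  show ?case
  proof (intro exI[of _ "min d1 d2"] conjI allI impI)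
    fix h :: 'a assume h: "norm h < min d1 d2"
    have i: "integrable lborel (\<lambda>x. norm (f (x + h) - f x))" "integrable lborel (\<lambda>x. norm (g (x + h) - g x))"
      using add.hyps by (auto intro!: integrable_norm Bochner_Integration.integrable_diff integrable_lborel_translate)
    have "(LINT x|lborel. norm (f (x + h) + g (x + h) - (f x + g x)))
      \<le> (LINT x|lborel. norm (f (x + h) - f x) + norm (g (x + h) - g x))"
    proof (rule integral_mono)
      show "integrable lborel (\<lambda>x. norm (f (x + h) + g (x + h) - (f x + g x)))"
        using add.hyps by (auto intro!: integrable_norm Bochner_Integration.integrable_diff
            Bochner_Integration.integrable_add integrable_lborel_translate)
    qed (use i in \<open>auto simp: norm_diff_triangle_ineq\<close>)
    also have "\<dots> = (LINT x|lborel. norm (f (x + h) - f x)) + (LINT x|lborel. norm (g (x + h) - g x))"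
      by (rule Bochner_Integration.integral_add[OF i])
    also have "\<dots> < e" using d1(2)[of h] d2(2)[of h] h by simp
    finally show "(LINT x|lborel. norm (f (x + h) + g (x + h) - (f x + g x))) < e" .
  qed (use d1 d2 in auto)
next
  case (lim f s)
  have "(\<lambda>i. LINT x|lborel. norm (s i x - f x)) \<longlonglongrightarrow> (LINT (x::'a)|lborel. norm (0::'b))"
  proof (rule integral_dominated_convergence[where w="\<lambda>x. 3 * norm (f x)"])
    show "AE x in lborel. (\<lambda>i. norm (s i x - f x)) \<longlonglongrightarrow> norm (0::'b)"
      using lim.hyps(2) by (intro AE_I2 tendsto_norm LIM_zero) simp
    show "AE x in lborel. norm (norm (s i x - f x)) \<le> 3 * norm (f x)" for i
    proof (rule AE_I2)
      fix x :: 'a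
      have "norm (s i x - f x) \<le> norm (s i x) + norm (f x)" by norm
      then show "norm (norm (s i x - f x)) \<le> 3 * norm (f x)" using lim.hyps(3)[of x i] by simp
    qed
  qed (use lim.hyps(1,4) in \<open>auto\<close>)
  then have "(\<lambda>i. LINT x|lborel. norm (s i x - f x)) \<longlonglongrightarrow> 0" by simp
  then obtain i where i: "(LINT x|lborel. norm (s i x - f x)) < e/3"
    using order_tendstoD(2)[of _ 0 sequentially "e/3"] lim.prems
    by (metis (no_types, lifting) divide_pos_pos eventually_sequentially order_refl zero_less_numeral)
  obtain d where d: "d > 0" "\<And>h. norm h < d \<Longrightarrow> (LINT x|lborel. norm (s i (x + h) - s i x)) < e/3"
    using lim.IH[of "e/3" i] lim.prems by auto
  show ?case
  proof (intro exI[of _ d] conjI allI impI d(1))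
    fix h :: 'a assume h: "norm h < d"
    let ?a = "\<lambda>x. norm (s i (x + h) - f (x + h))" and ?b = "\<lambda>x. norm (s i (x + h) - s i x)"
      and ?c = "\<lambda>x. norm (s i x - f x)"
    have i': "integrable lborel ?a" "integrable lborel ?b" "integrable lborel ?c"
      using lim.hyps by (auto intro!: integrable_norm Bochner_Integration.integrable_diff integrable_lborel_translate)
    have "(LINT x|lborel. norm (f (x + h) - f x)) \<le> (LINT x|lborel. ?a x + ?b x + ?c x)"
    proof (rule integral_mono)
      show "integrable lborel (\<lambda>x. norm (f (x + h) - f x))"
        using lim.hyps by (auto intro!: integrable_norm Bochner_Integration.integrable_diff integrable_lborel_translate)
      show "norm (f (x + h) - f x) \<le> ?a x + ?b x + ?c x" for x by norm
    qed (use i' in auto)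
    also have "\<dots> = (LINT x|lborel. ?a x) + (LINT x|lborel. ?b x) + (LINT x|lborel. ?c x)"
      using i' by simp
    also have "(LINT x|lborel. ?a x) = (LINT x|lborel. ?c x)"
      using lim.hyps(1,4) by (intro integral_lborel_translate[where f="\<lambda>x. norm (s i x - f x)"]) auto
    finally show "(LINT x|lborel. norm (f (x + h) - f x)) < e" using i d(2)[OF h] by simp
  qed
qed

section \<open>The space \<open>L2\<close>: products, bounded multiples, translates\<close>

lemma L2_iff: "f \<in> L2 \<longleftrightarrow> f \<in> borel_measurable borel \<and> integrable lborel (\<lambda>x. (norm (f x))\<^sup>2)"
  by (simp add: L2_def)

lemma L2_measurable: "f \<in> L2 \<Longrightarrow> f \<in> borel_measurable borel"
  by (simp add: L2_iff)

lemma L2_norm_mult_integrable: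
  assumes "f \<in> L2" "g \<in> L2"
  shows "integrable lborel (\<lambda>x. norm (f x) * norm (g x))"
proof (rule Bochner_Integration.integrable_bound)
  show "integrable lborel (\<lambda>x. (norm (f x))\<^sup>2 + (norm (g x))\<^sup>2)"
    using assms by (auto simp: L2_iff)
  show "AE x in lborel. norm (norm (f x) * norm (g x)) \<le> norm ((norm (f x))\<^sup>2 + (norm (g x))\<^sup>2)"
  proof (rule AE_I2)
    fix x
    have "2 * norm (f x) * norm (g x) \<le> (norm (f x))\<^sup>2 + (norm (g x))\<^sup>2" by (rule sum_squares_bound)
    moreover have "0 \<le> norm (f x) * norm (g x)" by simp
    ultimately have "norm (f x) * norm (g x) \<le> (norm (f x))\<^sup>2 + (norm (g x))\<^sup>2" by linarith
    then show "norm (norm (f x) * norm (g x)) \<le> norm ((norm (f x))\<^sup>2 + (norm (g x))\<^sup>2)" by simp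
  qed
qed (use assms in \<open>auto simp: L2_iff\<close>)

lemma L2_mult_integrable:
  assumes "f \<in> L2" "g \<in> L2"
  shows "integrable lborel (\<lambda>x. f x * g x)"
  by (rule Bochner_Integration.integrable_bound[OF L2_norm_mult_integrable[OF assms]])
     (use assms in \<open>auto simp: L2_iff norm_mult\<close>)

lemma L2_norm_bound:
  assumes "g \<in> L2" "f \<in> borel_measurable borel" "\<And>x. norm (f x) \<le> C * norm (g x)"
  shows "f \<in> L2"
  unfolding L2_iff
proof
  show "integrable lborel (\<lambda>x. (norm (f x))\<^sup>2)"
  proof (rule Bochner_Integration.integrable_bound)
    show "integrable lborel (\<lambda>x. C\<^sup>2 * (norm (g x))\<^sup>2)" using assms by (auto simp: L2_iff)
    show "AE x in lborel. norm ((norm (f x))\<^sup>2) \<le> norm (C\<^sup>2 * (norm (g x))\<^sup>2)"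
      using power_mono[OF assms(3), of _ 2] by (auto simp: power_mult_distrib)
  qed (use assms in auto)
qed fact

lemma L2_mult_bounded:
  assumes "f \<in> L2" "k \<in> borel_measurable borel" "\<And>x. norm (k x) \<le> C"
  shows "(\<lambda>x. k x * f x) \<in> L2"
  by (rule L2_norm_bound[OF assms(1), where C=C])
     (use assms in \<open>auto simp: L2_iff norm_mult intro!: mult_right_mono\<close>)

lemma L2_add:
  assumes "f \<in> L2" "g \<in> L2"
  shows "(\<lambda>x. f x + g x) \<in> L2"
  unfolding L2_iff
proof
  show "integrable lborel (\<lambda>x. (norm (f x + g x))\<^sup>2)"
  proof (rule Bochner_Integration.integrable_bound)
    show "integrable lborel (\<lambda>x. 2 * (norm (f x))\<^sup>2 + 2 * (norm (g x))\<^sup>2)"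
      using assms by (auto simp: L2_iff)
    show "AE x in lborel. norm ((norm (f x + g x))\<^sup>2) \<le> norm (2 * (norm (f x))\<^sup>2 + 2 * (norm (g x))\<^sup>2)"
    proof (rule AE_I2)
      fix x
      have "(norm (f x + g x))\<^sup>2 \<le> (norm (f x) + norm (g x))\<^sup>2"
        by (intro power_mono norm_triangle_ineq) auto
      also have "\<dots> \<le> 2 * (norm (f x))\<^sup>2 + 2 * (norm (g x))\<^sup>2"
        using sum_squares_bound[of "norm (f x)" "norm (g x)"] by (simp add: power2_sum)
      finally show "norm ((norm (f x + g x))\<^sup>2) \<le> norm (2 * (norm (f x))\<^sup>2 + 2 * (norm (g x))\<^sup>2)"
        by simp
    qed
  qed (use assms in \<open>auto simp: L2_iff\<close>)
qed (use assms in \<open>auto simp: L2_iff\<close>)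

lemma L2_cmult: "f \<in> L2 \<Longrightarrow> (\<lambda>x. c * f x) \<in> L2"
  by (rule L2_mult_bounded[where C="norm c"]) auto

lemma L2_diff:
  assumes "f \<in> L2" "g \<in> L2"
  shows "(\<lambda>x. f x - g x) \<in> L2"
  using L2_add[OF assms(1) L2_cmult[OF assms(2), of "-1"]] by simp

lemma L2_cnj: "f \<in> L2 \<Longrightarrow> (\<lambda>x. cnj (f x)) \<in> L2"
  by (rule L2_norm_bound[where C=1 and g=f])
     (auto simp: L2_iff intro: borel_measurable_continuous_on[OF continuous_on_cnj[OF continuous_on_id]])

lemma L2_translate: "f \<in> L2 \<Longrightarrow> (\<lambda>x. f (x + a)) \<in> L2"
  using integrable_lborel_translate[of "\<lambda>x. (norm (f x))\<^sup>2" a] by (auto simp: L2_iff)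

lemma L2_AE_cong:
  assumes "f \<in> L2" "g \<in> borel_measurable borel" "AE x in lborel. g x = f x"
  shows "g \<in> L2"
proof -
  have "integrable lborel (\<lambda>x. (norm (g x))\<^sup>2) \<longleftrightarrow> integrable lborel (\<lambda>x. (norm (f x))\<^sup>2)"
    using assms by (intro integrable_cong_AE) (auto simp: L2_iff)
  then show ?thesis using assms by (simp add: L2_iff)
qed

text \<open>The signed square a |a| sends L^2 to L^1 without losing the sign of a, so its increments
  control those of a. By symmetry a dominates |b|; then the left side is at most a^2 - b^2 if b is
  nonnegative, and at most 2 (a^2 + b^2) otherwise.\<close>

lemma power2_diff_le_abs_square:
  fixes a b :: real
  shows "(a - b)\<^sup>2 \<le> 2 * \<bar>a * \<bar>a\<bar> - b * \<bar>b\<bar>\<bar>"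
proof -
  have *: "(a - b)\<^sup>2 \<le> 2 * \<bar>a * \<bar>a\<bar> - b * \<bar>b\<bar>\<bar>" if "a \<ge> 0" "a \<ge> \<bar>b\<bar>" for a b :: real
  proof (cases "b \<ge> 0")
    case True
    then have "b * b \<le> a * b" "a * b \<le> a * a" using that by (auto intro: mult_right_mono mult_left_mono)
    then show ?thesis using True that by (simp add: power2_eq_square algebra_simps)
  next
    case False
    have "0 \<le> (a + b)\<^sup>2" by simp
    then show ?thesis using False that
      by (simp add: power2_eq_square algebra_simps abs_of_neg)
  qed
  consider "\<bar>a\<bar> \<ge> \<bar>b\<bar>" "a \<ge> 0" | "\<bar>a\<bar> \<ge> \<bar>b\<bar>" "a \<le> 0" | "\<bar>b\<bar> \<ge> \<bar>a\<bar>" "b \<ge> 0" | "\<bar>b\<bar> \<ge> \<bar>a\<bar>" "b \<le> 0" by linarith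
  then show ?thesis
  proof cases
    case 1 then show ?thesis using *[of a b] by simp
  next
    case 2
    have "\<bar>- a * \<bar>- a\<bar> - - b * \<bar>- b\<bar>\<bar> = \<bar>a * \<bar>a\<bar> - b * \<bar>b\<bar>\<bar>" by simp
    moreover have "(- a - - b)\<^sup>2 = (a - b)\<^sup>2" by (simp add: power2_commute)
    moreover have "(- a - - b)\<^sup>2 \<le> 2 * \<bar>- a * \<bar>- a\<bar> - - b * \<bar>- b\<bar>\<bar>" by (rule *) (use 2 in auto)
    ultimately show ?thesis by (simp only:)
  next
    case 3 then show ?thesis using *[of b a] by (simp add: power2_commute abs_minus_commute)
  next
    case 4
    have "\<bar>- b * \<bar>- b\<bar> - - a * \<bar>- a\<bar>\<bar> = \<bar>a * \<bar>a\<bar> - b * \<bar>b\<bar>\<bar>" by simp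
    moreover have "(- b - - a)\<^sup>2 = (a - b)\<^sup>2" by simp
    moreover have "(- b - - a)\<^sup>2 \<le> 2 * \<bar>- b * \<bar>- b\<bar> - - a * \<bar>- a\<bar>\<bar>" by (rule *) (use 4 in auto)
    ultimately show ?thesis by (simp only:)
  qed
qed

text \<open>Continuity in \<open>L\<^sup>2\<close> is reduced to continuity in \<open>L\<^sup>1\<close> of \<open>a |a|\<close>, where \<open>a\<close> is the real or
  imaginary part.\<close>
lemma L2_translation_continuous:
  assumes f: "f \<in> L2" and e: "e > 0"
  shows "\<exists>d>0. \<forall>h. norm h < d \<longrightarrow> (LINT x|lborel. (norm (f (x + h) - f x))\<^sup>2) < e"
proof -
  have *: "integrable lborel (\<lambda>x. a x * \<bar>a x\<bar>)"
    if "a \<in> borel_measurable borel" "\<And>x. \<bar>a x\<bar> \<le> norm (f x)" for a :: "real^3 \<Rightarrow> real"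
  proof (rule Bochner_Integration.integrable_bound)
    show "integrable lborel (\<lambda>x. (norm (f x))\<^sup>2)" using f by (simp add: L2_iff)
    show "AE x in lborel. norm (a x * \<bar>a x\<bar>) \<le> norm ((norm (f x))\<^sup>2)"
      using power_mono[OF that(2), of _ 2] by (auto simp: power2_eq_square abs_mult)
  qed (use that in auto)
  let ?R = "\<lambda>x. Re (f x) * \<bar>Re (f x)\<bar>" and ?I = "\<lambda>x. Im (f x) * \<bar>Im (f x)\<bar>"
  have R: "integrable lborel ?R" by (rule *) (use f in \<open>auto simp: L2_iff abs_Re_le_cmod\<close>)
  have I: "integrable lborel ?I" by (rule *) (use f in \<open>auto simp: L2_iff abs_Im_le_cmod\<close>)
  obtain d1 where d1: "d1 > 0" "\<And>h. norm h < d1 \<Longrightarrow> (LINT x|lborel. norm (?R (x + h) - ?R x)) < e/4"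
    using L1_translation_continuous[OF R, of "e/4"] e by auto
  obtain d2 where d2: "d2 > 0" "\<And>h. norm h < d2 \<Longrightarrow> (LINT x|lborel. norm (?I (x + h) - ?I x)) < e/4"
    using L1_translation_continuous[OF I, of "e/4"] e by auto
  show ?thesis
  proof (intro exI[of _ "min d1 d2"] conjI allI impI)
    fix h :: "real^3" assume h: "norm h < min d1 d2"
    have i: "integrable lborel (\<lambda>x. norm (?R (x + h) - ?R x))" "integrable lborel (\<lambda>x. norm (?I (x + h) - ?I x))"
      using integrable_lborel_translate[OF R, of h] integrable_lborel_translate[OF I, of h] R I by auto
    have "(LINT x|lborel. (norm (f (x + h) - f x))\<^sup>2)
        \<le> (LINT x|lborel. 2 * norm (?R (x + h) - ?R x) + 2 * norm (?I (x + h) - ?I x))"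
    proof (rule integral_mono)
      show "integrable lborel (\<lambda>x. (norm (f (x + h) - f x))\<^sup>2)"
        using L2_diff[OF L2_translate[OF f, of h] f] by (simp add: L2_iff)
      show "(norm (f (x + h) - f x))\<^sup>2 \<le> 2 * norm (?R (x + h) - ?R x) + 2 * norm (?I (x + h) - ?I x)" for x
        using power2_diff_le_abs_square[of "Re (f (x + h))" "Re (f x)"]
          power2_diff_le_abs_square[of "Im (f (x + h))" "Im (f x)"]
        by (simp add: cmod_power2)
    qed (use i in auto)
    also have "\<dots> = 2 * (LINT x|lborel. norm (?R (x + h) - ?R x)) + 2 * (LINT x|lborel. norm (?I (x + h) - ?I x))"
      using i by simp
    also have "\<dots> < e" using d1(2)[of h] d2(2)[of h] h by simp
    finally show "(LINT x|lborel. (norm (f (x + h) - f x))\<^sup>2) < e" .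
  qed (use d1 d2 in auto)
qed

section \<open>Product test functions\<close>

primrec times_diff :: "nat \<Rightarrow> (real \<Rightarrow> real) \<Rightarrow> bool" where
  "times_diff 0 f = True"
| "times_diff (Suc n) f = (\<exists>f'. (\<forall>x. (f has_real_derivative f' x) (at x)) \<and> times_diff n f')"

lemma times_diff_SucI:
  assumes "\<And>x. (f has_real_derivative f' x) (at x)" "times_diff n f'"
  shows "times_diff (Suc n) f"
  unfolding times_diff.simps by (rule exI[of _ f']) (use assms in simp)

definition smooth :: "(real \<Rightarrow> real) \<Rightarrow> bool" where
  "smooth f \<longleftrightarrow> (\<forall>n. times_diff n f)"

lemma times_diff_Suc_D: "times_diff (Suc n) f \<Longrightarrow> times_diff n f"
  by (induction n arbitrary: f) auto

lemma times_diff_add: "times_diff n f \<Longrightarrow> times_diff n g \<Longrightarrow> times_diff n (\<lambda>x. f x + g x)"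
proof (induction n arbitrary: f g)
  case (Suc n)
  then obtain f' g' where "\<forall>x. (f has_real_derivative f' x) (at x)" "times_diff n f'"
     "\<forall>x. (g has_real_derivative g' x) (at x)" "times_diff n g'" by auto
  then show ?case using Suc.IH[of f' g'] by (auto intro!: exI[of _ "\<lambda>x. f' x + g' x"] derivative_eq_intros)
qed simp

lemma times_diff_mult: "times_diff n f \<Longrightarrow> times_diff n g \<Longrightarrow> times_diff n (\<lambda>x. f x * g x)"
proof (induction n arbitrary: f g)
  case (Suc n)
  then obtain f' g' where *: "\<forall>x. (f has_real_derivative f' x) (at x)" "times_diff n f'"
     "\<forall>x. (g has_real_derivative g' x) (at x)" "times_diff n g'" by auto
  have "times_diff n (\<lambda>x. f' x * g x + f x * g' x)"
    using Suc.prems[THEN times_diff_Suc_D] * Suc.IH by (intro times_diff_add) auto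
  then show ?case using * by (auto intro!: exI[of _ "\<lambda>x. f' x * g x + f x * g' x"] derivative_eq_intros)
qed simp

lemma times_diff_affine: "times_diff n f \<Longrightarrow> times_diff n (\<lambda>x. f (a * x + b))"
proof (induction n arbitrary: f)
  case (Suc n)
  then obtain f' where *: "\<forall>x. (f has_real_derivative f' x) (at x)" "times_diff n f'" by auto
  have c: "times_diff m (\<lambda>_. c)" for m c by (induction m arbitrary: c) (auto intro!: exI[of _ "\<lambda>_. 0"])
  have "times_diff n (\<lambda>x. f' (a * x + b) * a)"
    using Suc.IH[OF *(2)] c by (rule times_diff_mult)
  moreover have "((\<lambda>x. f (a * x + b)) has_real_derivative f' (a * x + b) * a) (at x)" for x
    using *(1) by (auto intro!: DERIV_chain2[where f=f] derivative_eq_intros)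
  ultimately show ?case by (rule times_diff_SucI[rotated])
qed simp

lemma times_diff_const: "times_diff n (\<lambda>_. c)"
  by (induction n arbitrary: c) (auto intro!: exI[of _ "\<lambda>_. 0"])

lemma smooth_mult: "smooth f \<Longrightarrow> smooth g \<Longrightarrow> smooth (\<lambda>x. f x * g x)"
  by (simp add: smooth_def times_diff_mult)

lemma smooth_affine: "smooth f \<Longrightarrow> smooth (\<lambda>x. f (a * x + b))"
  by (simp add: smooth_def times_diff_affine)

lemma smooth_has_deriv:
  assumes "smooth f"
  shows "(f has_real_derivative deriv f x) (at x)"
proof -
  have "times_diff (Suc 0) f" using assms unfolding smooth_def by blast
  then obtain f' where "\<forall>x. (f has_real_derivative f' x) (at x)" by auto
  then show ?thesis by (metis DERIV_imp_deriv)
qed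

lemma smooth_deriv:
  assumes "smooth f"
  shows "smooth (deriv f)"
  unfolding smooth_def
proof
  fix n
  have "times_diff (Suc n) f" using assms unfolding smooth_def by blast
  then obtain f' where "\<forall>x. (f has_real_derivative f' x) (at x)" "times_diff n f'" by auto
  moreover from this have "deriv f = f'" by (auto dest: DERIV_imp_deriv)
  ultimately show "times_diff n (deriv f)" by simp
qed

lemma smooth_continuous_on: "smooth f \<Longrightarrow> continuous_on A f"
  by (meson DERIV_isCont continuous_at_imp_continuous_on smooth_has_deriv)

lemma smooth_sin_cos: "smooth (\<lambda>x. c * sin (a * x))" "smooth (\<lambda>x. c * cos (a * x))"
proof -
  have "times_diff n (\<lambda>x. c * sin (a * x)) \<and> times_diff n (\<lambda>x. c * cos (a * x))" for n c
  proof (induction n arbitrary: c)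
    case (Suc n)
    have "((\<lambda>x. c * sin (a * x)) has_real_derivative (c * a) * cos (a * x)) (at x)" for x
      by (auto intro!: derivative_eq_intros)
    moreover have "((\<lambda>x. c * cos (a * x)) has_real_derivative (- c * a) * sin (a * x)) (at x)" for x
      by (auto intro!: derivative_eq_intros)
    ultimately show ?case using Suc[of "c * a"] Suc[of "- c * a"]
      by (auto simp del: times_diff.simps intro: times_diff_SucI[where f'="\<lambda>x. c * a * cos (a * x)"]
          times_diff_SucI[where f'="\<lambda>x. - c * a * sin (a * x)"])
  qed simp
  then show "smooth (\<lambda>x. c * sin (a * x))" "smooth (\<lambda>x. c * cos (a * x))" by (simp_all add: smooth_def)
qed

text \<open>Dividing by powers of x makes the family closed, up to linear combinations, under
  differentiation, so that smoothness is an induction over all \<open>k\<close> at once.\<close>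

definition flat_exp :: "nat \<Rightarrow> real \<Rightarrow> real" where
  "flat_exp k x = (if x > 0 then exp (- (1 / x)) / x ^ k else 0)"

lemma flat_exp_tendsto_0: "(flat_exp k \<longlongrightarrow> 0) (at 0)"
proof -
  have "((\<lambda>x. flat_exp k x) \<longlongrightarrow> 0) (at_right 0)"
  proof -
    have "((\<lambda>y. y ^ k / exp y) \<longlongrightarrow> (0::real)) at_top" by (rule tendsto_power_div_exp_0)
    then have "((\<lambda>x. inverse x ^ k / exp (inverse x)) \<longlongrightarrow> (0::real)) (at_right 0)"
      by (rule filterlim_compose[OF _ filterlim_inverse_at_top_right])
    then show ?thesis
      by (rule Lim_transform_eventually)
        (auto simp: flat_exp_def eventually_at_right_less exp_minus field_simps intro!: eventually_mono[OF eventually_at_right_less])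
  qed
  moreover have "((\<lambda>x. flat_exp k x) \<longlongrightarrow> 0) (at_left 0)"
    by (rule Lim_transform_eventually[OF tendsto_const])
       (auto simp: flat_exp_def eventually_at_filter)
  ultimately show ?thesis by (simp add: filterlim_split_at)
qed

lemma flat_exp_has_deriv:
  "(flat_exp k has_real_derivative flat_exp (k + 2) x - real k * flat_exp (Suc k) x) (at x)"
proof -
  consider "x > 0" | "x < 0" | "x = 0" by linarith
  then show ?thesis
  proof cases
    case 1
    have "((\<lambda>x. exp (- (1 / x)) / x ^ k) has_real_derivative flat_exp (k + 2) x - real k * flat_exp (Suc k) x) (at x)"
    proof (rule DERIV_cong)
      show "((\<lambda>x. exp (- (1 / x)) / x ^ k) has_real_derivative
          (exp (- (1 / x)) * (1 / x\<^sup>2) * x ^ k - exp (- (1 / x)) * (real k * x ^ (k - 1))) / (x ^ k * x ^ k)) (at x)"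
        using 1 by (auto intro!: derivative_eq_intros simp: power2_eq_square divide_simps)
      have k: "real k * x ^ (k - 1) = real k * x ^ k / x" using 1 by (cases k) auto
      show "(exp (- (1 / x)) * (1 / x\<^sup>2) * x ^ k - exp (- (1 / x)) * (real k * x ^ (k - 1))) / (x ^ k * x ^ k)
          = flat_exp (k + 2) x - real k * flat_exp (Suc k) x"
        unfolding k using 1 by (simp add: flat_exp_def divide_simps power2_eq_square) (simp add: algebra_simps)
    qed
    then show ?thesis
      by (rule has_field_derivative_transform_within_open[where S="{0<..}"])
         (use 1 in \<open>auto simp: flat_exp_def\<close>)
  next
    case 2
    have "((\<lambda>x. 0) has_real_derivative 0) (at x)" by simp
    then have "(flat_exp k has_real_derivative 0) (at x)"
      by (rule has_field_derivative_transform_within_open[where S="{..<0}"])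
         (use 2 in \<open>auto simp: flat_exp_def\<close>)
    then show ?thesis using 2 by (simp add: flat_exp_def)
  next
    case 3
    \<comment> \<open>The difference quotient at 0 is again a member of the family,
      \<open>flat_exp (Suc k)\<close>.\<close>
    have "((\<lambda>h. (flat_exp k (0 + h) - flat_exp k 0) / h) \<longlongrightarrow> 0) (at 0)"
      by (rule Lim_transform_eventually[OF flat_exp_tendsto_0[of "Suc k"]])
         (auto simp: flat_exp_def eventually_at_filter)
    then show ?thesis using 3 by (simp add: DERIV_def flat_exp_def)
  qed
qed

lemma smooth_flat_exp: "smooth (flat_exp k)"
proof -
  have "times_diff n (flat_exp k)" for n
  proof (induction n arbitrary: k)
    case (Suc n)
    have "times_diff n (\<lambda>x. flat_exp (k + 2) x + (- real k) * flat_exp (Suc k) x)"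
      by (intro times_diff_add times_diff_mult times_diff_const Suc)
    then show ?case by (intro times_diff_SucI[OF flat_exp_has_deriv]) simp
  qed simp
  then show ?thesis by (simp add: smooth_def)
qed

text \<open>\<open>n\<close> sharpens both edges: the functions stay between 0 and 1 and converge to
  the indicator of the open interval from a to b.\<close>

definition bump :: "real \<Rightarrow> real \<Rightarrow> nat \<Rightarrow> real \<Rightarrow> real" where
  "bump a b n x = flat_exp 0 (real n * (x - a)) * flat_exp 0 (real n * (b - x))"

lemma smooth_bump: "smooth (bump a b n)"
proof -
  have "bump a b n = (\<lambda>x. flat_exp 0 (real n * x + (- real n * a)) * flat_exp 0 (- real n * x + real n * b))"
    by (auto simp: bump_def fun_eq_iff algebra_simps)
  then show ?thesis by (simp only: smooth_mult smooth_affine smooth_flat_exp)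
qed

lemma bump_bounds: "0 \<le> bump a b n x" "bump a b n x \<le> 1"
proof -
  have "0 \<le> flat_exp 0 y" "flat_exp 0 y \<le> 1" for y by (auto simp: flat_exp_def)
  then show "0 \<le> bump a b n x" "bump a b n x \<le> 1" by (auto simp: bump_def intro: mult_le_one)
qed

lemma bump_outside: "x \<le> a \<or> b \<le> x \<Longrightarrow> bump a b n x = 0"
  by (auto simp: bump_def flat_exp_def zero_less_mult_iff)

lemma bump_tendsto: "(\<lambda>n. bump a b n x) \<longlonglongrightarrow> indicator {a<..<b} x"
proof (cases "a < x \<and> x < b")
  case True
  have "(\<lambda>n. flat_exp 0 (real n * c)) \<longlonglongrightarrow> 1" if "c > 0" for c
  proof -
    have "(\<lambda>n. exp (- (inverse c * inverse (real n)))) \<longlonglongrightarrow> exp (- (inverse c * 0))"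
      by (intro tendsto_intros lim_inverse_n)
    then have "(\<lambda>n. exp (- (inverse c * inverse (real n)))) \<longlonglongrightarrow> 1" by simp
    then show ?thesis
      by (rule Lim_transform_eventually)
         (use that in \<open>auto simp: flat_exp_def field_simps intro!: eventually_mono[OF eventually_gt_at_top[of 0]]\<close>)
  qed
  from tendsto_mult[OF this[of "x - a"] this[of "b - x"]] show ?thesis
    using True by (simp add: bump_def[abs_def])
next
  case False
  then show ?thesis by (subst bump_outside) auto
qed

text \<open>Products are the only test functions used. They approximate indicators of boxes, while
  partial derivatives, translations along an axis and weights in one coordinate each act on a single
  factor.\<close>

definition tensor :: "(3 \<Rightarrow> real \<Rightarrow> real) \<Rightarrow> real^3 \<Rightarrow> real" where
  "tensor h x = (\<Prod>j\<in>UNIV. h j (x $ j))"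

definition test_factors :: "(3 \<Rightarrow> real \<Rightarrow> real) set" where
  "test_factors = {h. \<forall>j. smooth (h j) \<and> (\<exists>c. \<forall>s. \<bar>s\<bar> > c \<longrightarrow> h j s = 0)}"

definition dfactor :: "3 \<Rightarrow> (3 \<Rightarrow> real \<Rightarrow> real) \<Rightarrow> 3 \<Rightarrow> real \<Rightarrow> real" where
  "dfactor i h = h(i := deriv (h i))"

lemma tensor_split: "tensor h x = h i (x $ i) * (\<Prod>j\<in>UNIV - {i}. h j (x $ j))"
  unfolding tensor_def by (subst prod.remove[of _ i]) auto

lemma tensor_upd: "tensor (h(i := k)) x = k (x $ i) * (\<Prod>j\<in>UNIV - {i}. h j (x $ j))"
  by (subst tensor_split[of _ _ i]) (auto intro!: prod.cong)

lemma tensor_has_derivative: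
  assumes "\<And>j. smooth (h j)"
  shows "(tensor h has_derivative (\<lambda>v. \<Sum>i\<in>UNIV. v $ i * tensor (dfactor i h) x)) (at x)"
proof -
  have "((\<lambda>x. h j (x $ j)) has_derivative (\<lambda>v. deriv (h j) (x $ j) * v $ j)) (at x)" for j
    by (rule has_derivative_compose[OF bounded_linear.has_derivative[OF bounded_linear_vec_nth has_derivative_ident]])
       (use smooth_has_deriv[OF assms, of j "x $ j"] in \<open>simp add: has_field_derivative_def\<close>)
  then have "((\<lambda>x. \<Prod>j\<in>UNIV. h j (x $ j)) has_derivative
      (\<lambda>v. \<Sum>i\<in>UNIV. (deriv (h i) (x $ i) * v $ i) * (\<Prod>j\<in>UNIV - {i}. h j (x $ j)))) (at x)"
    by (intro has_derivative_prod)
  moreover have "tensor h = (\<lambda>x. \<Prod>j\<in>UNIV. h j (x $ j))" by (simp add: tensor_def fun_eq_iff)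
  ultimately show ?thesis by (simp add: dfactor_def tensor_upd mult_ac)
qed

lemma dfactor_test_factors:
  assumes "h \<in> test_factors"
  shows "dfactor i h \<in> test_factors"
proof -
  have "\<exists>c. \<forall>s. \<bar>s\<bar> > c \<longrightarrow> deriv (h i) s = 0"
  proof -
    obtain c where c: "\<And>s. \<bar>s\<bar> > c \<Longrightarrow> h i s = 0" using assms by (auto simp: test_factors_def)
    have "deriv (h i) s = 0" if "\<bar>s\<bar> > c" for s
    proof -
      have "((\<lambda>_. 0) has_real_derivative 0) (at s)" by simp
      then have "(h i has_real_derivative 0) (at s)"
        by (rule has_field_derivative_transform_within_open[where S="{s. \<bar>s\<bar> > c}"])
           (use that c in \<open>auto intro!: open_Collect_less continuous_intros\<close>)
      then show ?thesis by (rule DERIV_imp_deriv)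
    qed
    then show ?thesis by auto
  qed
  then show ?thesis using assms by (auto simp: test_factors_def dfactor_def smooth_deriv)
qed

lemma tensor_continuous:
  assumes "h \<in> test_factors"
  shows "continuous_on A (tensor h)"
  using tensor_has_derivative assms
  by (metis (no_types, lifting) continuous_at_imp_continuous_on has_derivative_continuous test_factors_def mem_Collect_eq)

lemma tensor_measurable:
  assumes "h \<in> test_factors"
  shows "tensor h \<in> borel_measurable borel"
  using borel_measurable_continuous_onI tensor_continuous[OF assms] by blast

lemma tensor_compact_support:
  assumes "h \<in> test_factors"
  shows "\<exists>c. \<forall>x. norm x > c \<longrightarrow> tensor h x = 0"
proof -
  have "\<exists>c. \<forall>j. \<forall>s. \<bar>s\<bar> > c j \<longrightarrow> h j s = 0" using assms by (auto simp: test_factors_def intro: choice)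
  then obtain c where c: "\<And>j s. \<bar>s\<bar> > c j \<Longrightarrow> h j s = 0" by blast
  have "tensor h x = 0" if "norm x > (\<Sum>j\<in>UNIV. c j)" for x
  proof -
    have "(\<Sum>j\<in>UNIV. c j) < (\<Sum>j\<in>UNIV. \<bar>x $ j\<bar>)" using that norm_le_l1_cart[of x] by linarith
    then obtain j where "c j < \<bar>x $ j\<bar>" by (meson not_le sum_mono)
    then show ?thesis using c by (auto simp: tensor_def)
  qed
  then show ?thesis by blast
qed

lemma tensor_bounded:
  assumes "h \<in> test_factors"
  shows "\<exists>B. \<forall>x. \<bar>tensor h x\<bar> \<le> B"
proof -
  obtain c where c: "\<And>x. norm x > c \<Longrightarrow> tensor h x = 0" using tensor_compact_support[OF assms] by blast
  have "compact (tensor h ` cball 0 c)"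
    by (intro compact_continuous_image tensor_continuous assms) auto
  then obtain B where "\<forall>x\<in>cball 0 c. \<bar>tensor h x\<bar> \<le> B"
    by (auto dest!: compact_imp_bounded simp: bounded_iff)
  then have B: "\<And>x. x \<in> cball 0 c \<Longrightarrow> \<bar>tensor h x\<bar> \<le> B" by blast
  have "\<bar>tensor h x\<bar> \<le> max B 0" for x using B[of x] c[of x] by (cases "norm x > c") (auto simp: le_max_iff_disj)
  then show ?thesis by blast
qed

lemma tensor_L2:
  assumes "h \<in> test_factors"
  shows "(\<lambda>x. of_real (tensor h x)) \<in> L2"
proof -
  obtain c where c: "\<And>x. norm x > c \<Longrightarrow> tensor h x = 0" using tensor_compact_support[OF assms] by blast
  obtain B where B: "\<And>x. \<bar>tensor h x\<bar> \<le> B" using tensor_bounded[OF assms] by blast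
  have "integrable lborel (\<lambda>x::real^3. B\<^sup>2 * indicator (cball 0 c) x)"
    by (intro integrable_mult_right integrable_real_indicator)
       (auto intro: emeasure_bounded_finite[unfolded infinity_ennreal_def])
  then have "integrable lborel (\<lambda>x. (norm (complex_of_real (tensor h x)))\<^sup>2)"
  proof (rule Bochner_Integration.integrable_bound)
    show "AE x in lborel. norm ((norm (complex_of_real (tensor h x)))\<^sup>2) \<le> norm (B\<^sup>2 * indicat_real (cball 0 c) x)"
    proof (rule AE_I2)
      fix x
      show "norm ((norm (complex_of_real (tensor h x)))\<^sup>2) \<le> norm (B\<^sup>2 * indicat_real (cball 0 c) x)"
        using power_mono[OF B[of x], of 2] c[of x] by (cases "norm x > c") (auto simp: indicator_def)
    qed
  qed (use tensor_measurable[OF assms] in auto)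
  then show ?thesis using tensor_measurable[OF assms] by (simp add: L2_iff)
qed

lemma tensor_partial_deriv:
  assumes "h \<in> test_factors"
  shows "partial_deriv i (\<lambda>x. of_real (tensor h x)) = (\<lambda>x. of_real (tensor (dfactor i h) x))"
    and "(\<lambda>x. complex_of_real (tensor h x)) differentiable (at x)"
proof -
  have d: "((\<lambda>x. complex_of_real (tensor h x)) has_derivative
     (\<lambda>v. of_real (\<Sum>i\<in>UNIV. v $ i * tensor (dfactor i h) x))) (at x)" for x
    using assms by (intro bounded_linear.has_derivative[OF bounded_linear_of_real] tensor_has_derivative)
      (auto simp: test_factors_def)
  then show "(\<lambda>x. complex_of_real (tensor h x)) differentiable (at x)" by (rule differentiableI)
  have "(\<Sum>k\<in>UNIV. axis i 1 $ k * tensor (dfactor k h) x) = tensor (dfactor i h) x" for x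
    by (simp add: axis_def if_distrib[of "\<lambda>a. a * _"] cong: if_cong)
  then show "partial_deriv i (\<lambda>x. of_real (tensor h x)) = (\<lambda>x. of_real (tensor (dfactor i h) x))"
    using frechet_derivative_at[OF d, symmetric] by (auto simp: partial_deriv_def fun_eq_iff simp flip: of_real_sum of_real_mult)
qed

lemma tensor_partial_derivs:
  assumes "h \<in> test_factors"
  shows "partial_derivs js (\<lambda>x. of_real (tensor h x)) = (\<lambda>x. of_real (tensor (foldr dfactor js h) x))"
    and "foldr dfactor js h \<in> test_factors"
proof (induction js)
  case (Cons j js)
  { case 1 show ?case using Cons by (simp add: tensor_partial_deriv) }
  { case 2 show ?case using Cons by (simp add: dfactor_test_factors) }
qed (use assms in auto)

lemma tensor_test_function:
  assumes "h \<in> test_factors"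
  shows "(\<lambda>x. of_real (tensor h x)) \<in> test_functions"
proof -
  obtain c where c: "\<And>x. norm x > c \<Longrightarrow> tensor h x = 0" using tensor_compact_support[OF assms] by blast
  have "\<exists>K. compact K \<and> (\<forall>x. x \<notin> K \<longrightarrow> complex_of_real (tensor h x) = 0)"
    by (intro exI[of _ "cball 0 c"]) (auto simp: c)
  then show ?thesis unfolding test_functions_def
    by (auto simp: tensor_partial_derivs[OF assms] tensor_partial_deriv)
qed

text \<open>Symmetry of second derivatives is immediate for products, and from here it passes to
  weak second derivatives.\<close>

lemma dfactor_commute: "dfactor i (dfactor j h) = dfactor j (dfactor i h)"
  by (cases "i = j") (auto simp: dfactor_def fun_upd_twist)

section \<open>Weak derivatives\<close>

text \<open>Tested only against products, hence implied by \<open>is_weak_deriv\<close>; by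
  \<open>test_factors_AE_zero\<close> such tests still separate functions up to null sets.\<close>

definition wderiv :: "3 \<Rightarrow> (real^3 \<Rightarrow> complex) \<Rightarrow> (real^3 \<Rightarrow> complex) \<Rightarrow> bool" where
  "wderiv i f g \<longleftrightarrow> (\<forall>h\<in>test_factors. (LINT x|lborel. f x * of_real (tensor (dfactor i h) x)) =
     - (LINT x|lborel. g x * of_real (tensor h x)))"

text \<open>Membership in \<open>H2\<close> speaks about derivatives of \<open>f\<close> alone;
  moving one derivative onto the test function turns the second derivative of \<open>f\<close> into
  a derivative of \<open>v\<close>. One function serves for both orders of differentiation, and it
  is the very choice \<open>weak_deriv\<close> that occurs in \<open>laplacian\<close>.\<close>

lemma H2_weak_derivs:
  assumes "f \<in> H2"
  shows "\<exists>v. (\<forall>i. v i \<in> L2 \<and> wderiv i f (v i)) \<and>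
    (\<forall>i j. weak_deriv [i, j] f \<in> L2 \<and> wderiv i (v j) (weak_deriv [i, j] f) \<and>
       wderiv j (v i) (weak_deriv [i, j] f))"
proof -
  have ex: "weak_deriv js f \<in> L2 \<and> is_weak_deriv js f (weak_deriv js f)" if "length js \<le> 2" for js
  proof -
    have "\<exists>g. g \<in> L2 \<and> is_weak_deriv js f g" using assms that by (auto simp: H2_def)
    then show ?thesis unfolding weak_deriv_def by (rule someI_ex)
  qed
  have w: "(LINT x|lborel. f x * of_real (tensor (foldr dfactor js h) x)) =
     (-1) ^ length js * (LINT x|lborel. weak_deriv js f x * of_real (tensor h x))"
    if "length js \<le> 2" "h \<in> test_factors" for js h
  proof -
    have "is_weak_deriv js f (weak_deriv js f)" using ex[OF that(1)] ..
    from bspec[OF this[unfolded is_weak_deriv_def] tensor_test_function[OF that(2)]]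
    show ?thesis by (simp only: tensor_partial_derivs(1)[OF that(2)])
  qed
  have 1: "(LINT x|lborel. f x * of_real (tensor (dfactor i h) x)) =
     - (LINT x|lborel. weak_deriv [i] f x * of_real (tensor h x))" if "h \<in> test_factors" for i h
    using w[of "[i]", OF _ that] by simp
  have 2: "(LINT x|lborel. f x * of_real (tensor (dfactor i (dfactor j h)) x)) =
     (LINT x|lborel. weak_deriv [i, j] f x * of_real (tensor h x))" if "h \<in> test_factors" for i j h
    using w[of "[i, j]", OF _ that] by simp
  show ?thesis
  proof (intro exI[of _ "\<lambda>i. weak_deriv [i] f"] conjI allI)
    fix i j
    have 3: "(LINT x|lborel. weak_deriv [k] f x * of_real (tensor (dfactor l h) x)) =
       - (LINT x|lborel. f x * of_real (tensor (dfactor k (dfactor l h)) x))"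
      if "h \<in> test_factors" for k l h
      using 1[OF dfactor_test_factors[OF that]] by simp
    show "wderiv i (weak_deriv [j] f) (weak_deriv [i, j] f)"
      unfolding wderiv_def by (simp add: 2 3 dfactor_commute[of j i])
    show "wderiv j (weak_deriv [i] f) (weak_deriv [i, j] f)"
      unfolding wderiv_def by (simp add: 2 3)
    show "weak_deriv [i] f \<in> L2" "weak_deriv [i, j] f \<in> L2" using ex by simp_all
    show "wderiv i f (weak_deriv [i] f)" unfolding wderiv_def using 1 by blast
  qed
qed

text \<open>The positive and the negative part of \<open>G\<close>, taken as densities, give two
  measures that agree on boxes. Boxes form a generator stable under intersection, so the measures
  coincide, and densities are unique almost everywhere.\<close>

lemma AE_zero_of_box_integrals_real:
  fixes G :: "'a::euclidean_space \<Rightarrow> real"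
  assumes [measurable]: "G \<in> borel_measurable borel"
    and int: "\<And>l u. integrable lborel (\<lambda>x. indicator (box l u) x * G x)"
    and zero: "\<And>l u. (LINT x|lborel. indicator (box l u) x * G x) = 0"
  shows "AE x in lborel. G x = 0"
proof -
  let ?P = "\<lambda>l u. (\<integral>\<^sup>+x. ennreal (G x) * indicator (box l u) x \<partial>lborel)"
  let ?M = "\<lambda>l u. (\<integral>\<^sup>+x. ennreal (- G x) * indicator (box l u) x \<partial>lborel)"
  have nn: "(?P l u) = (?M l u)"
    and fin: "(?P l u) < \<infinity>" for l u
  proof -
    let ?H = "\<lambda>x. indicator (box l u) x * G x"
    have p: "(?P l u) = (\<integral>\<^sup>+x. ennreal (?H x) \<partial>lborel)"
      by (intro nn_integral_cong) (auto simp: indicator_def)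
    have m: "(?M l u) = (\<integral>\<^sup>+x. ennreal (- ?H x) \<partial>lborel)"
      by (intro nn_integral_cong) (auto simp: indicator_def)
    have f: "(\<integral>\<^sup>+x. ennreal (?H x) \<partial>lborel) < \<infinity>" "(\<integral>\<^sup>+x. ennreal (- ?H x) \<partial>lborel) < \<infinity>"
      using int[of l u] by (auto simp: real_integrable_def less_top)
    have "enn2real (\<integral>\<^sup>+x. ennreal (?H x) \<partial>lborel) = enn2real (\<integral>\<^sup>+x. ennreal (- ?H x) \<partial>lborel)"
      using real_lebesgue_integral_def[OF int[of l u]] zero[of l u] by simp
    then have "(\<integral>\<^sup>+x. ennreal (?H x) \<partial>lborel) = (\<integral>\<^sup>+x. ennreal (- ?H x) \<partial>lborel)"
      using f by (metis ennreal_enn2real infinity_ennreal_def)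
    then show "(?P l u) = (?M l u)"
      "(?P l u) < \<infinity>" using p m f by auto
  qed
  have "density lborel (\<lambda>x. ennreal (G x)) = density lborel (\<lambda>x. ennreal (- G x))"
  proof (rule measure_eqI_generator_eq)
    let ?E = "range (\<lambda>(a, b). box a b::'a set)"
    show "Int_stable ?E" by (auto simp: Int_stable_def box_Int_box)
    show "?E \<subseteq> Pow UNIV" by simp
    show "sets (density lborel (\<lambda>x. ennreal (G x))) = sigma_sets UNIV ?E"
      "sets (density lborel (\<lambda>x. ennreal (- G x))) = sigma_sets UNIV ?E"
      by (simp_all add: borel_eq_box)
    let ?A = "\<lambda>n::nat. box (- (real n *\<^sub>R One)) (real n *\<^sub>R One) :: 'a set"
    show "range ?A \<subseteq> ?E" "(\<Union>i. ?A i) = UNIV" unfolding UN_box_eq_UNIV by auto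
    show "emeasure (density lborel (\<lambda>x. ennreal (G x))) (?A i) \<noteq> \<infinity>" for i
      using fin by (simp add: emeasure_density less_top)
    show "emeasure (density lborel (\<lambda>x. ennreal (G x))) X = emeasure (density lborel (\<lambda>x. ennreal (- G x))) X"
      if "X \<in> ?E" for X
      using that nn by (auto simp: emeasure_density)
  qed
  then have "AE x in lborel. ennreal (G x) = ennreal (- G x)"
    by (intro sigma_finite_measure.density_unique[OF sigma_finite_lborel]) auto
  then show ?thesis
  proof eventually_elim
    case (elim x)
    then show ?case by (metis ennreal_eq_0_iff le_cases neg_le_0_iff_le order_antisym)
  qed
qed

lemma AE_zero_of_box_integrals:
  fixes F :: "'a::euclidean_space \<Rightarrow> complex"
  assumes [measurable]: "F \<in> borel_measurable borel"
    and int: "\<And>l u. integrable lborel (\<lambda>x. indicat_real (box l u) x *\<^sub>R F x)"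
    and zero: "\<And>l u. (LINT x|lborel. indicat_real (box l u) x *\<^sub>R F x) = 0"
  shows "AE x in lborel. F x = 0"
proof -
  have "AE x in lborel. Re (F x) = 0"
  proof (rule AE_zero_of_box_integrals_real)
    show "integrable lborel (\<lambda>x. indicator (box l u) x * Re (F x))" for l u
      using integrable_Re[OF int[of l u]] by simp
    show "(LINT x|lborel. indicator (box l u) x * Re (F x)) = 0" for l u
      using integral_Re[OF int[of l u]] zero[of l u] by simp
  qed measurable
  moreover have "AE x in lborel. Im (F x) = 0"
  proof (rule AE_zero_of_box_integrals_real)
    show "integrable lborel (\<lambda>x. indicator (box l u) x * Im (F x))" for l u
      using integrable_Im[OF int[of l u]] by simp
    show "(LINT x|lborel. indicator (box l u) x * Im (F x)) = 0" for l u
      using integral_Im[OF int[of l u]] zero[of l u] by simp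
  qed measurable
  ultimately show ?thesis by eventually_elim (simp add: complex_eq_iff)
qed

text \<open>Products of bumps converge boundedly to the indicator of a box, so the integral of
  \<open>F\<close> over each box vanishes.\<close>

lemma test_factors_AE_zero:
  fixes F :: "real^3 \<Rightarrow> complex"
  assumes [measurable]: "F \<in> borel_measurable borel"
    and int: "\<And>l u. integrable lborel (\<lambda>x. indicat_real (box l u) x *\<^sub>R F x)"
    and zero: "\<And>h. h \<in> test_factors \<Longrightarrow> (LINT x|lborel. F x * of_real (tensor h x)) = 0"
  shows "AE x in lborel. F x = 0"
proof (rule AE_zero_of_box_integrals[OF _ int])
  fix l u :: "real^3"
  define h where "h n j = bump (l $ j) (u $ j) n" for n and j :: 3
  have h: "h n \<in> test_factors" for n
  proof -
    have "\<exists>c. \<forall>s. \<bar>s\<bar> > c \<longrightarrow> h n j s = 0" for j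
      unfolding h_def by (rule exI[of _ "max \<bar>l $ j\<bar> \<bar>u $ j\<bar>"]) (auto intro!: bump_outside)
    then show ?thesis by (auto simp: test_factors_def h_def smooth_bump)
  qed
  have mem: "x \<in> box l u \<longleftrightarrow> (\<forall>j. x $ j \<in> {l $ j<..<u $ j})" for x by (auto simp: mem_box_cart)
  have ind: "(\<Prod>j\<in>UNIV. indicat_real {l $ j<..<u $ j} (x $ j)) = indicator (box l u) x" for x
    using mem[of x] by (cases "x \<in> box l u") (auto simp: indicator_def)
  have "(\<lambda>n. LINT x|lborel. F x * of_real (tensor (h n) x)) \<longlonglongrightarrow> (LINT x|lborel. indicat_real (box l u) x *\<^sub>R F x)"
  proof (rule integral_dominated_convergence[OF _ _ integrable_norm[OF int[of l u]]])
    show "(\<lambda>x. F x * of_real (tensor (h n) x)) \<in> borel_measurable lborel" for n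
      using tensor_measurable[OF h[of n]] by measurable
    show "AE x in lborel. (\<lambda>n. F x * of_real (tensor (h n) x)) \<longlonglongrightarrow> indicat_real (box l u) x *\<^sub>R F x"
    proof (rule AE_I2)
      fix x :: "real^3"
      have "(\<lambda>n. tensor (h n) x) \<longlonglongrightarrow> (\<Prod>j\<in>UNIV. indicat_real {l $ j<..<u $ j} (x $ j))"
        unfolding tensor_def h_def by (intro tendsto_prod bump_tendsto)
      then have "(\<lambda>n. F x * of_real (tensor (h n) x)) \<longlonglongrightarrow> F x * of_real (indicat_real (box l u) x)"
        unfolding ind by (intro tendsto_intros)
      then show "(\<lambda>n. F x * of_real (tensor (h n) x)) \<longlonglongrightarrow> indicat_real (box l u) x *\<^sub>R F x"
        by (simp add: scaleR_conv_of_real mult.commute)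
    qed
    show "AE x in lborel. norm (F x * of_real (tensor (h n) x)) \<le> norm (indicat_real (box l u) x *\<^sub>R F x)" for n
    proof (rule AE_I2)
      fix x :: "real^3"
      have "\<bar>tensor (h n) x\<bar> \<le> indicat_real (box l u) x"
      proof (cases "x \<in> box l u")
        case True
        have "0 \<le> tensor (h n) x" "tensor (h n) x \<le> 1"
          unfolding tensor_def h_def by (auto intro!: prod_nonneg prod_le_1 simp: bump_bounds)
        then show ?thesis using True by simp
      next
        case False
        then obtain j where "\<not> x $ j \<in> {l $ j<..<u $ j}" using mem by blast
        then have "h n j (x $ j) = 0" unfolding h_def by (intro bump_outside) auto
        then have "tensor (h n) x = 0" unfolding tensor_def by (intro prod_zero) auto
        then show ?thesis by simp
      qed
      from mult_left_mono[OF this, of "norm (F x)"]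
      show "norm (F x * of_real (tensor (h n) x)) \<le> norm (indicat_real (box l u) x *\<^sub>R F x)"
        by (simp add: norm_mult mult.commute)
    qed
  qed measurable
  then show "(LINT x|lborel. indicat_real (box l u) x *\<^sub>R F x) = 0"
    using zero[OF h] by (simp add: LIMSEQ_const_iff)
qed measurable

section \<open>Weak derivatives as increments along lines\<close>

lemma L2_line_integrable:
  assumes v: "v \<in> L2" and k: "k \<in> L2"
  shows "integrable (lborel \<Otimes>\<^sub>M lborel) (\<lambda>(r, x). indicat_real {a..b} r *\<^sub>R (v (x + r *\<^sub>R e) * k x))"
proof -
  let ?F = "(\<lambda>(r, x). indicat_real {a..b} r *\<^sub>R (v (x + r *\<^sub>R e) * k x))"
  have [measurable]: "v \<in> borel_measurable borel" "k \<in> borel_measurable borel"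
    using v k by (auto simp: L2_iff)
  define C where "C = (LINT x|lborel. (norm (v x))\<^sup>2) + (LINT x|lborel. (norm (k x))\<^sup>2)"
  have vi: "integrable lborel (\<lambda>x. (norm (v x))\<^sup>2)" and ki: "integrable lborel (\<lambda>x. (norm (k x))\<^sup>2)"
    using v k by (auto simp: L2_iff)
  \<comment> \<open>The bound does not depend on the shift, because the L^2 norm is translation
    invariant; integrating it over a bounded range of shifts is then harmless.\<close>
  have le: "(\<integral>\<^sup>+x. ennreal (norm (v (x + c) * k x)) \<partial>lborel) \<le> ennreal C" for c
  proof -
    have "(\<integral>\<^sup>+x. ennreal (norm (v (x + c) * k x)) \<partial>lborel)
      \<le> (\<integral>\<^sup>+x. ennreal ((norm (v (x + c)))\<^sup>2) + ennreal ((norm (k x))\<^sup>2) \<partial>lborel)"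
    proof (rule nn_integral_mono)
      fix x
      have "norm (v (x + c) * k x) \<le> (norm (v (x + c)))\<^sup>2 + (norm (k x))\<^sup>2"
        using sum_squares_bound[of "norm (v (x + c))" "norm (k x)"]
          mult_nonneg_nonneg[OF norm_ge_zero[of "v (x + c)"] norm_ge_zero[of "k x"]]
        unfolding norm_mult mult.assoc by linarith
      then show "ennreal (norm (v (x + c) * k x)) \<le> ennreal ((norm (v (x + c)))\<^sup>2) + ennreal ((norm (k x))\<^sup>2)"
        by (simp add: ennreal_leI flip: ennreal_plus)
    qed
    also have "\<dots> = (\<integral>\<^sup>+x. ennreal ((norm (v (x + c)))\<^sup>2) \<partial>lborel) + (\<integral>\<^sup>+x. ennreal ((norm (k x))\<^sup>2) \<partial>lborel)"
      by (intro nn_integral_add) auto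
    also have "(\<integral>\<^sup>+x. ennreal ((norm (v (x + c)))\<^sup>2) \<partial>lborel) = (\<integral>\<^sup>+x. ennreal ((norm (v x))\<^sup>2) \<partial>lborel)"
      by (intro nn_integral_lborel_translate[where f="\<lambda>x. ennreal ((norm (v x))\<^sup>2)"]) auto
    also have "\<dots> + (\<integral>\<^sup>+x. ennreal ((norm (k x))\<^sup>2) \<partial>lborel) = ennreal C"
      unfolding C_def using vi ki by (subst (1 2) nn_integral_eq_integral) (auto simp flip: ennreal_plus)
    finally show ?thesis .
  qed
  show ?thesis
  proof (rule integrableI_bounded)
    show "?F \<in> borel_measurable (lborel \<Otimes>\<^sub>M lborel)"
      by measurable
    have "(\<integral>\<^sup>+p. ennreal (norm (?F p)) \<partial>(lborel \<Otimes>\<^sub>M lborel))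
      = (\<integral>\<^sup>+r. \<integral>\<^sup>+x. ennreal (norm (indicat_real {a..b} r *\<^sub>R (v (x + r *\<^sub>R e) * k x))) \<partial>lborel \<partial>lborel)"
      by (subst lborel.nn_integral_fst[symmetric]) auto
    also have "\<dots> = (\<integral>\<^sup>+r. indicator {a..b} r * (\<integral>\<^sup>+x. ennreal (norm (v (x + r *\<^sub>R e) * k x)) \<partial>lborel) \<partial>lborel)"
      by (intro nn_integral_cong) (auto simp: indicator_def)
    also have "\<dots> \<le> (\<integral>\<^sup>+r. indicator {a..b} r * ennreal C \<partial>lborel)"
      by (intro nn_integral_mono mult_left_mono le) auto
    also have "\<dots> < \<infinity>" by (subst nn_integral_multc) (auto simp: ennreal_mult_less_top emeasure_lborel_Icc_eq)
    finally show "(\<integral>\<^sup>+p. ennreal (norm (?F p)) \<partial>(lborel \<Otimes>\<^sub>M lborel)) < \<infinity>" .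
  qed
qed

lemma box_indicator_L2: "(\<lambda>x. complex_of_real (indicator (box l u) x)) \<in> L2"
proof -
  have "integrable lborel (indicat_real (box l u))"
    by (intro integrable_real_indicator) (auto simp: emeasure_lborel_box_eq)
  moreover have "(norm (complex_of_real (indicator (box l u) x)))\<^sup>2 = indicator (box l u) x" for x :: "real^3"
    by (auto simp: indicator_def)
  ultimately show ?thesis by (simp add: L2_iff)
qed

definition shift_factor :: "3 \<Rightarrow> real \<Rightarrow> (3 \<Rightarrow> real \<Rightarrow> real) \<Rightarrow> 3 \<Rightarrow> real \<Rightarrow> real" where
  "shift_factor i r h = h(i := (\<lambda>s. h i (s + r)))"

lemma tensor_shift: "tensor (shift_factor i r h) x = tensor h (x + r *\<^sub>R axis i 1)"
  unfolding shift_factor_def tensor_upd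
  by (subst tensor_split[of h _ i]) (auto intro!: prod.cong arg_cong2[where f="(*)"] simp: axis_def)

lemma shift_factor_test:
  assumes "h \<in> test_factors"
  shows "shift_factor i r h \<in> test_factors"
proof -
  obtain c where c: "\<And>s. \<bar>s\<bar> > c \<Longrightarrow> h i s = 0" using assms by (auto simp: test_factors_def)
  have "\<exists>c. \<forall>s. \<bar>s\<bar> > c \<longrightarrow> h i (s + r) = 0"
    by (rule exI[of _ "c + \<bar>r\<bar>"]) (auto intro!: c)
  moreover have "smooth (\<lambda>s. h i (s + r))"
    using smooth_affine[of "h i" 1 r] assms by (simp add: test_factors_def)
  ultimately show ?thesis using assms by (auto simp: test_factors_def shift_factor_def)
qed

lemma dfactor_shift:
  assumes "h \<in> test_factors"
  shows "dfactor i (shift_factor i r h) = shift_factor i r (dfactor i h)"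
proof -
  have "deriv (\<lambda>s. h i (s + r)) s = deriv (h i) (s + r)" for s
  proof (rule DERIV_imp_deriv)
    have "smooth (h i)" using assms by (simp add: test_factors_def)
    from smooth_has_deriv[OF this, of "s + r"]
    show "((\<lambda>s. h i (s + r)) has_real_derivative deriv (h i) (s + r)) (at s)"
      by (simp add: DERIV_shift)
  qed
  then show ?thesis by (auto simp: dfactor_def shift_factor_def fun_eq_iff)
qed

lemma tensor_line_has_deriv:
  assumes "h \<in> test_factors"
  shows "((\<lambda>r. tensor h (x + r *\<^sub>R axis i 1)) has_real_derivative tensor (dfactor i h) (x + r *\<^sub>R axis i 1)) (at r)"
proof -
  have h: "smooth (h i)" using assms by (simp add: test_factors_def)
  have "((\<lambda>r. h i (x $ i + r) * (\<Prod>j\<in>UNIV - {i}. h j (x $ j))) has_real_derivative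
     deriv (h i) (x $ i + r) * (\<Prod>j\<in>UNIV - {i}. h j (x $ j))) (at r)"
    using smooth_has_deriv[OF h, of "x $ i + r"]
    by (intro DERIV_cmult_right) (simp add: DERIV_shift[of "h i"] add.commute)
  moreover have "tensor h (x + r *\<^sub>R axis i 1) = h i (x $ i + r) * (\<Prod>j\<in>UNIV - {i}. h j (x $ j))" for h r
    using tensor_shift[of i r h x] by (simp add: shift_factor_def tensor_upd)
  ultimately show ?thesis by (simp add: dfactor_def)
qed

text \<open>Both sides are paired with a product test function. By translation invariance the shift
  and the derivative move onto the smooth factor, where the classical fundamental theorem of
  calculus applies along each line.\<close>

lemma wderiv_line:
  assumes f: "f \<in> L2" and v: "v \<in> L2" and w: "wderiv i f v" and ab: "a \<le> b"
  defines "e \<equiv> axis i 1 :: real^3"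
  shows "AE x in lborel. f (x + b *\<^sub>R e) - f (x + a *\<^sub>R e) = (LINT r|lborel. indicat_real {a..b} r *\<^sub>R v (x + r *\<^sub>R e))"
proof -
  define W where "W x = (LINT r|lborel. indicat_real {a..b} r *\<^sub>R v (x + r *\<^sub>R e))" for x
  have [measurable]: "v \<in> borel_measurable borel" "f \<in> borel_measurable borel"
    using v f by (auto simp: L2_iff)
  have [measurable]: "W \<in> borel_measurable borel" unfolding W_def by measurable
  have Wk: "integrable lborel (\<lambda>x. W x * k x)"
    "(LINT x|lborel. W x * k x) = (LINT r|lborel. indicat_real {a..b} r *\<^sub>R (LINT x|lborel. v (x + r *\<^sub>R e) * k x))"
    if "k \<in> L2" for k
  proof -
    \<comment> \<open>On lines where the integral of \<open>v\<close> diverges and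
      \<open>k x\<close> is nonzero, both sides are the default value 0.\<close>
    have eq: "W x * k x = (LINT r|lborel. indicat_real {a..b} r *\<^sub>R (v (x + r *\<^sub>R e) * k x))" for x
      unfolding W_def by (cases "k x = 0") (simp_all flip: integral_mult_left_zero mult_scaleR_left)
    show "integrable lborel (\<lambda>x. W x * k x)"
      unfolding eq by (rule lborel_pair.integrable_snd[OF L2_line_integrable[OF v that]])
    show "(LINT x|lborel. W x * k x) = (LINT r|lborel. indicat_real {a..b} r *\<^sub>R (LINT x|lborel. v (x + r *\<^sub>R e) * k x))"
      unfolding eq using lborel_pair.Fubini_integral[OF L2_line_integrable[OF v that, of a b e]] by simp
  qed
  define F where "F x = f (x + b *\<^sub>R e) - f (x + a *\<^sub>R e)" for x
  have FL2: "F \<in> L2" unfolding F_def by (intro L2_diff L2_translate f)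
  have "AE x in lborel. F x - W x = 0"
  proof (rule test_factors_AE_zero)
    show "(\<lambda>x. F x - W x) \<in> borel_measurable borel" unfolding F_def by measurable
    fix l u :: "real^3"
    have "integrable lborel (\<lambda>x. F x * complex_of_real (indicator (box l u) x) - W x * complex_of_real (indicator (box l u) x))"
      by (intro Bochner_Integration.integrable_diff L2_mult_integrable FL2 Wk(1) box_indicator_L2)
    then show "integrable lborel (\<lambda>x. indicat_real (box l u) x *\<^sub>R (F x - W x))"
      by (simp add: scaleR_conv_of_real algebra_simps)
  next
    fix h assume h: "h \<in> test_factors"
  let ?d = "\<lambda>r x. of_real (tensor (dfactor i h) (x + r *\<^sub>R (- e)))"
    have t: "(\<lambda>x. complex_of_real (tensor h x)) \<in> L2" and dt: "(\<lambda>x. complex_of_real (tensor (dfactor i h) x)) \<in> L2"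
      using h by (auto intro!: tensor_L2 dfactor_test_factors)
    have [measurable]: "tensor h \<in> borel_measurable borel" "tensor (dfactor i h) \<in> borel_measurable borel"
      using h by (auto intro!: tensor_measurable dfactor_test_factors)
    have "(LINT x|lborel. W x * of_real (tensor h x)) =
       (LINT r|lborel. indicat_real {a..b} r *\<^sub>R (LINT x|lborel. v (x + r *\<^sub>R e) * of_real (tensor h x)))"
      by (rule Wk(2)[OF t])
    also have "\<dots> = (LINT r|lborel. indicat_real {a..b} r *\<^sub>R
        (- (LINT x|lborel. (?d r x) * f x)))"
    proof (intro Bochner_Integration.integral_cong refl arg_cong2[where f=scaleR])
      fix r
      have "(LINT x|lborel. v (x + r *\<^sub>R e) * of_real (tensor h x)) =
         (LINT x|lborel. v (x + r *\<^sub>R e) * of_real (tensor h ((x + r *\<^sub>R e) - r *\<^sub>R e)))" by simp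
      also have "\<dots> = (LINT x|lborel. v x * of_real (tensor h (x - r *\<^sub>R e)))"
        by (rule integral_lborel_translate[where f="\<lambda>x. v x * of_real (tensor h (x - r *\<^sub>R e))"]) measurable
      also have "\<dots> = (LINT x|lborel. v x * of_real (tensor (shift_factor i (- r) h) x))"
        by (simp add: tensor_shift e_def)
      also have "\<dots> = - (LINT x|lborel. f x * of_real (tensor (dfactor i (shift_factor i (- r) h)) x))"
        using w shift_factor_test[OF h] by (simp add: wderiv_def)
      also have "\<dots> = - (LINT x|lborel. (?d r x) * f x)"
        by (simp add: dfactor_shift[OF h] tensor_shift e_def mult.commute)
      finally show "(LINT x|lborel. v (x + r *\<^sub>R e) * of_real (tensor h x)) =
        - (LINT x|lborel. (?d r x) * f x)" .
    qed
    also have "\<dots> = - (LINT r|lborel. LINT x|lborel. indicat_real {a..b} r *\<^sub>R ((?d r x) * f x))"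
      by simp
    also have "\<dots> = - (LINT x|lborel. LINT r|lborel. indicat_real {a..b} r *\<^sub>R ((?d r x) * f x))"
      using lborel_pair.Fubini_integral[OF L2_line_integrable[OF dt f, of a b "- e"]] by simp
    also have "\<dots> = - (LINT x|lborel. f x * of_real (tensor h (x - a *\<^sub>R e)) - f x * of_real (tensor h (x - b *\<^sub>R e)))"
    proof (intro arg_cong[where f=uminus] Bochner_Integration.integral_cong refl)
      fix x
      \<comment> \<open>The test function is evaluated at \<open>x - r *\<^sub>R e\<close>, so the
        primitive in \<open>r\<close> is minus \<open>tensor h\<close>.\<close>
      have "(LINT r|lborel. indicator {a..b} r *\<^sub>R tensor (dfactor i h) (x - r *\<^sub>R e)) =
        - tensor h (x - b *\<^sub>R e) - (- tensor h (x - a *\<^sub>R e))"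
      proof (rule integral_FTC_atLeastAtMost[OF ab])
        show "continuous_on {a..b} (\<lambda>r. tensor (dfactor i h) (x - r *\<^sub>R e))"
          by (intro continuous_on_compose2[OF tensor_continuous[OF dfactor_test_factors[OF h], of UNIV]] continuous_intros) auto
        show "((\<lambda>r. - tensor h (x - r *\<^sub>R e)) has_vector_derivative tensor (dfactor i h) (x - r *\<^sub>R e)) (at r within {a..b})" for r
        proof -
          have "((\<lambda>r. tensor h (x + (- r) *\<^sub>R axis i 1)) has_real_derivative
             tensor (dfactor i h) (x + (- r) *\<^sub>R axis i 1) * (- 1)) (at r within {a..b})"
            by (rule DERIV_chain2[where f="\<lambda>r. tensor h (x + r *\<^sub>R axis i 1)" and g=uminus])
               (auto intro!: tensor_line_has_deriv[OF h, of x i "- r", simplified] derivative_eq_intros)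
          from DERIV_minus[OF this] show ?thesis
            by (simp add: has_real_derivative_iff_has_vector_derivative e_def)
        qed
      qed
      then show "(LINT r|lborel. indicat_real {a..b} r *\<^sub>R ((?d r x) * f x)) =
         f x * of_real (tensor h (x - a *\<^sub>R e)) - f x * of_real (tensor h (x - b *\<^sub>R e))"
        by (simp add: scaleR_conv_of_real flip: of_real_mult mult.assoc) (simp add: algebra_simps)
    qed
    also have "\<dots> = (LINT x|lborel. f x * of_real (tensor h (x - b *\<^sub>R e))) - (LINT x|lborel. f x * of_real (tensor h (x - a *\<^sub>R e)))"
    proof -
      have "integrable lborel (\<lambda>x. f x * of_real (tensor h (x - c *\<^sub>R e)))" for c
        using L2_mult_integrable[OF f L2_translate[OF t, of "- (c *\<^sub>R e)"]] by simp
      then show ?thesis by simp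
    qed
    also have "\<dots> = (LINT x|lborel. F x * of_real (tensor h x))"
    proof -
      have 1: "(LINT x|lborel. f x * of_real (tensor h (x - c *\<^sub>R e))) = (LINT x|lborel. f (x + c *\<^sub>R e) * of_real (tensor h x))" for c
        using integral_lborel_translate[of "\<lambda>x. f x * of_real (tensor h (x - c *\<^sub>R e))" "c *\<^sub>R e"] by simp
      have 2: "integrable lborel (\<lambda>x. f (x + c *\<^sub>R e) * of_real (tensor h x))" for c
        by (intro L2_mult_integrable L2_translate f t)
      show ?thesis unfolding 1 F_def using 2 by (simp add: left_diff_distrib)
    qed
    finally have "(LINT x|lborel. W x * of_real (tensor h x)) = (LINT x|lborel. F x * of_real (tensor h x))" .
    then show "(LINT x|lborel. (F x - W x) * of_real (tensor h x)) = 0"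
      using L2_mult_integrable[OF FL2 t] Wk(1)[OF t] by (simp add: left_diff_distrib)
  qed
  then show ?thesis by eventually_elim (simp add: F_def W_def)
qed

text \<open>A single bound for the first-order Taylor remainder, valid for all steps of length at
  most \<open>M\<close> together. A shear moves different points by different amounts, so a bound
  for each fixed step would not do.\<close>

definition osc :: "(real^3 \<Rightarrow> complex) \<Rightarrow> 3 \<Rightarrow> real \<Rightarrow> real^3 \<Rightarrow> ennreal" where
  "osc v i M x = (\<integral>\<^sup>+r. indicator {- M..M} r * ennreal (norm (v (x + r *\<^sub>R axis i 1) - v x)) \<partial>lborel)"

lemma osc_measurable [measurable]: 
  assumes [measurable]: "v \<in> borel_measurable borel"
  shows "osc v i M \<in> borel_measurable borel"
  unfolding osc_def by measurable

lemma line_average_osc: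
  fixes v :: "real^3 \<Rightarrow> complex" and i :: 3
  assumes [measurable]: "v \<in> borel_measurable borel" and ab: "a \<le> b" "{a..b} \<subseteq> {- M..M}"
  defines "e \<equiv> axis i 1 :: real^3"
  shows "ennreal (norm ((LINT r|lborel. indicat_real {a..b} r *\<^sub>R v (x + r *\<^sub>R e)) - (b - a) *\<^sub>R v x)) \<le> osc v i M x"
\<comment> \<open>Where the oscillation is infinite the claim is trivial; where it is finite, the
  integral along the segment converges and is not a default value.\<close>
proof (cases "osc v i M x = \<infinity>")
  case False
  let ?G = "\<lambda>r. indicat_real {a..b} r *\<^sub>R (v (x + r *\<^sub>R e) - v x)"
  have le: "(\<integral>\<^sup>+r. ennreal (norm (?G r)) \<partial>lborel) \<le> osc v i M x"
    unfolding osc_def e_def[symmetric]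
    by (intro nn_integral_mono) (use ab in \<open>auto simp: indicator_def\<close>)
  have G: "integrable lborel ?G"
    by (rule integrableI_bounded) (use le False in \<open>auto simp: less_top intro: le_less_trans\<close>)
  have c: "has_bochner_integral lborel (\<lambda>r. indicat_real {a..b} r *\<^sub>R v x) ((b - a) *\<^sub>R v x)"
    using ab(1) has_bochner_integral_scaleR_left[OF has_bochner_integral_real_indicator[of "{a..b}" lborel], of "v x"]
    by simp
  have "(LINT r|lborel. indicat_real {a..b} r *\<^sub>R v (x + r *\<^sub>R e))
     = (LINT r|lborel. ?G r + indicat_real {a..b} r *\<^sub>R v x)"
    by (intro Bochner_Integration.integral_cong) (auto simp: scaleR_diff_right)
  also have "\<dots> = (LINT r|lborel. ?G r) + (b - a) *\<^sub>R v x"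
    using G c by (subst Bochner_Integration.integral_add) (auto simp: has_bochner_integral_iff)
  finally have "norm ((LINT r|lborel. indicat_real {a..b} r *\<^sub>R v (x + r *\<^sub>R e)) - (b - a) *\<^sub>R v x) = norm (LINT r|lborel. ?G r)"
    by simp
  also have "ennreal \<dots> \<le> (\<integral>\<^sup>+r. ennreal (norm (?G r)) \<partial>lborel)" by (rule integral_norm_bound_ennreal[OF G])
  also note le
  finally show ?thesis .
qed simp

lemma wderiv_difference_osc:
  assumes f: "f \<in> L2" and v: "v \<in> L2" and w: "wderiv i f v" and s: "\<bar>s\<bar> \<le> M"
  shows "AE x in lborel. ennreal (norm (f (x + s *\<^sub>R axis i 1) - f x - s *\<^sub>R v x)) \<le> osc v i M x"
proof (cases "s \<ge> 0")
  case True
  show ?thesis using wderiv_line[OF f v w True]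
  proof eventually_elim
    case (elim x)
    then show ?case using line_average_osc[of v 0 s M x i] True s v by (auto simp: L2_iff)
  qed
next
  case False
  then have "s \<le> 0" by simp
  from wderiv_line[OF f v w this] show ?thesis
  proof eventually_elim
    case (elim x)
    have "norm (f (x + s *\<^sub>R axis i 1) - f x - s *\<^sub>R v x) = norm (f x - f (x + s *\<^sub>R axis i 1) - (0 - s) *\<^sub>R v x)"
      by (subst norm_minus_cancel[symmetric]) (simp add: algebra_simps)
    then show ?case using line_average_osc[of v s 0 M x i] False s v elim by (auto simp: L2_iff)
  qed
qed

text \<open>The Taylor remainder is o(M) when paired with an L^2 function. After Tonelli the inner
  integral compares \<open>v\<close> with a translate by less than \<open>d\<close> and is at most
  e/2 by continuity of translations; the segment has length 2 M.\<close>

lemma osc_pairing_small: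
  assumes v: "v \<in> L2" and W: "W \<in> L2" and e: "e > 0"
  shows "\<exists>d>0. \<forall>M. 0 < M \<and> M < d \<longrightarrow> (\<integral>\<^sup>+x. ennreal (norm (W x)) * osc v i M x \<partial>lborel) \<le> ennreal (e * M)"
proof -
  have [measurable]: "v \<in> borel_measurable borel" "W \<in> borel_measurable borel" using v W by (auto simp: L2_iff)
  define K where "K = (LINT x|lborel. (norm (W x))\<^sup>2)"
  have K: "K \<ge> 0" unfolding K_def by simp
  \<comment> \<open>Weight for the inequality a b <= c a^2 + b^2 / c: the first term contributes at
    most e/4, and a translation error below c e/4 makes the second one at most e/4 as well.\<close>
  define c where "c = e / (4 * (K + 1))"
  have c: "c > 0" "c * K \<le> e / 4" using e K by (auto simp: c_def divide_simps)
  obtain d where d: "d > 0" "\<And>h. norm h < d \<Longrightarrow> (LINT x|lborel. (norm (v (x + h) - v x))\<^sup>2) < c * e / 4"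
    using L2_translation_continuous[OF v, of "c * e / 4"] c e by auto
  have le: "(\<integral>\<^sup>+x. ennreal (norm (W x)) * ennreal (norm (v (x + h) - v x)) \<partial>lborel) \<le> ennreal (e / 2)" if "norm h < d" for h
  proof -
    let ?D = "\<lambda>x. v (x + h) - v x"
    have D: "integrable lborel (\<lambda>x. (norm (?D x))\<^sup>2)"
      using L2_diff[OF L2_translate[OF v, of h] v] by (simp add: L2_iff)
    have "(\<integral>\<^sup>+x. ennreal (norm (W x)) * ennreal (norm (?D x)) \<partial>lborel)
       \<le> (\<integral>\<^sup>+x. ennreal (c * (norm (W x))\<^sup>2 + (norm (?D x))\<^sup>2 / c) \<partial>lborel)"
    proof (rule nn_integral_mono)
      fix x
      have "0 \<le> (c * norm (W x) - norm (?D x))\<^sup>2" by simp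
      then have "2 * c * norm (W x) * norm (?D x) \<le> c\<^sup>2 * (norm (W x))\<^sup>2 + (norm (?D x))\<^sup>2"
        by (simp add: power2_diff power_mult_distrib)
      then have "norm (W x) * norm (?D x) * c \<le> (c * (norm (W x))\<^sup>2 + (norm (?D x))\<^sup>2 / c) * c"
      proof -
        have "(c * (norm (W x))\<^sup>2 + (norm (?D x))\<^sup>2 / c) * c = c\<^sup>2 * (norm (W x))\<^sup>2 + (norm (?D x))\<^sup>2"
          using c by (simp add: distrib_right power2_eq_square)
        moreover have "0 \<le> c * norm (W x) * norm (?D x)" using c by simp
        moreover have "norm (W x) * norm (?D x) * c = c * norm (W x) * norm (?D x)" by simp
        ultimately show ?thesis
          using \<open>2 * c * norm (W x) * norm (?D x) \<le> c\<^sup>2 * (norm (W x))\<^sup>2 + (norm (?D x))\<^sup>2\<close>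
          by (simp only: mult.assoc)
      qed
      then have "norm (W x) * norm (?D x) \<le> c * (norm (W x))\<^sup>2 + (norm (?D x))\<^sup>2 / c"
        using c by (simp only: mult_le_cancel_right_pos)
      then show "ennreal (norm (W x)) * ennreal (norm (?D x)) \<le> ennreal (c * (norm (W x))\<^sup>2 + (norm (?D x))\<^sup>2 / c)"
        by (simp flip: ennreal_mult add: ennreal_leI)
    qed
    also have "\<dots> = ennreal (c * K + (LINT x|lborel. (norm (?D x))\<^sup>2) / c)"
      using W D c unfolding K_def by (subst nn_integral_eq_integral) (auto simp: L2_iff intro!: add_nonneg_nonneg)
    also have "\<dots> \<le> ennreal (e / 4 + e / 4)"
      using d(2)[OF that] c by (intro ennreal_leI add_mono) (auto simp: divide_simps mult_ac)
    finally show ?thesis by simp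
  qed
  show ?thesis
  proof (intro exI[of _ d] conjI allI impI d(1))
    fix M assume M: "0 < M \<and> M < d"
    have "(\<integral>\<^sup>+x. ennreal (norm (W x)) * osc v i M x \<partial>lborel)
      = (\<integral>\<^sup>+x. \<integral>\<^sup>+r. ennreal (norm (W x)) * (indicator {- M..M} r * ennreal (norm (v (x + r *\<^sub>R axis i 1) - v x))) \<partial>lborel \<partial>lborel)"
      unfolding osc_def by (intro nn_integral_cong nn_integral_cmult[symmetric]) measurable
    also have "\<dots> = (\<integral>\<^sup>+r. \<integral>\<^sup>+x. ennreal (norm (W x)) * (indicator {- M..M} r * ennreal (norm (v (x + r *\<^sub>R axis i 1) - v x))) \<partial>lborel \<partial>lborel)"
      by (rule lborel_pair.Fubini') measurable
    also have "\<dots> \<le> (\<integral>\<^sup>+r. indicator {- M..M} r * ennreal (e / 2) \<partial>lborel)"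
    proof (rule nn_integral_mono)
      fix r
      show "(\<integral>\<^sup>+x. ennreal (norm (W x)) * (indicator {- M..M} r * ennreal (norm (v (x + r *\<^sub>R axis i 1) - v x))) \<partial>lborel)
        \<le> indicator {- M..M} r * ennreal (e / 2)"
        using le[of "r *\<^sub>R axis i 1"] M by (cases "r \<in> {- M..M}") auto
    qed
    also have "\<dots> = ennreal (e * M)"
      using M e by (subst nn_integral_multc) (auto simp flip: ennreal_mult)
    finally show "(\<integral>\<^sup>+x. ennreal (norm (W x)) * osc v i M x \<partial>lborel) \<le> ennreal (e * M)" .
  qed
qed

text \<open>By translation invariance, a forward increment of \<open>f\<close> paired with
  \<open>g\<close> equals a backward increment of \<open>g\<close> paired with \<open>f\<close>.
  Dividing by the step and using \<open>osc_pairing_small\<close> on both sides gives the identity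
  without any approximation by smooth functions.\<close>

lemma wderiv_IBP:
  assumes f: "f \<in> L2" "f' \<in> L2" "wderiv i f f'" and g: "g \<in> L2" "g' \<in> L2" "wderiv i g g'"
  shows "(LINT x|lborel. f' x * g x) = - (LINT x|lborel. f x * g' x)"
proof -
  have [measurable]: "f \<in> borel_measurable borel" "f' \<in> borel_measurable borel"
    "g \<in> borel_measurable borel" "g' \<in> borel_measurable borel"
    using f g by (auto simp: L2_iff)
  have quot: "\<exists>d>0. \<forall>s. s \<noteq> 0 \<and> \<bar>s\<bar> < d \<longrightarrow>
      norm ((LINT x|lborel. (f (x + s *\<^sub>R axis i 1) - f x) * g x) - s *\<^sub>R (LINT x|lborel. f' x * g x)) \<le> e * \<bar>s\<bar>"
    if e: "e > 0" and f: "f \<in> L2" "f' \<in> L2" "wderiv i f f'" and g: "g \<in> L2" for e f f' g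
  proof -
    have [measurable]: "f \<in> borel_measurable borel" "f' \<in> borel_measurable borel" "g \<in> borel_measurable borel"
      using f g by (auto simp: L2_iff)
    obtain d where d: "d > 0" "\<And>M. 0 < M \<Longrightarrow> M < d \<Longrightarrow>
        (\<integral>\<^sup>+x. ennreal (norm (g x)) * osc f' i M x \<partial>lborel) \<le> ennreal (e * M)"
      using osc_pairing_small[OF f(2) g e, of i] by blast
    show ?thesis
    proof (intro exI[of _ d] conjI allI impI d(1))
      fix s :: real assume s: "s \<noteq> 0 \<and> \<bar>s\<bar> < d"
      let ?q = "\<lambda>x. f (x + s *\<^sub>R axis i 1) - f x - s *\<^sub>R f' x"
      have i1: "integrable lborel (\<lambda>x. (f (x + s *\<^sub>R axis i 1) - f x) * g x)"
        by (intro L2_mult_integrable L2_diff L2_translate f g)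
      have i2: "integrable lborel (\<lambda>x. f' x * g x)" by (intro L2_mult_integrable f g)
      have i3: "integrable lborel (\<lambda>x. ?q x * g x)"
        using Bochner_Integration.integrable_diff[OF i1 integrable_scaleR_right[OF i2, of s]]
        by (simp add: left_diff_distrib)
      have "(LINT x|lborel. (f (x + s *\<^sub>R axis i 1) - f x) * g x) - s *\<^sub>R (LINT x|lborel. f' x * g x)
         = (LINT x|lborel. ?q x * g x)"
        using i1 i2 by (simp add: left_diff_distrib)
      also have "ennreal (norm \<dots>) \<le> (\<integral>\<^sup>+x. ennreal (norm (?q x * g x)) \<partial>lborel)"
        by (rule integral_norm_bound_ennreal[OF i3])
      also have "\<dots> \<le> (\<integral>\<^sup>+x. ennreal (norm (g x)) * osc f' i \<bar>s\<bar> x \<partial>lborel)"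
        using wderiv_difference_osc[OF f, of s "\<bar>s\<bar>"]
        by (intro nn_integral_mono_AE)
           (auto simp: norm_mult ennreal_mult mult.commute[of "ennreal (norm (g _))"] intro!: mult_right_mono elim!: eventually_mono)
      also have "\<dots> \<le> ennreal (e * \<bar>s\<bar>)" using s by (intro d(2)) auto
      finally show "norm ((LINT x|lborel. (f (x + s *\<^sub>R axis i 1) - f x) * g x) - s *\<^sub>R (LINT x|lborel. f' x * g x)) \<le> e * \<bar>s\<bar>"
        using e by (subst (asm) ennreal_le_iff) auto
    qed
  qed
  let ?A = "(LINT x|lborel. f' x * g x) + (LINT x|lborel. g' x * f x)"
  have "norm ?A \<le> 2 * e" if e: "e > 0" for e
  proof -
    obtain d1 where d1: "d1 > 0" "\<And>s. s \<noteq> 0 \<Longrightarrow> \<bar>s\<bar> < d1 \<Longrightarrow>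
       norm ((LINT x|lborel. (f (x + s *\<^sub>R axis i 1) - f x) * g x) - s *\<^sub>R (LINT x|lborel. f' x * g x)) \<le> e * \<bar>s\<bar>"
      using quot[OF e f g(1)] by blast
    obtain d2 where d2: "d2 > 0" "\<And>s. s \<noteq> 0 \<Longrightarrow> \<bar>s\<bar> < d2 \<Longrightarrow>
       norm ((LINT x|lborel. (g (x + s *\<^sub>R axis i 1) - g x) * f x) - s *\<^sub>R (LINT x|lborel. g' x * f x)) \<le> e * \<bar>s\<bar>"
      using quot[OF e g f(1)] by blast
    define s where "s = min d1 d2 / 2"
    have s: "s > 0" "\<bar>s\<bar> < d1" "\<bar>- s\<bar> < d2" using d1(1) d2(1) by (auto simp: s_def)
    let ?X = "LINT x|lborel. (f (x + s *\<^sub>R axis i 1) - f x) * g x"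
    have "?X = (LINT x|lborel. f (x + s *\<^sub>R axis i 1) * g x) - (LINT x|lborel. f x * g x)"
      using L2_mult_integrable[OF L2_translate[OF f(1)] g(1), of "s *\<^sub>R axis i 1"] L2_mult_integrable[OF f(1) g(1)]
      by (simp add: left_diff_distrib)
    also have "(LINT x|lborel. f (x + s *\<^sub>R axis i 1) * g x) = (LINT x|lborel. g (x + (- s) *\<^sub>R axis i 1) * f x)"
      using integral_lborel_translate[of "\<lambda>x. g (x + (- s) *\<^sub>R axis i 1) * f x" "s *\<^sub>R axis i 1"]
      by (simp add: mult.commute)
    also have "(LINT x|lborel. g (x + (- s) *\<^sub>R axis i 1) * f x) - (LINT x|lborel. f x * g x) =
        (LINT x|lborel. (g (x + (- s) *\<^sub>R axis i 1) - g x) * f x)"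
      using L2_mult_integrable[OF L2_translate[OF g(1)] f(1), of "(- s) *\<^sub>R axis i 1"] L2_mult_integrable[OF g(1) f(1)]
      by (simp add: algebra_simps)
    finally have X: "?X = (LINT x|lborel. (g (x + (- s) *\<^sub>R axis i 1) - g x) * f x)" .
    have 1: "norm (?X - s *\<^sub>R (LINT x|lborel. f' x * g x)) \<le> e * s" using d1(2)[of s] s by simp
    have 2: "norm (?X + s *\<^sub>R (LINT x|lborel. g' x * f x)) \<le> e * s" unfolding X using d2(2)[of "- s"] s by simp
    have "s * norm ?A = norm (s *\<^sub>R ?A)" using s by simp
    also have "s *\<^sub>R ?A = (?X + s *\<^sub>R (LINT x|lborel. g' x * f x)) - (?X - s *\<^sub>R (LINT x|lborel. f' x * g x))"
      by (simp add: scaleR_add_right)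
    also have "norm \<dots> \<le> e * s + e * s" by (rule order.trans[OF norm_triangle_ineq4 add_mono[OF 2 1]])
    finally have "s * norm ?A \<le> s * (2 * e)" by (simp add: mult_ac)
    then show ?thesis using s by simp
  qed
  \<comment> \<open>With this e the bound says that the norm of \<open>?A\<close> is at most half of
    itself.\<close>
  from this[of "norm ?A / 4"] have "?A = 0" by (cases "?A = 0") auto
  then have "(LINT x|lborel. f' x * g x) = - (LINT x|lborel. g' x * f x)" by (simp add: add_eq_0_iff)
  then show ?thesis by (simp add: mult.commute)
qed

lemma wderiv_cnj:
  assumes "wderiv i f g" 
  shows "wderiv i (\<lambda>x. cnj (f x)) (\<lambda>x. cnj (g x))"
  unfolding wderiv_def
proof
  fix h assume "h \<in> test_factors"
  then have "(LINT x|lborel. f x * of_real (tensor (dfactor i h) x)) = - (LINT x|lborel. g x * of_real (tensor h x))"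
    using assms by (simp add: wderiv_def)
  moreover have "(LINT x|lborel. cnj (k x) * of_real (tensor h x)) = cnj (LINT x|lborel. k x * of_real (tensor h x))" for k h
    by (subst Bochner_Integration.integral_cnj[symmetric]) simp
  ultimately show "(LINT x|lborel. cnj (f x) * of_real (tensor (dfactor i h) x)) = - (LINT x|lborel. cnj (g x) * of_real (tensor h x))"
    by simp
qed

text \<open>A smooth weight in one coordinate can be absorbed into the corresponding factor of the
  test function, where the ordinary product rule holds. The bounds on \<open>a\<close> and
  \<open>deriv a\<close> keep all products in \<open>L2\<close>.\<close>

lemma wderiv_mult_smooth:
  assumes f: "f \<in> L2" "f' \<in> L2" "wderiv i f f'"
    and a: "smooth a" "\<And>s. \<bar>a s\<bar> \<le> A" "\<And>s. \<bar>deriv a s\<bar> \<le> A"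
  shows "wderiv i (\<lambda>x. of_real (a (x $ k)) * f x)
     (\<lambda>x. of_real (a (x $ k)) * f' x + (if i = k then of_real (deriv a (x $ k)) * f x else 0))"
  unfolding wderiv_def
proof
  fix h assume h: "h \<in> test_factors"
  have [measurable]: "a \<in> borel_measurable borel" "deriv a \<in> borel_measurable borel"
    using a(1) by (auto intro!: borel_measurable_continuous_onI smooth_continuous_on smooth_deriv)
  have [measurable]: "(\<lambda>x::real^3. x $ k) \<in> borel_measurable borel"
    by (intro borel_measurable_continuous_onI continuous_intros)
  have af: "(\<lambda>x. of_real (a (x $ k)) * g x) \<in> L2" "(\<lambda>x. of_real (deriv a (x $ k)) * g x) \<in> L2" if "g \<in> L2" for g
    using a that by (auto intro!: L2_mult_bounded[where C=A])
  define h2 where "h2 = h(k := (\<lambda>s. a s * h k s))"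
  have h2: "h2 \<in> test_factors"
    using h a(1) by (auto simp: test_factors_def h2_def intro!: smooth_mult) (metis mult_zero_right)
  have t2: "tensor h2 x = a (x $ k) * tensor h x" for x
    unfolding h2_def tensor_upd by (subst tensor_split[of h _ k]) simp
  have dt2: "tensor (dfactor i h2) x = a (x $ k) * tensor (dfactor i h) x + (if i = k then deriv a (x $ k) * tensor h x else 0)" for x
  proof (cases "i = k")
    case True
    have hk: "smooth (h k)" using h by (simp add: test_factors_def)
    have "deriv (\<lambda>s. a s * h k s) s = deriv a s * h k s + a s * deriv (h k) s" for s
      using DERIV_mult[OF smooth_has_deriv[OF a(1), of s] smooth_has_deriv[OF hk, of s]]
      by (intro DERIV_imp_deriv) (simp add: algebra_simps)
    then have "dfactor i h2 = h(k := (\<lambda>s. deriv a s * h k s + a s * deriv (h k) s))"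
      using True by (simp add: dfactor_def h2_def fun_eq_iff)
    then show ?thesis using True tensor_split[of h x k] by (simp add: tensor_upd dfactor_def algebra_simps)
  next
    case False
    have "dfactor i h2 = (dfactor i h)(k := (\<lambda>s. a s * h k s))"
      using False by (auto simp: dfactor_def h2_def)
    then show ?thesis using False tensor_split[of "dfactor i h" x k] by (simp add: tensor_upd) (simp add: dfactor_def)
  qed
  have t: "(\<lambda>x. complex_of_real (tensor h x)) \<in> L2" and dt: "(\<lambda>x. complex_of_real (tensor (dfactor i h) x)) \<in> L2"
    using h by (auto intro!: tensor_L2 dfactor_test_factors)
  have i1: "integrable lborel (\<lambda>x. of_real (a (x $ k)) * f x * of_real (tensor (dfactor i h) x))"
    by (intro L2_mult_integrable af f dt)
  have i2: "integrable lborel (\<lambda>x. of_real (deriv a (x $ k)) * f x * of_real (tensor h x))"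
    by (intro L2_mult_integrable af f t)
  have i3: "integrable lborel (\<lambda>x. of_real (a (x $ k)) * f' x * of_real (tensor h x))"
    by (intro L2_mult_integrable af f t)
  have "(LINT x|lborel. f x * of_real (tensor (dfactor i h2) x)) = - (LINT x|lborel. f' x * of_real (tensor h2 x))"
    using f(3) h2 by (simp add: wderiv_def)
  also have "(LINT x|lborel. f x * of_real (tensor (dfactor i h2) x)) =
      (LINT x|lborel. of_real (a (x $ k)) * f x * of_real (tensor (dfactor i h) x) +
         (if i = k then of_real (deriv a (x $ k)) * f x * of_real (tensor h x) else 0))"
    unfolding dt2 by (intro Bochner_Integration.integral_cong) (auto simp: algebra_simps)
  also have "\<dots> = (LINT x|lborel. of_real (a (x $ k)) * f x * of_real (tensor (dfactor i h) x)) +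
      (LINT x|lborel. (if i = k then of_real (deriv a (x $ k)) * f x * of_real (tensor h x) else 0))"
    using i1 i2 by (cases "i = k") simp_all
  also have "(LINT x|lborel. f' x * of_real (tensor h2 x)) = (LINT x|lborel. of_real (a (x $ k)) * f' x * of_real (tensor h x))"
    unfolding t2 by (intro Bochner_Integration.integral_cong) (auto simp: algebra_simps)
  finally show "(LINT x|lborel. of_real (a (x $ k)) * f x * of_real (tensor (dfactor i h) x)) =
    - (LINT x|lborel. (of_real (a (x $ k)) * f' x + (if i = k then of_real (deriv a (x $ k)) * f x else 0)) * of_real (tensor h x))"
    using i2 i3 by (cases "i = k") (simp_all add: distrib_right algebra_simps)
qed

lemma wderiv_IBP_weight:
  assumes f: "f \<in> L2" "f' \<in> L2" "wderiv i f f'" and g: "g \<in> L2" "g' \<in> L2" "wderiv i g g'"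
    and a: "smooth a" "\<And>s. \<bar>a s\<bar> \<le> A" "\<And>s. \<bar>deriv a s\<bar> \<le> A"
  shows "(LINT x|lborel. of_real (a (x $ k)) * (f' x * g x)) =
     - (LINT x|lborel. of_real (a (x $ k)) * (f x * g' x))
     - (if i = k then (LINT x|lborel. of_real (deriv a (x $ k)) * (f x * g x)) else 0)"
proof -
  let ?z = "\<lambda>x. (if i = k then of_real (deriv a (x $ k)) * g x else 0)"
  have [measurable]: "a \<in> borel_measurable borel" "deriv a \<in> borel_measurable borel"
    using a(1) by (auto intro!: borel_measurable_continuous_onI smooth_continuous_on smooth_deriv)
  have [measurable]: "(\<lambda>x::real^3. x $ k) \<in> borel_measurable borel"
    by (intro borel_measurable_continuous_onI continuous_intros)
  have af: "(\<lambda>x. of_real (a (x $ k)) * g x) \<in> L2" "(\<lambda>x. of_real (deriv a (x $ k)) * g x) \<in> L2" if "g \<in> L2" for g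
    using a that by (auto intro!: L2_mult_bounded[where C=A])
  have z: "(\<lambda>x. (?z x)) \<in> L2"
    using af(2)[OF g(1)] by (cases "i = k") (simp_all add: L2_iff)
  have "(LINT x|lborel. f' x * (of_real (a (x $ k)) * g x)) =
     - (LINT x|lborel. f x * (of_real (a (x $ k)) * g' x + (?z x)))"
    by (rule wderiv_IBP[OF f _ _ wderiv_mult_smooth[OF g a]]) (intro af L2_add g z)+
  also have "(LINT x|lborel. f x * (of_real (a (x $ k)) * g' x + (?z x))) =
    (LINT x|lborel. f x * (of_real (a (x $ k)) * g' x)) + (LINT x|lborel. f x * (?z x))"
    unfolding distrib_left by (intro Bochner_Integration.integral_add L2_mult_integrable f af g z)
  finally show ?thesis by (simp add: mult_ac)
qed

section \<open>The Riesz kernel\<close>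

lemma ball_measurable [measurable]: "ball c r \<in> sets borel" "cball c r \<in> sets borel"
  by simp_all

lemma ennreal_le_suminf: "f m \<le> (\<Sum>k. f k :: ennreal)"
  using sum_le_suminf[of f "{m}"] by simp

text \<open>The k-th ball has volume proportional to r^(3 k), so the series is dominated by a
  geometric one of ratio b r^3.\<close>

lemma nn_integral_dyadic_finite:
  fixes f :: "real^3 \<Rightarrow> ennreal"
  assumes f: "\<And>z. f z \<le> (\<Sum>k. ennreal (A * b ^ k) * indicator (cball 0 (R * r ^ k)) z)"
    and pos: "A \<ge> 0" "b \<ge> 0" "R \<ge> 0" "r \<ge> 0" "b * r ^ 3 < 1"
  shows "(\<integral>\<^sup>+z. f z \<partial>lborel) < \<infinity>"
proof -
  define V where "V = unit_ball_vol 3"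
  have "(\<integral>\<^sup>+z. f z \<partial>lborel) \<le> (\<integral>\<^sup>+z. (\<Sum>k. ennreal (A * b ^ k) * indicator (cball 0 (R * r ^ k)) (z::real^3)) \<partial>lborel)"
    by (intro nn_integral_mono f)
  also have "\<dots> = (\<Sum>k. \<integral>\<^sup>+z. ennreal (A * b ^ k) * indicator (cball 0 (R * r ^ k)) (z::real^3) \<partial>lborel)"
    by (intro nn_integral_suminf borel_measurable_times_ennreal borel_measurable_const borel_measurable_indicator) auto
  also have "\<dots> = (\<Sum>k. ennreal (A * V * R ^ 3 * (b * r ^ 3) ^ k))"
  proof (intro suminf_cong)
    fix k
    have "(\<integral>\<^sup>+z. ennreal (A * b ^ k) * indicator (cball 0 (R * r ^ k)) (z::real^3) \<partial>lborel)
      = ennreal (A * b ^ k) * emeasure lborel (cball (0::real^3) (R * r ^ k))"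
      by (rule nn_integral_cmult_indicator) simp
    also have "\<dots> = ennreal (A * b ^ k) * ennreal (V * (R * r ^ k) ^ 3)"
      using pos by (subst emeasure_cball) (auto simp: V_def)
    also have "\<dots> = ennreal (A * V * R ^ 3 * (b * r ^ 3) ^ k)"
      using pos unfolding V_def
      by (subst ennreal_mult[symmetric]) (auto simp: power_mult_distrib mult_ac power_mult[symmetric] intro!: mult_nonneg_nonneg)
    finally show "(\<integral>\<^sup>+z. ennreal (A * b ^ k) * indicator (cball 0 (R * r ^ k)) (z::real^3) \<partial>lborel)
      = ennreal (A * V * R ^ 3 * (b * r ^ 3) ^ k)" .
  qed
  also have "\<dots> < \<infinity>"
  proof -
    have "summable (\<lambda>k. A * V * R ^ 3 * (b * r ^ 3) ^ k)"
      using pos by (intro summable_mult summable_geometric) auto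
    then show ?thesis using pos
      by (subst suminf_ennreal2) (auto simp: V_def intro!: mult_nonneg_nonneg)
  qed
  finally show ?thesis .
qed

lemma nn_integral_norm_powr_near:
  assumes "0 \<le> \<gamma>" "\<gamma> < 3"
  shows "(\<integral>\<^sup>+z\<in>ball 0 1. ennreal (1 / norm (z::real^3) powr \<gamma>) \<partial>lborel) < \<infinity>"
proof (rule nn_integral_dyadic_finite[where A="2 powr \<gamma>" and b="2 powr \<gamma>" and R=1 and r="1/2"])
  have "2 powr \<gamma> < 2 powr (3::real)" using assms by (intro powr_less_mono) auto
  then show "2 powr \<gamma> * (1/2) ^ 3 < (1::real)" by (simp add: divide_simps)
  fix z :: "real^3"
  show "ennreal (1 / norm z powr \<gamma>) * indicator (ball 0 1) z
      \<le> (\<Sum>k. ennreal (2 powr \<gamma> * (2 powr \<gamma>) ^ k) * indicator (cball 0 (1 * (1/2) ^ k)) z)"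
  proof (cases "z \<noteq> 0 \<and> norm z < 1")
    case True
    \<comment> \<open>\<open>z\<close> lies in the shell 2^-(m+1) <= |z| <= 2^-m, so the m-th term
      of the series alone dominates.\<close>
    define m where "m = nat \<lfloor>- log 2 (norm z)\<rfloor>"
    have "log 2 (norm z) < 0" using True by simp
    then have m: "real m \<le> - log 2 (norm z)" "- log 2 (norm z) < real m + 1" unfolding m_def by linarith+
    have z: "norm z = 2 powr (log 2 (norm z))" using True by simp
    have "norm z \<le> 2 powr (- real m)" by (subst z) (use m in simp)
    moreover have "2 powr (- real m) = (1/2) ^ m"
      by (simp only: powr_minus powr_realpow power_one_over inverse_eq_divide zero_less_numeral)
    ultimately have 1: "norm z \<le> (1/2) ^ m" by simp
    have "norm z \<ge> 2 powr (- (real m + 1))" by (subst z) (use m in simp)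
    then have "norm z powr \<gamma> \<ge> (2 powr (- (real m + 1))) powr \<gamma>" using assms by (intro powr_mono2) auto
    then have "1 / norm z powr \<gamma> \<le> 1 / (2 powr (- (real m + 1))) powr \<gamma>"
      using True by (intro divide_left_mono) auto
    also have "\<dots> = 2 powr \<gamma> * (2 powr \<gamma>) ^ m"
    proof -
      have "(2 powr (- (real m + 1))) powr \<gamma> = 2 powr (- ((real m + 1) * \<gamma>))"
        by (simp only: powr_powr mult_minus_left)
      moreover have "2 powr \<gamma> * (2 powr \<gamma>) ^ m = 2 powr \<gamma> * (2 powr \<gamma>) powr real m"
        by (subst powr_realpow) auto
      moreover have "\<dots> = 2 powr ((real m + 1) * \<gamma>)"
        unfolding powr_powr powr_add[symmetric] by (simp add: algebra_simps)
      ultimately show ?thesis by (simp only: powr_minus_divide) simp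
    qed
    finally have 2: "1 / norm z powr \<gamma> \<le> 2 powr \<gamma> * (2 powr \<gamma>) ^ m" .
    have "ennreal (1 / norm z powr \<gamma>) * indicator (ball 0 1) z
      \<le> ennreal (2 powr \<gamma> * (2 powr \<gamma>) ^ m) * indicator (cball 0 (1 * (1/2) ^ m)) z"
      using True 1 2 by (simp add: ennreal_leI)
    also have "\<dots> \<le> (\<Sum>k. ennreal (2 powr \<gamma> * (2 powr \<gamma>) ^ k) * indicator (cball 0 (1 * (1/2) ^ k)) z)"
      by (rule ennreal_le_suminf[where f="\<lambda>k. ennreal (2 powr \<gamma> * (2 powr \<gamma>) ^ k) * indicator (cball 0 (1 * (1/2) ^ k)) z"])
    finally show ?thesis .
  \<comment> \<open>At the origin the integrand is 0, since 0 \<open>powr\<close> anything is 0 and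
    so is division by 0.\<close>
  qed (auto simp: powr_def)
qed simp_all

lemma nn_integral_norm_powr_far:
  assumes "\<gamma> > 3"
  shows "(\<integral>\<^sup>+z\<in>- ball 0 1. ennreal (1 / norm (z::real^3) powr \<gamma>) \<partial>lborel) < \<infinity>"
proof (rule nn_integral_dyadic_finite[where A=1 and b="2 powr (- \<gamma>)" and R=2 and r=2])
  have "2 powr (- \<gamma>) < 2 powr (- 3::real)" using assms by (intro powr_less_mono) auto
  then show "2 powr (- \<gamma>) * 2 ^ 3 < (1::real)" by (simp add: powr_minus divide_simps)
  fix z :: "real^3"
  show "ennreal (1 / norm z powr \<gamma>) * indicator (- ball 0 1) z
      \<le> (\<Sum>k. ennreal (1 * (2 powr (- \<gamma>)) ^ k) * indicator (cball 0 (2 * 2 ^ k)) z)"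
  proof (cases "norm z < 1")
    case False
    \<comment> \<open>The shell is 2^m <= |z| <= 2^(m+1); its outer radius explains the choice
      \<open>R = 2\<close>.\<close>
    define m where "m = nat \<lfloor>log 2 (norm z)\<rfloor>"
    have "norm z \<ge> 1" using False by simp
    then have "log 2 (norm z) \<ge> 0" using zero_le_log_cancel_iff[of 2 "norm z"] by linarith
    then have m: "real m \<le> log 2 (norm z)" "log 2 (norm z) < real m + 1" unfolding m_def by linarith+
    have z: "norm z = 2 powr (log 2 (norm z))" using False by (subst powr_log_cancel) auto
    have "norm z \<le> 2 powr (real m + 1)" by (subst z) (use m in simp)
    then have 1: "norm z \<le> 2 * 2 ^ m" by (simp add: powr_add powr_realpow)
    have "norm z \<ge> 2 powr (real m)" by (subst z) (use m in simp)
    then have "norm z powr \<gamma> \<ge> (2 powr (real m)) powr \<gamma>" using assms by (intro powr_mono2) auto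
    then have "1 / norm z powr \<gamma> \<le> 1 / (2 powr (real m)) powr \<gamma>"
      by (intro divide_left_mono mult_pos_pos) (use \<open>norm z \<ge> 1\<close> in auto)
    also have "\<dots> = 1 * (2 powr (- \<gamma>)) ^ m"
    proof -
      have "(2 powr real m) powr \<gamma> = 2 powr (real m * \<gamma>)" by (simp add: powr_powr)
      moreover have "(2 powr (- \<gamma>)) ^ m = (2 powr (- \<gamma>)) powr real m"
        by (subst powr_realpow) auto
      moreover have "\<dots> = 2 powr (- (real m * \<gamma>))" unfolding powr_powr by (simp add: mult.commute)
      ultimately show ?thesis by (simp add: powr_minus_divide)
    qed
    finally have 2: "1 / norm z powr \<gamma> \<le> 1 * (2 powr (- \<gamma>)) ^ m" .
    have "ennreal (1 / norm z powr \<gamma>) * indicator (- ball 0 1) z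
      \<le> ennreal (1 * (2 powr (- \<gamma>)) ^ m) * indicator (cball 0 (2 * 2 ^ m)) z"
      using False 1 2 by (simp add: ennreal_leI)
    also have "\<dots> \<le> (\<Sum>k. ennreal (1 * (2 powr (- \<gamma>)) ^ k) * indicator (cball 0 (2 * 2 ^ k)) z)"
      by (rule ennreal_le_suminf[where f="\<lambda>k. ennreal (1 * (2 powr (- \<gamma>)) ^ k) * indicator (cball 0 (2 * 2 ^ k)) z"])
    finally show ?thesis .
  qed auto
qed simp_all

section \<open>The Riesz potential as a mixture of Gaussians\<close>

locale riesz =
  fixes \<beta> :: real
  assumes beta: "0 < \<beta>" "\<beta> < 3"
begin

definition riesz_const :: real where
  "riesz_const = Gamma ((3 - \<beta>) / 2) / (Gamma (\<beta> / 2) * pi powr (3 / 2) * 2 powr \<beta>)"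

abbreviation ker :: "real^3 \<Rightarrow> real" where "ker \<equiv> riesz_potential \<beta>"

lemma riesz_const_pos: "riesz_const > 0"
  using beta unfolding riesz_const_def by (intro divide_pos_pos mult_pos_pos Gamma_real_pos) auto

lemma ker_eq: "ker x = riesz_const * (1 / norm x powr (3 - \<beta>))"
  by (simp add: riesz_potential_def riesz_const_def)

lemma ker_nonneg: "ker x \<ge> 0"
  using riesz_const_pos by (simp add: ker_eq)

lemma ker_measurable [measurable]: "ker \<in> borel_measurable borel"
  unfolding ker_eq[abs_def] by measurable

text \<open>Near \<open>x\<close> the function is bounded by continuity and the kernel is locally
  integrable. Away from \<open>x\<close>, put A = |x - y|^(-6) and G = |g y|^2: the integrand is a
  constant times A^((3-\<beta>)/6) G^((3+\<beta>)/6), the exponents add up to 1, and so it is at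
  most the constant times A + G. The critical exponent thus dictates the power 6, which is
  integrable at infinity.\<close>

lemma ker_powr_integral_finite:
  fixes g :: "real^3 \<Rightarrow> complex"
  assumes g: "continuous_on UNIV g" "g \<in> L2"
  shows "(\<integral>\<^sup>+y. ennreal (ker (x - y) * norm (g y) powr ((3 + \<beta>) / 3)) \<partial>lborel) < \<infinity>"
proof -
  have [measurable]: "g \<in> borel_measurable borel" using g by (simp add: L2_iff)
  define p where "p = (3 + \<beta>) / 3"
  have p: "p > 0" using beta by (simp add: p_def)
  have "compact ((\<lambda>y. norm (g y)) ` cball x 1)"
    using g(1) by (intro compact_continuous_image continuous_intros) (auto intro: continuous_on_subset)
  then obtain B where "\<forall>y\<in>cball x 1. norm (norm (g y)) \<le> B"
    by (auto dest!: compact_imp_bounded simp: bounded_iff)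
  then have B: "norm (g y) \<le> B" if "dist x y \<le> 1" for y using that by auto
  have B0: "B \<ge> 0" using B[of x] norm_ge_zero[of "g x"] by (simp del: norm_ge_zero)
  let ?N = "\<lambda>z. ennreal (1 / norm (z::real^3) powr (3 - \<beta>)) * indicator (ball 0 1) z"
  let ?F = "\<lambda>z. ennreal (1 / norm (z::real^3) powr 6) * indicator (- ball 0 1) z"
  have le: "ennreal (ker (x - y) * norm (g y) powr p) \<le>
     ennreal (riesz_const * B powr p) * ?N (y + - x) + ennreal riesz_const * (?F (y + - x) + ennreal ((norm (g y))\<^sup>2))" for y
  proof (cases "norm (y - x) < 1")
    case True
    have "norm (g y) powr p \<le> B powr p" using True p B[of y] by (intro powr_mono2) (auto simp: dist_norm norm_minus_commute)
    then have "ker (x - y) * norm (g y) powr p \<le> riesz_const * B powr p * (1 / norm (y - x) powr (3 - \<beta>))"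
      unfolding ker_eq using riesz_const_pos by (simp add: norm_minus_commute divide_right_mono mult_left_mono)
    then have "ennreal (ker (x - y) * norm (g y) powr p) \<le> ennreal (riesz_const * B powr p) * ?N (y + - x)"
      using True riesz_const_pos by (simp add: ennreal_leI flip: ennreal_mult)
    then show ?thesis by (rule order.trans) simp
  next
    case False
    define A where "A = 1 / norm (y - x) powr 6"
    define G where "G = (norm (g y))\<^sup>2"
    have A: "A > 0" using False by (auto simp: A_def)
    have G: "G \<ge> 0" by (simp add: G_def)
    have "1 / norm (y - x) powr (3 - \<beta>) = A powr ((3 - \<beta>) / 6)"
    proof -
      have "6 * ((3 - \<beta>) / 6) = 3 - \<beta>" by simp
      then show ?thesis unfolding A_def by (simp only: powr_divide powr_powr powr_one_eq_one norm_ge_zero)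
    qed
    moreover have "norm (g y) powr p = G powr ((3 + \<beta>) / 6)"
    proof (cases "g y = 0")
      case False
      then have "(norm (g y))\<^sup>2 = norm (g y) powr 2" by (simp add: powr_numeral)
      moreover have "2 * ((3 + \<beta>) / 6) = (3 + \<beta>) / 3" by simp
      ultimately show ?thesis unfolding G_def p_def by (simp only: powr_powr)
    qed (simp add: G_def)
    ultimately have "1 / norm (y - x) powr (3 - \<beta>) * norm (g y) powr p = A powr ((3 - \<beta>) / 6) * G powr ((3 + \<beta>) / 6)"
      by simp
    also have "\<dots> \<le> (A + G) powr ((3 - \<beta>) / 6) * (A + G) powr ((3 + \<beta>) / 6)"
      using A G beta by (intro mult_mono powr_mono2) auto
    also have "\<dots> = A + G" using A G by (simp add: powr_add[symmetric] add_divide_distrib[symmetric])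
    finally have le: "1 / norm (y - x) powr (3 - \<beta>) * norm (g y) powr p \<le> A + G" .
    have "ker (x - y) * norm (g y) powr p = riesz_const * (1 / norm (y - x) powr (3 - \<beta>) * norm (g y) powr p)"
      by (simp add: ker_eq norm_minus_commute)
    also have "\<dots> \<le> riesz_const * (A + G)" using le riesz_const_pos by (intro mult_left_mono) auto
    finally have "ker (x - y) * norm (g y) powr p \<le> riesz_const * (A + G)" .
    then have "ennreal (ker (x - y) * norm (g y) powr p) \<le> ennreal riesz_const * (ennreal A + ennreal G)"
      using riesz_const_pos A G by (simp add: ennreal_leI flip: ennreal_mult ennreal_plus)
    also have "\<dots> = ennreal riesz_const * (?F (y + - x) + ennreal ((norm (g y))\<^sup>2))"
      using False by (simp add: A_def G_def)
    finally show ?thesis by (rule order.trans) simp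
  qed
  have "(\<integral>\<^sup>+y. ennreal (ker (x - y) * norm (g y) powr p) \<partial>lborel) \<le>
     (\<integral>\<^sup>+y. ennreal (riesz_const * B powr p) * ?N (y + - x) + ennreal riesz_const * (?F (y + - x) + ennreal ((norm (g y))\<^sup>2)) \<partial>lborel)"
    by (intro nn_integral_mono le)
  also have "\<dots> = ennreal (riesz_const * B powr p) * (\<integral>\<^sup>+y. ?N (y + - x) \<partial>lborel) +
     ennreal riesz_const * ((\<integral>\<^sup>+y. ?F (y + - x) \<partial>lborel) + (\<integral>\<^sup>+y. ennreal ((norm (g y))\<^sup>2) \<partial>lborel))"
    by (simp add: nn_integral_add nn_integral_cmult)
  also have "\<dots> = ennreal (riesz_const * B powr p) * (\<integral>\<^sup>+y. ?N y \<partial>lborel) +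
     ennreal riesz_const * ((\<integral>\<^sup>+y. ?F y \<partial>lborel) + (\<integral>\<^sup>+y. ennreal ((norm (g y))\<^sup>2) \<partial>lborel))"
    by (subst (1 2) nn_integral_lborel_translate) auto
  also have "\<dots> < \<infinity>"
  proof -
    have "(\<integral>\<^sup>+y. ennreal ((norm (g y))\<^sup>2) \<partial>lborel) < \<infinity>"
      using g(2) by (auto simp: L2_iff integrable_iff_bounded)
    then show ?thesis
      using nn_integral_norm_powr_near[of "3 - \<beta>"] nn_integral_norm_powr_far[of 6] beta
      by (simp add: ennreal_mult_less_top)
  qed
  finally show ?thesis by (simp add: p_def)
qed

text \<open>A normalizing constant that is left unevaluated; the factor 4 is the one that completing
  the square produces in \<open>gk_product\<close>.\<close>

definition gauss_mass :: "real \<Rightarrow> ennreal" where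
  "gauss_mass s = (\<integral>\<^sup>+z. ennreal (exp (- 4 * s * (norm (z::real^3))\<^sup>2)) \<partial>lborel)"

lemma gauss_mass_measurable [measurable]: "gauss_mass \<in> borel_measurable borel"
  unfolding gauss_mass_def by measurable

text \<open>These two facts permit division by the mass. Finiteness comes from exp (-y) <= (3/y)^3
  with y = 4 s |z|^2, which gives the decay |z|^(-6).\<close>

lemma gauss_mass_bounds:
  assumes "s > 0"
  shows "gauss_mass s \<noteq> 0" "gauss_mass s < \<infinity>"
proof -
  have "\<not> (AE z::real^3 in lborel. False)"
    by (simp add: trivial_limit_def[symmetric] ae_filter_eq_bot_iff)
  then show "gauss_mass s \<noteq> 0"
    unfolding gauss_mass_def by (subst nn_integral_0_iff_AE) auto
  have "gauss_mass s \<le> (\<integral>\<^sup>+z. indicator (ball 0 1) (z::real^3) +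
     ennreal (27 / (4 * s) ^ 3) * (ennreal (1 / norm z powr 6) * indicator (- ball 0 1) z) \<partial>lborel)"
    unfolding gauss_mass_def
  proof (rule nn_integral_mono)
    fix z :: "real^3"
    show "ennreal (exp (- 4 * s * (norm z)\<^sup>2)) \<le> indicator (ball 0 1) z +
       ennreal (27 / (4 * s) ^ 3) * (ennreal (1 / norm z powr 6) * indicator (- ball 0 1) z)"
    proof (cases "norm z < 1")
      case True
      then show ?thesis using assms by simp
    next
      case False
      define y where "y = 4 * s * (norm z)\<^sup>2"
      have "norm z > 0" using False zero_less_one by linarith
      then have y: "y > 0" using assms by (auto simp: y_def)
      have "(y / 3) ^ 3 \<le> (1 + y / 3) ^ 3" using y by (intro power_mono) auto
      also have "\<dots> \<le> exp y" using exp_ge_one_plus_x_over_n_power_n[of 3 y] y by simp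
      finally have "exp (- y) \<le> 27 / y ^ 3" using y by (simp add: exp_minus divide_simps power_divide mult.commute)
      also have "\<dots> = 27 / (4 * s) ^ 3 * (1 / norm z powr 6)"
        using \<open>norm z > 0\<close> by (simp add: y_def power_mult_distrib powr_numeral flip: power_mult)
      finally show ?thesis using False assms by (simp add: y_def ennreal_leI flip: ennreal_mult)
    qed
  qed
  also have "\<dots> = emeasure lborel (ball (0::real^3) 1) +
     ennreal (27 / (4 * s) ^ 3) * (\<integral>\<^sup>+z\<in>- ball 0 1. ennreal (1 / norm (z::real^3) powr 6) \<partial>lborel)"
    by (simp add: nn_integral_add nn_integral_cmult)
  also have "\<dots> < \<infinity>"
    using nn_integral_norm_powr_far[of 6] emeasure_bounded_finite[of "ball (0::real^3) 1"]
    by (simp add: ennreal_mult_less_top)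
  finally show "gauss_mass s < \<infinity>" .
qed

text \<open>The density s^(a-1) / \<Gamma>(a), a = (3-\<beta>)/2, of the Gamma integral that writes
  |x|^(-(3-\<beta>)) through exp (-s |x|^2). Division by \<open>gauss_mass s\<close> compensates for
  splitting that Gaussian into a convolution of two narrower ones.\<close>

definition gw :: "real \<Rightarrow> ennreal" where
  "gw s = indicator {0<..} s * ennreal (riesz_const / Gamma ((3 - \<beta>) / 2) * s powr ((3 - \<beta>) / 2 - 1)) / gauss_mass s"

definition gk :: "real \<Rightarrow> real^3 \<Rightarrow> real^3 \<Rightarrow> ennreal" where
  "gk s z x = ennreal (exp (- 2 * s * (norm (x - z))\<^sup>2))"

lemma gw_measurable [measurable]: "gw \<in> borel_measurable borel"
  unfolding gw_def by measurable

lemma gk_measurable [measurable (raw)]: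
  "f \<in> borel_measurable M \<Longrightarrow> g \<in> borel_measurable M \<Longrightarrow> h \<in> borel_measurable M \<Longrightarrow>
   (\<lambda>w. gk (f w) (g w) (h w)) \<in> borel_measurable M"
proof -
  assume [measurable]: "f \<in> borel_measurable M" "g \<in> borel_measurable M" "h \<in> borel_measurable M"
  have "(\<lambda>w. h w - g w) \<in> borel_measurable M" by simp
  then have [measurable]: "(\<lambda>w. norm (h w - g w)) \<in> borel_measurable M" by simp
  show ?thesis unfolding gk_def by measurable
qed

text \<open>By the parallelogram law, |x-z|^2 + |y-z|^2 = |x-y|^2 / 2 + 2 |z-m|^2 with m the
  midpoint of x and y; the last term integrates to the mass.\<close>

lemma gk_product: "(\<integral>\<^sup>+z. gk s z x * gk s z y \<partial>lborel) = ennreal (exp (- s * (norm (x - y))\<^sup>2)) * gauss_mass s"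
proof -
  define m where "m = (1/2) *\<^sub>R (x + y)"
  have par: "(norm (x - z))\<^sup>2 + (norm (y - z))\<^sup>2 = (norm (x - y))\<^sup>2 / 2 + 2 * (norm (z - m))\<^sup>2" for z
    unfolding m_def power2_norm_eq_inner
    by (simp add: inner_diff_left inner_diff_right inner_add_left inner_add_right inner_commute algebra_simps)
       (simp add: field_simps)
  have e: "- 2 * s * (norm (x - z))\<^sup>2 + - 2 * s * (norm (y - z))\<^sup>2 = - s * (norm (x - y))\<^sup>2 + - 4 * s * (norm (z + - m))\<^sup>2" for z
  proof -
    have "- 2 * s * (norm (x - z))\<^sup>2 + - 2 * s * (norm (y - z))\<^sup>2 = - 2 * s * ((norm (x - z))\<^sup>2 + (norm (y - z))\<^sup>2)"
      by (simp add: algebra_simps)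
    also have "\<dots> = - s * (norm (x - y))\<^sup>2 + - 4 * s * (norm (z + - m))\<^sup>2"
      unfolding par by (simp add: algebra_simps)
    finally show ?thesis .
  qed
  have "(\<integral>\<^sup>+z. gk s z x * gk s z y \<partial>lborel) =
     (\<integral>\<^sup>+z. ennreal (exp (- s * (norm (x - y))\<^sup>2)) * ennreal (exp (- 4 * s * (norm (z + - m))\<^sup>2)) \<partial>lborel)"
    unfolding gk_def by (intro nn_integral_cong) (simp only: ennreal_mult[symmetric] exp_ge_zero exp_add[symmetric] e)
  also have "\<dots> = ennreal (exp (- s * (norm (x - y))\<^sup>2)) * (\<integral>\<^sup>+z. ennreal (exp (- 4 * s * (norm (z + - m))\<^sup>2)) \<partial>lborel)"
    by (rule nn_integral_cmult) measurable
  also have "(\<integral>\<^sup>+z. ennreal (exp (- 4 * s * (norm (z + - m))\<^sup>2)) \<partial>lborel) = gauss_mass s"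
    unfolding gauss_mass_def
    by (rule nn_integral_lborel_translate[where f="\<lambda>z. ennreal (exp (- 4 * s * (norm z)\<^sup>2))"]) measurable
  finally show ?thesis .
qed

text \<open>The Gamma integral, rescaled by the squared distance. The diagonal is excluded because
  there \<open>ker\<close> has the default value 0 whereas the mixture is infinite.\<close>

lemma ker_gauss_mixture:
  assumes "x \<noteq> y"
  shows "ennreal (ker (x - y)) = (\<integral>\<^sup>+s. gw s * (\<integral>\<^sup>+z. gk s z x * gk s z y \<partial>lborel) \<partial>lborel)"
proof -
  define a where "a = (3 - \<beta>) / 2"
  have a: "a > 0" using beta by (simp add: a_def)
  define r where "r = norm (x - y)"
  have r: "r > 0" using assms by (simp add: r_def)
  have Ga: "Gamma a > 0" using a by (rule Gamma_real_pos)
  let ?w = "\<lambda>s. (indicator {0..} s * (s powr (a - 1) * exp (- s * r\<^sup>2)))"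
  let ?h = "\<lambda>s. (indicator {0..} (0 + r\<^sup>2 * s) * (0 + r\<^sup>2 * s) powr (a - 1) / exp (0 + r\<^sup>2 * s))"
  let ?J = "\<integral>\<^sup>+s. ennreal (?w s) \<partial>lborel"
  \<comment> \<open>Substitution of r^2 s for the variable of the Gamma integral.\<close>
  have "ennreal (Gamma a) = ennreal \<bar>r\<^sup>2\<bar> * (\<integral>\<^sup>+s. ennreal (?h s) \<partial>lborel)"
    unfolding Gamma_conv_nn_integral_real[OF a]
    by (rule nn_integral_real_affine) (use r in auto)
  also have "(\<integral>\<^sup>+s. ennreal (?h s) \<partial>lborel)
     = (\<integral>\<^sup>+s. ennreal ((r\<^sup>2) powr (a - 1)) * ennreal (?w s) \<partial>lborel)"
  proof (intro nn_integral_cong)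
    fix s :: real
    show "ennreal (?h s)
      = ennreal ((r\<^sup>2) powr (a - 1)) * ennreal (?w s)"
      using r by (auto simp: indicator_def powr_mult exp_minus field_simps zero_le_mult_iff simp flip: ennreal_mult)
  qed
  also have "\<dots> = ennreal ((r\<^sup>2) powr (a - 1)) * ?J" by (rule nn_integral_cmult) measurable
  finally have "ennreal (Gamma a) = ennreal (r\<^sup>2 * (r\<^sup>2) powr (a - 1)) * ?J"
    by (simp add: ennreal_mult mult.assoc)
  also have "r\<^sup>2 * (r\<^sup>2) powr (a - 1) = (r\<^sup>2) powr a"
    using r by (simp add: powr_diff)
  also have "(r\<^sup>2) powr a = r powr (3 - \<beta>)"
  proof -
    have "r\<^sup>2 = r powr 2" using r by (simp add: powr_numeral)
    moreover have "2 * a = 3 - \<beta>" by (simp add: a_def)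
    ultimately show ?thesis by (simp only: powr_powr)
  qed
  finally have J: "ennreal (Gamma a) = ennreal (r powr (3 - \<beta>)) * ?J" .
  have "(\<integral>\<^sup>+s. gw s * (\<integral>\<^sup>+z. gk s z x * gk s z y \<partial>lborel) \<partial>lborel) =
     (\<integral>\<^sup>+s. ennreal (riesz_const / Gamma a) * ennreal (?w s) \<partial>lborel)"
  proof (intro nn_integral_cong_AE)
    show "AE s in lborel. gw s * (\<integral>\<^sup>+z. gk s z x * gk s z y \<partial>lborel) =
      ennreal (riesz_const / Gamma a) * ennreal (?w s)"
      using AE_lborel_singleton[of "0::real"]
    proof eventually_elim
      case (elim s)
      show ?case
      proof (cases "s > 0")
        case True
        have "gw s * (\<integral>\<^sup>+z. gk s z x * gk s z y \<partial>lborel) =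
           ennreal (riesz_const / Gamma a * s powr (a - 1)) / gauss_mass s * (ennreal (exp (- s * r\<^sup>2)) * gauss_mass s)"
          unfolding gk_product gw_def a_def[symmetric] r_def[symmetric] using True by simp
        also have "\<dots> = ennreal (riesz_const / Gamma a * s powr (a - 1)) * ennreal (exp (- s * r\<^sup>2))"
        proof -
          have "a / Z * (e * Z) = a * e * Z / Z" for a e Z :: ennreal
            by (simp add: divide_ennreal_def mult_ac)
          then show ?thesis using gauss_mass_bounds[OF True] by (simp add: ennreal_mult_divide_eq)
        qed
        also have "\<dots> = ennreal (riesz_const / Gamma a) * ennreal (?w s)"
          using True riesz_const_pos Ga by (simp add: mult_ac flip: ennreal_mult)
        finally show ?thesis .
      qed (use elim in \<open>auto simp: gw_def\<close>)
    qed
  qed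
  also have "\<dots> = ennreal (riesz_const / Gamma a) * ?J" by (rule nn_integral_cmult) measurable
  also have "?J = ennreal (Gamma a) / ennreal (r powr (3 - \<beta>))"
  proof -
    have "ennreal (r powr (3 - \<beta>)) \<noteq> 0" using r by simp
    then have "?J * ennreal (r powr (3 - \<beta>)) / ennreal (r powr (3 - \<beta>)) = ?J"
      by (rule ennreal_mult_divide_eq) simp
    then show ?thesis unfolding J by (simp add: mult.commute)
  qed
  also have "ennreal (riesz_const / Gamma a) * (ennreal (Gamma a) / ennreal (r powr (3 - \<beta>))) = ennreal (ker (x - y))"
    using r Ga riesz_const_pos by (simp add: divide_ennreal ker_eq r_def flip: ennreal_mult)
  finally show ?thesis by simp
qed

section \<open>Positive definiteness of the Riesz energy\<close>

definition energy :: "(real^3 \<Rightarrow> ennreal) \<Rightarrow> (real^3 \<Rightarrow> ennreal) \<Rightarrow> ennreal" where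
  "energy a b = (\<integral>\<^sup>+x. \<integral>\<^sup>+y. ennreal (ker (x - y)) * a x * b y \<partial>lborel \<partial>lborel)"

text \<open>Each scale s and centre z contributes the product of two Gaussian averages, which is a
  square when both densities agree. All integrands are nonnegative, so Tonelli applies; the diagonal
  is a null set in \<open>y\<close>.\<close>

lemma energy_gauss:
  assumes [measurable]: "a \<in> borel_measurable borel" "b \<in> borel_measurable borel"
  shows "energy a b = (\<integral>\<^sup>+s. gw s * (\<integral>\<^sup>+z. (\<integral>\<^sup>+x. gk s z x * a x \<partial>lborel) * (\<integral>\<^sup>+y. gk s z y * b y \<partial>lborel) \<partial>lborel) \<partial>lborel)"
proof -
  let ?A = "\<lambda>s z. (\<integral>\<^sup>+x. gk s z x * a x \<partial>lborel)"
  let ?B = "\<lambda>s z. (\<integral>\<^sup>+y. gk s z y * b y \<partial>lborel)"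
  let ?F = "\<lambda>s z x y. gw s * (gk s z x * gk s z y) * a x * b y"
  have "energy a b = (\<integral>\<^sup>+x. \<integral>\<^sup>+y. (\<integral>\<^sup>+s. \<integral>\<^sup>+z. (?F s z x y) \<partial>lborel \<partial>lborel) \<partial>lborel \<partial>lborel)"
    unfolding energy_def
  proof (rule nn_integral_cong, rule nn_integral_cong_AE)
    fix x :: "real^3"
    show "AE y in lborel. ennreal (ker (x - y)) * a x * b y = (\<integral>\<^sup>+s. \<integral>\<^sup>+z. (?F s z x y) \<partial>lborel \<partial>lborel)"
      using AE_lborel_singleton[of x]
    proof eventually_elim
      case (elim y)
      have "(\<integral>\<^sup>+z. (?F s z x y) \<partial>lborel) = gw s * (\<integral>\<^sup>+z. gk s z x * gk s z y \<partial>lborel) * a x * b y" for s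
        by (simp add: nn_integral_multc nn_integral_cmult)
      then show ?case using elim by (simp add: ker_gauss_mixture nn_integral_multc)
    qed
  qed
  also have "\<dots> = (\<integral>\<^sup>+x. \<integral>\<^sup>+s. \<integral>\<^sup>+y. \<integral>\<^sup>+z. (?F s z x y) \<partial>lborel \<partial>lborel \<partial>lborel \<partial>lborel)"
    by (intro nn_integral_cong lborel_pair.Fubini') measurable
  also have "\<dots> = (\<integral>\<^sup>+s. \<integral>\<^sup>+x. \<integral>\<^sup>+y. \<integral>\<^sup>+z. (?F s z x y) \<partial>lborel \<partial>lborel \<partial>lborel \<partial>lborel)"
    by (rule lborel_pair.Fubini') measurable
  also have "\<dots> = (\<integral>\<^sup>+s. \<integral>\<^sup>+x. \<integral>\<^sup>+z. \<integral>\<^sup>+y. (?F s z x y) \<partial>lborel \<partial>lborel \<partial>lborel \<partial>lborel)"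
    by (intro nn_integral_cong lborel_pair.Fubini') measurable
  also have "\<dots> = (\<integral>\<^sup>+s. \<integral>\<^sup>+z. \<integral>\<^sup>+x. \<integral>\<^sup>+y. (?F s z x y) \<partial>lborel \<partial>lborel \<partial>lborel \<partial>lborel)"
    by (intro nn_integral_cong lborel_pair.Fubini') measurable
  also have "\<dots> = (\<integral>\<^sup>+s. gw s * (\<integral>\<^sup>+z. (?A s z) * (?B s z) \<partial>lborel) \<partial>lborel)"
  proof (intro nn_integral_cong)
    fix s
    have "(\<integral>\<^sup>+x. \<integral>\<^sup>+y. (?F s z x y) \<partial>lborel \<partial>lborel) =
       gw s * ((?A s z) * (?B s z))" for z
    proof -
      have "(\<integral>\<^sup>+x. \<integral>\<^sup>+y. (?F s z x y) \<partial>lborel \<partial>lborel) =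
        (\<integral>\<^sup>+x. \<integral>\<^sup>+y. gw s * (gk s z x * a x) * (gk s z y * b y) \<partial>lborel \<partial>lborel)"
        by (simp add: mult_ac)
      also have "\<dots> = (\<integral>\<^sup>+x. gw s * (gk s z x * a x) * (?B s z) \<partial>lborel)"
        by (intro nn_integral_cong nn_integral_cmult) measurable
      also have "\<dots> = (\<integral>\<^sup>+x. gw s * (gk s z x * a x) \<partial>lborel) * (?B s z)"
        by (rule nn_integral_multc) measurable
      also have "(\<integral>\<^sup>+x. gw s * (gk s z x * a x) \<partial>lborel) = gw s * (?A s z)"
        by (rule nn_integral_cmult) measurable
      finally show ?thesis by (simp add: mult.assoc)
    qed
    then show "(\<integral>\<^sup>+z. \<integral>\<^sup>+x. \<integral>\<^sup>+y. (?F s z x y) \<partial>lborel \<partial>lborel \<partial>lborel) =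
      gw s * (\<integral>\<^sup>+z. (?A s z) * (?B s z) \<partial>lborel)"
      by (simp add: nn_integral_cmult)
  qed
  finally show ?thesis .
qed

lemma ennreal_two_mult_le: "2 * (P * Q) \<le> P * P + Q * (Q::ennreal)"
proof (cases P; cases Q)
  fix r t assume *: "P = ennreal r" "0 \<le> r" "Q = ennreal t" "0 \<le> t"
  have "2 * (r * t) \<le> r * r + t * t" using sum_squares_bound[of r t] by (simp add: power2_eq_square)
  then have "ennreal (2 * (r * t)) \<le> ennreal (r * r + t * t)" by (rule ennreal_leI)
  then show ?thesis using * by (simp add: ennreal_mult ennreal_plus)
qed (auto simp: ennreal_top_mult ennreal_mult_top)

text \<open>This is the nonnegativity of the energy of a - b, expanded so that no signed density and
  no finiteness is involved. It holds under the Gaussian integrals, pair by pair of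
  averages.\<close>

lemma energy_polarization:
  assumes [measurable]: "a \<in> borel_measurable borel" "b \<in> borel_measurable borel"
  shows "2 * energy a b \<le> energy a a + energy b b"
proof -
  let ?A = "\<lambda>s z. \<integral>\<^sup>+x. gk s z x * a x \<partial>lborel" and ?B = "\<lambda>s z. \<integral>\<^sup>+x. gk s z x * b x \<partial>lborel"
  have "2 * energy a b = (\<integral>\<^sup>+s. gw s * (\<integral>\<^sup>+z. 2 * (?A s z * ?B s z) \<partial>lborel) \<partial>lborel)"
    unfolding energy_gauss[OF assms] by (simp add: nn_integral_cmult mult.left_commute[of _ "2::ennreal"])
  also have "\<dots> \<le> (\<integral>\<^sup>+s. gw s * (\<integral>\<^sup>+z. ?A s z * ?A s z + ?B s z * ?B s z \<partial>lborel) \<partial>lborel)"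
    by (intro nn_integral_mono mult_left_mono ennreal_two_mult_le) simp
  also have "\<dots> = (\<integral>\<^sup>+s. gw s * (\<integral>\<^sup>+z. ?A s z * ?A s z \<partial>lborel) + gw s * (\<integral>\<^sup>+z. ?B s z * ?B s z \<partial>lborel) \<partial>lborel)"
    by (simp add: nn_integral_add distrib_left)
  also have "\<dots> = energy a a + energy b b"
    unfolding energy_gauss[OF assms(1) assms(1)] energy_gauss[OF assms(2) assms(2)]
    by (rule nn_integral_add) measurable
  finally show ?thesis .
qed

end

section \<open>Shears\<close>

locale shear =
  fixes t R :: real and j :: 3
  assumes t: "0 < t" "t < 1" and R: "R > 0"
begin

definition psi :: "real \<Rightarrow> real" where "psi s = s - t * (R * sin (s / R))"

text \<open>The displacement depends only on the coordinate that it changes, so the derivative is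
  diagonal and its only nontrivial entry is \<open>jac x\<close>.\<close>

definition flow :: "real^3 \<Rightarrow> real^3" where "flow x = x - (t * (R * sin (x $ j / R))) *\<^sub>R axis j 1"

definition jac :: "real^3 \<Rightarrow> real" where "jac x = 1 - t * cos (x $ j / R)"

lemma sin_scaled_Lipschitz: "\<bar>R * sin (a / R) - R * sin (b / R)\<bar> \<le> \<bar>a - b\<bar>"
proof -
  have "\<bar>sin x - sin y\<bar> \<le> \<bar>x - y\<bar>" for x y :: real
  proof -
    have "\<bar>sin x - sin y\<bar> = 2 * (\<bar>sin ((x - y) / 2)\<bar> * \<bar>cos ((x + y) / 2)\<bar>)"
      by (simp add: sin_diff_sin abs_mult)
    also have "\<dots> \<le> 2 * (\<bar>(x - y) / 2\<bar> * 1)"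
      by (intro mult_left_mono mult_mono abs_sin_x_le_abs_x) auto
    finally show ?thesis by simp
  qed
  from mult_left_mono[OF this[of "a / R" "b / R"], of R] R
  have "R * \<bar>sin (a / R) - sin (b / R)\<bar> \<le> R * \<bar>a / R - b / R\<bar>" by simp
  then show ?thesis
  proof -
    have "\<bar>R * sin (a / R) - R * sin (b / R)\<bar> = R * \<bar>sin (a / R) - sin (b / R)\<bar>"
      using R by (simp add: abs_mult flip: right_diff_distrib)
    moreover have "R * \<bar>a / R - b / R\<bar> = \<bar>a - b\<bar>"
      using R by (simp flip: diff_divide_distrib)
    ultimately show ?thesis using \<open>R * \<bar>sin (a / R) - sin (b / R)\<bar> \<le> R * \<bar>a / R - b / R\<bar>\<close> by simp
  qed
qed

text \<open>\<open>psi\<close> differs from the identity by a map with Lipschitz constant t < 1. The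
  bound yields injectivity and also continuity of the inverse.\<close>

lemma psi_expanding: "(1 - t) * \<bar>a - b\<bar> \<le> \<bar>psi a - psi b\<bar>"
proof -
  have "t * \<bar>R * sin (a / R) - R * sin (b / R)\<bar> \<le> t * \<bar>a - b\<bar>"
    using sin_scaled_Lipschitz t by (intro mult_left_mono) auto
  moreover have "\<bar>t * (R * sin (a / R) - R * sin (b / R))\<bar> = t * \<bar>R * sin (a / R) - R * sin (b / R)\<bar>"
    using t by (simp only: abs_mult abs_of_pos)
  moreover have "psi a - psi b = (a - b) - t * (R * sin (a / R) - R * sin (b / R))"
    by (simp add: psi_def algebra_simps)
  ultimately show ?thesis by (simp add: left_diff_distrib)
qed

lemma inj_psi: "inj psi"
proof (rule injI)
  fix a b assume "psi a = psi b"
  then show "a = b" using psi_expanding[of a b] t by (simp add: mult_le_0_iff)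
qed

lemma surj_psi: "surj psi"
proof -
  have "\<exists>s. psi s = a" for a
  proof -
    have "\<bar>t * (R * sin x)\<bar> \<le> t * R" for x
      using t R by (auto simp: abs_mult intro!: mult_left_mono mult_left_le)
    then have 1: "psi (a - t * R) \<le> a" "a \<le> psi (a + t * R)"
      unfolding psi_def by (smt (verit))+
    have "continuous_on {a - t * R..a + t * R} psi"
      unfolding psi_def using R by (intro continuous_intros) auto
    then show ?thesis using IVT'[of psi "a - t * R" a "a + t * R", OF 1] t R by auto
  qed
  then show ?thesis unfolding surj_def by metis
qed

text \<open>The inverse of \<open>flow\<close>, written as a bounded displacement: this form gives
  continuity from that of \<open>inv psi\<close> and is the one used in the Taylor expansion of
  \<open>u\<close>.\<close>

definition unflow :: "real^3 \<Rightarrow> real^3" where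
  "unflow x = x + (t * (R * sin (inv psi (x $ j) / R))) *\<^sub>R axis j 1"

lemma flow_nth: "flow x $ k = (if k = j then psi (x $ j) else x $ k)"
  by (simp add: flow_def psi_def axis_def)

lemma unflow_nth: "unflow x $ k = (if k = j then inv psi (x $ j) else x $ k)"
proof -
  have "psi (inv psi (x $ j)) = x $ j" using surj_psi by (rule surj_f_inv_f)
  then show ?thesis by (simp add: unflow_def axis_def psi_def)
qed

lemma flow_unflow: "flow (unflow x) = x"
  using surj_f_inv_f[OF surj_psi] by (simp add: vec_eq_iff flow_nth unflow_nth)

lemma unflow_flow: "unflow (flow x) = x"
  using inv_f_f[OF inj_psi] by (simp add: vec_eq_iff flow_nth unflow_nth)

lemma flow_continuous: "continuous_on UNIV flow"
  unfolding flow_def using R by (intro continuous_intros) auto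

lemma flow_measurable [measurable]: "flow \<in> borel_measurable borel"
  by (rule borel_measurable_continuous_onI[OF flow_continuous])

lemma jac_measurable [measurable]: "jac \<in> borel_measurable borel"
  unfolding jac_def by (intro borel_measurable_continuous_onI continuous_intros) (use R in auto)

lemma unflow_measurable [measurable]: "unflow \<in> borel_measurable borel"
proof -
  have "continuous_on UNIV (inv psi)"
    unfolding continuous_on_iff
  proof (intro ballI allI impI)
    fix a e :: real assume "e > 0"
    show "\<exists>d>0. \<forall>b\<in>UNIV. dist b a < d \<longrightarrow> dist (inv psi b) (inv psi a) < e"
    proof (intro exI[of _ "(1 - t) * e"] conjI ballI impI)
      fix b assume "dist b a < (1 - t) * e"
      moreover have "(1 - t) * \<bar>inv psi b - inv psi a\<bar> \<le> \<bar>b - a\<bar>"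
        using psi_expanding[of "inv psi b" "inv psi a"] surj_f_inv_f[OF surj_psi] by simp
      ultimately have "(1 - t) * \<bar>inv psi b - inv psi a\<bar> < (1 - t) * e" by (simp add: dist_real_def)
      then show "dist (inv psi b) (inv psi a) < e" using t by (simp add: dist_real_def)
    qed (use t \<open>e > 0\<close> in auto)
  qed
  then have "continuous_on UNIV (\<lambda>x::real^3. inv psi (x $ j))"
    by (rule continuous_on_compose2) (auto intro: continuous_intros)
  then have "continuous_on UNIV unflow"
    unfolding unflow_def using R by (intro continuous_intros) auto
  then show ?thesis by (rule borel_measurable_continuous_onI)
qed

lemma jac_pos: "jac x > 0"
proof -
  have "t * cos (x $ j / R) \<le> t * 1" using t by (intro mult_left_mono) auto
  then show ?thesis unfolding jac_def using t by linarith
qed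

lemma flow_has_derivative:
  "(flow has_derivative (\<lambda>v. v - (t * cos (x $ j / R) * v $ j) *\<^sub>R axis j 1)) (at x within S)"
  unfolding flow_def using R
  by (auto intro!: derivative_eq_intros bounded_linear.has_derivative[OF bounded_linear_vec_nth] simp: fun_eq_iff algebra_simps)

lemma det_flow: "det (matrix (\<lambda>v::real^3. v - (t * cos (x $ j / R) * v $ j) *\<^sub>R axis j 1)) = jac x"
proof -
  let ?A = "matrix (\<lambda>v::real^3. v - (t * cos (x $ j / R) * v $ j) *\<^sub>R axis j 1)"
  have "det ?A = (\<Prod>i\<in>UNIV. ?A $ i $ i)"
    by (rule det_diagonal) (auto simp: matrix_def axis_def)
  also have "\<dots> = (\<Prod>i\<in>UNIV. if i = j then jac x else 1)"
    by (intro prod.cong) (auto simp: matrix_def axis_def jac_def)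
  finally show ?thesis by simp
qed

text \<open>The change of variables as an identity of measures, checked on boxes through the volume
  formula for differentiable injective images. It then serves every nonnegative Borel function,
  integrable or not.\<close>

lemma distr_flow: "distr (density lborel (\<lambda>x. ennreal (jac x))) borel flow = lborel"
proof (rule lborel_eqI[symmetric])
  fix l u :: "real^3" assume lu: "\<And>b. b \<in> Basis \<Longrightarrow> l \<bullet> b \<le> u \<bullet> b"
  define S where "S = flow -` box l u"
  have S: "S \<in> sets borel" unfolding S_def using measurable_sets[OF flow_measurable, of "box l u"] by simp
  have im: "flow ` S = box l u"
    unfolding S_def using flow_unflow by (auto simp: image_iff) (metis)
  have "flow ` S \<in> lmeasurable \<and> measure lebesgue (flow ` S) = measure lebesgue (box l u) \<longleftrightarrow>
    ((\<lambda>x. \<bar>det (matrix (\<lambda>v::real^3. v - (t * cos (x $ j / R) * v $ j) *\<^sub>R axis j 1))\<bar>) has_integral measure lebesgue (box l u)) S"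
    by (rule has_measure_differentiable_image)
       (use S flow_has_derivative unflow_flow in \<open>auto intro!: inj_on_inverseI[where g=unflow]\<close>)
  then have "((\<lambda>x. \<bar>jac x\<bar>) has_integral measure lebesgue (box l u)) S"
    unfolding im det_flow by simp
  then have I: "(jac has_integral measure lborel (box l u)) S"
    using jac_pos by (simp add: abs_of_pos)
  have "emeasure (distr (density lborel (\<lambda>x. ennreal (jac x))) borel flow) (box l u) = (\<integral>\<^sup>+x. ennreal (jac x) * indicator S x \<partial>lborel)"
    using S by (simp add: emeasure_distr emeasure_density S_def)
  also have "\<dots> = (\<integral>\<^sup>+x. ennreal (indicator S x * jac x) \<partial>lborel)"
    by (intro nn_integral_cong) (auto simp: indicator_def)
  also have "\<dots> = ennreal (measure lborel (box l u))"
    using nn_integral_has_integral_lebesgue[OF less_imp_le[OF jac_pos] I] .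
  also have "\<dots> = (\<Prod>b\<in>Basis. (u - l) \<bullet> b)"
    using lu by (simp add: measure_def emeasure_lborel_box_eq inner_diff_left prod_nonneg)
  finally show "emeasure (distr (density lborel (\<lambda>x. ennreal (jac x))) borel flow) (box l u) = ennreal (\<Prod>b\<in>Basis. (u - l) \<bullet> b)" .
qed simp

lemma nn_integral_flow:
  assumes [measurable]: "F \<in> borel_measurable borel"
  shows "(\<integral>\<^sup>+x. F x \<partial>lborel) = (\<integral>\<^sup>+x. ennreal (jac x) * F (flow x) \<partial>lborel)"
proof -
  have "(\<integral>\<^sup>+x. F x \<partial>lborel) = (\<integral>\<^sup>+x. F x \<partial>distr (density lborel (\<lambda>x. ennreal (jac x))) borel flow)"
    by (simp add: distr_flow)
  also have "\<dots> = (\<integral>\<^sup>+x. ennreal (jac x) * F (flow x) \<partial>lborel)"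
    by (subst nn_integral_distr) (auto simp: nn_integral_density)
  finally show ?thesis .
qed

end

section \<open>The kernel under a shear, to first order in \<open>t\<close>\<close>

lemma one_plus_power_le:
  fixes x :: real
  assumes "0 \<le> x" "x \<le> 1"
  shows "(1 + x) ^ n \<le> 1 + (2 ^ n - 1) * x"
proof (induction n)
  case (Suc n)
  have "(1 + x) ^ Suc n \<le> (1 + x) * (1 + (2 ^ n - 1) * x)"
    using mult_left_mono[OF Suc, of "1 + x"] assms by simp
  also have "\<dots> = 1 + 2 ^ n * x + (2 ^ n - 1) * (x * x)" by (simp add: algebra_simps)
  also have "\<dots> \<le> 1 + 2 ^ n * x + (2 ^ n - 1) * (x * 1)"
    using assms by (intro add_left_mono mult_left_mono) auto
  also have "\<dots> = 1 + (2 ^ Suc n - 1) * x" by (simp add: algebra_simps)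
  finally show ?case .
qed simp

lemma continuous_AE_zero:
  fixes f :: "'a::euclidean_space \<Rightarrow> 'b::real_normed_vector"
  assumes "continuous_on UNIV f" "AE x in lborel. f x = 0"
  shows "f x = 0"
proof (rule ccontr)
  assume "f x \<noteq> 0"
  have "open {x. f x \<noteq> 0}"
    using open_vimage[OF open_Compl[OF closed_singleton[of 0]] assms(1)] by (simp add: vimage_def)
  moreover have "{x. f x \<noteq> 0} \<noteq> {}" using \<open>f x \<noteq> 0\<close> by auto
  ultimately have "\<not> negligible {x. f x \<noteq> 0}" by (rule open_not_negligible)
  moreover have "{x. f x \<noteq> 0} \<in> null_sets lborel"
    using assms(2) \<open>open {x. f x \<noteq> 0}\<close> AE_iff_null[of lborel "\<lambda>x. f x = 0"] by simp
  then have "negligible {x. f x \<noteq> 0}"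
    unfolding negligible_iff_null_sets by (rule null_sets_completionI)
  ultimately show False by simp
qed

context riesz
begin

definition pex :: real where "pex = (3 + \<beta>) / 3"

lemma pex_bounds: "1 < pex" "pex < 2" using beta by (auto simp: pex_def)

text \<open>The factor that the kernel \<open>k (x - y)\<close> picks up under the change of variables; \<open>c\<close>, \<open>d\<close> are the values of
  \<open>\<xi>'\<close> at \<open>x\<^sub>j\<close>, \<open>y\<^sub>j\<close>, and \<open>1 - 2 t a + t\<^sup>2 b\<close> is the ratio of the squared distances.\<close>
definition kfac :: "real \<Rightarrow> real \<Rightarrow> real \<Rightarrow> real \<Rightarrow> real \<Rightarrow> real" where
  "kfac t c d a b = (1 - t * c) * (1 - t * d) * ((1 + t / 2 * c) powr pex * (1 + t / 2 * d) powr pex) *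
     (1 - 2 * t * a + t\<^sup>2 * b) powr (- ((3 - \<beta>) / 2))"

text \<open>The Jacobians contribute -(c + d), the amplitudes p/2 (c + d), and the ratio of
  distances -(3-\<beta>)/2 times -2 a.\<close>

lemma kfac_tendsto:
  "((\<lambda>t. (kfac t c d a b - 1) / t) \<longlongrightarrow> (pex / 2 - 1) * (c + d) + (3 - \<beta>) * a) (at_right 0)"
proof -
  have "((\<lambda>t. kfac t c d a b) has_real_derivative (pex / 2 - 1) * (c + d) + (3 - \<beta>) * a) (at 0)"
    unfolding kfac_def by (auto intro!: derivative_eq_intros simp: field_simps)
  then have "((\<lambda>t. (kfac t c d a b - kfac 0 c d a b) / (t - 0)) \<longlongrightarrow> (pex / 2 - 1) * (c + d) + (3 - \<beta>) * a) (at 0)"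
    by (simp add: has_field_derivative_iff)
  then show ?thesis
    by (simp add: kfac_def filterlim_at_split)
qed

text \<open>This becomes the domination as t tends to 0. Every factor lies between powers of 1 - t
  and 1 + 2 t: one for each Jacobian, two for each amplitude since p < 2, and three for the kernel
  since 3 - \<beta> < 3. In total the power is 9.\<close>

lemma kfac_bound:
  assumes t: "0 < t" "t \<le> 1/2" and c: "\<bar>c\<bar> \<le> 1" "\<bar>d\<bar> \<le> 1"
    and m: "(1 - t)\<^sup>2 \<le> 1 - 2 * t * a + t\<^sup>2 * b" "1 - 2 * t * a + t\<^sup>2 * b \<le> (1 + t)\<^sup>2"
  shows "\<bar>kfac t c d a b - 1\<bar> \<le> 1022 * t" "kfac t c d a b \<ge> 0"
proof -
  define m where "m = 1 - 2 * t * a + t\<^sup>2 * b"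
  note m = m[folded m_def]
  have tc: "\<bar>t * c\<bar> \<le> t" "\<bar>t * d\<bar> \<le> t" using t c by (auto simp: abs_mult intro: mult_left_le)
  have p: "(1 - t)\<^sup>2 \<le> (1 + t / 2 * e) powr pex" "(1 + t / 2 * e) powr pex \<le> (1 + 2 * t)\<^sup>2" if "\<bar>t * e\<bar> \<le> t" for e
  proof -
    have te: "t / 2 * e = (t * e) / 2" by simp
    have e: "1 - t \<le> 1 + t / 2 * e" "1 + t / 2 * e \<le> 1 + 2 * t" "0 < 1 - t"
      unfolding te using abs_le_iff[THEN iffD1, OF that] t by linarith+
    have "(1 - t)\<^sup>2 = (1 - t) powr 2" using e by (simp add: powr_numeral)
    also have "\<dots> \<le> (1 - t) powr pex" using pex_bounds t by (intro powr_mono') auto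
    also have "\<dots> \<le> (1 + t / 2 * e) powr pex" using pex_bounds e by (intro powr_mono2) auto
    finally show "(1 - t)\<^sup>2 \<le> (1 + t / 2 * e) powr pex" .
    have "(1 + t / 2 * e) powr pex \<le> (1 + 2 * t) powr pex" using pex_bounds e t by (intro powr_mono2) auto
    also have "\<dots> \<le> (1 + 2 * t) powr 2" using pex_bounds t by (intro powr_mono) auto
    also have "\<dots> = (1 + 2 * t)\<^sup>2" using t by (simp add: powr_numeral)
    finally show "(1 + t / 2 * e) powr pex \<le> (1 + 2 * t)\<^sup>2" .
  qed
  have q: "(1 - t) ^ 3 \<le> m powr (- ((3 - \<beta>) / 2))" "m powr (- ((3 - \<beta>) / 2)) \<le> (1 + 2 * t) ^ 3"
  proof -
    have "0 < (1 - t)\<^sup>2" using t by simp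
    then have m0: "m > 0" using m(1) by linarith
    have sq: "(y\<^sup>2) powr (- ((3 - \<beta>) / 2)) = y powr (- (3 - \<beta>))" if "y > 0" for y :: real
    proof -
      have "y\<^sup>2 = y powr 2" using that by (simp add: powr_numeral)
      moreover have "2 * (- ((3 - \<beta>) / 2)) = - (3 - \<beta>)" by (simp add: field_simps)
      ultimately show ?thesis by (simp only: powr_powr)
    qed
    have "(1 - t) ^ 3 * (1 + t) ^ 3 = (1 - t\<^sup>2) ^ 3" by (simp add: power_mult_distrib[symmetric] algebra_simps power2_eq_square)
    also have "\<dots> \<le> 1" using t by (intro power_le_one) (auto simp: power_le_one)
    finally have "(1 - t) ^ 3 \<le> 1 / (1 + t) ^ 3" using t by (simp add: pos_le_divide_eq)
    also have "\<dots> = (1 + t) powr (- 3)" using t by (simp add: powr_minus_divide powr_numeral)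
    also have "\<dots> \<le> (1 + t) powr (- (3 - \<beta>))" using t beta by (intro powr_mono) auto
    also have "\<dots> = ((1 + t)\<^sup>2) powr (- ((3 - \<beta>) / 2))" using t by (subst sq) auto
    also have "\<dots> \<le> m powr (- ((3 - \<beta>) / 2))" using m m0 beta by (intro powr_mono2') auto
    finally show "(1 - t) ^ 3 \<le> m powr (- ((3 - \<beta>) / 2))" .
    have "m powr (- ((3 - \<beta>) / 2)) \<le> ((1 - t)\<^sup>2) powr (- ((3 - \<beta>) / 2))" using m t beta by (intro powr_mono2') auto
    also have "\<dots> = (1 - t) powr (- (3 - \<beta>))" using t by (subst sq) auto
    also have "\<dots> \<le> (1 - t) powr (- 3)" using t beta by (intro powr_mono') auto
    also have "\<dots> = 1 / (1 - t) ^ 3" using t by (simp add: powr_minus_divide powr_numeral)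
    also have "\<dots> \<le> (1 + 2 * t) ^ 3"
    proof -
      \<comment> \<open>The product is 1 + t (1 - 2 t), which is where t <= 1/2 enters.\<close>
      have "1 \<le> (1 + 2 * t) * (1 - t)" using t by (simp add: algebra_simps)
      then have "1 \<le> ((1 + 2 * t) * (1 - t)) ^ 3" by (rule one_le_power)
      then show ?thesis using t by (simp add: pos_divide_le_eq power_mult_distrib)
    qed
    finally show "m powr (- ((3 - \<beta>) / 2)) \<le> (1 + 2 * t) ^ 3" .
  qed
  have c1: "c \<le> 1" "d \<le> 1" using c by auto
  have lo: "(1 - t) * (1 - t) * ((1 - t)\<^sup>2 * (1 - t)\<^sup>2) * (1 - t) ^ 3 \<le> kfac t c d a b"
    unfolding kfac_def m_def[symmetric] using t tc c1 p[OF tc(1)] p[OF tc(2)] q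
    by (intro mult_mono mult_nonneg_nonneg) auto
  have hi: "kfac t c d a b \<le> (1 + 2 * t) * (1 + 2 * t) * ((1 + 2 * t)\<^sup>2 * (1 + 2 * t)\<^sup>2) * (1 + 2 * t) ^ 3"
    unfolding kfac_def m_def[symmetric] using t tc c1 p[OF tc(1)] p[OF tc(2)] q
    by (intro mult_mono mult_nonneg_nonneg) auto
  have "1 + 9 * (- t) \<le> (1 + (- t)) ^ 9" using Bernoulli_inequality[of "- t" 9] t by simp
  also have "\<dots> = (1 - t) * (1 - t) * ((1 - t)\<^sup>2 * (1 - t)\<^sup>2) * (1 - t) ^ 3"
    by (simp add: eval_nat_numeral)
  finally have lo': "1 - 9 * t \<le> kfac t c d a b" using lo by simp
  have "(1 + 2 * t) * (1 + 2 * t) * ((1 + 2 * t)\<^sup>2 * (1 + 2 * t)\<^sup>2) * (1 + 2 * t) ^ 3 = (1 + 2 * t) ^ 9"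
    by (simp add: eval_nat_numeral)
  \<comment> \<open>The chord of the convex function (1 + x)^9 over the unit interval, taken at x =
    2 t; hence 1022 = 2 (2^9 - 1).\<close>
  also have "\<dots> \<le> 1 + (2 ^ 9 - 1) * (2 * t)" using t by (intro one_plus_power_le) auto
  finally have hi': "kfac t c d a b \<le> 1 + 1022 * t" using hi by simp
  show "\<bar>kfac t c d a b - 1\<bar> \<le> 1022 * t" using lo' hi' t by simp
  have "0 \<le> (1 - t) * (1 - t) * ((1 - t)\<^sup>2 * (1 - t)\<^sup>2) * (1 - t) ^ 3" using t by simp
  then show "kfac t c d a b \<ge> 0" using lo by linarith
qed

end

text \<open>With \<open>square_ratio\<close> below, these are the coefficients in the expansion of
  |flow x - flow y|^2 / |x - y|^2 as a quadratic polynomial in t. For large R this one tends to (x_j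
  - y_j)^2 / |x - y|^2, and these limits sum to 1 over j.\<close>

definition cross_ratio :: "real \<Rightarrow> 3 \<Rightarrow> real^3 \<Rightarrow> real^3 \<Rightarrow> real" where
  "cross_ratio R j x y = (R * sin (x $ j / R) - R * sin (y $ j / R)) * (x $ j - y $ j) / (norm (x - y))\<^sup>2"

definition square_ratio :: "real \<Rightarrow> 3 \<Rightarrow> real^3 \<Rightarrow> real^3 \<Rightarrow> real" where
  "square_ratio R j x y = (R * sin (x $ j / R) - R * sin (y $ j / R))\<^sup>2 / (norm (x - y))\<^sup>2"

locale riesz_shear = riesz \<beta> + shear t R j for \<beta> t R :: real and j :: 3
begin

lemma norm_flow_diff:
  assumes "x \<noteq> y"
  shows "(norm (flow x - flow y))\<^sup>2 = (norm (x - y))\<^sup>2 * (1 - 2 * t * cross_ratio R j x y + t\<^sup>2 * square_ratio R j x y)"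
proof -
  define \<delta> where "\<delta> = R * sin (x $ j / R) - R * sin (y $ j / R)"
  have fd: "flow x - flow y = (x - y) - (t * \<delta>) *\<^sub>R axis j 1"
    by (simp add: flow_def \<delta>_def algebra_simps)
  have "(norm (flow x - flow y))\<^sup>2 = (norm (x - y))\<^sup>2 - 2 * (t * \<delta>) * (x $ j - y $ j) + (t * \<delta>)\<^sup>2"
    unfolding fd power2_norm_eq_inner
    by (simp add: inner_diff_left inner_diff_right inner_axis inner_axis' power2_eq_square inner_commute algebra_simps)
  moreover have "N * (1 - 2 * t * (\<delta> * D / N) + t\<^sup>2 * (\<delta>\<^sup>2 / N)) = N - 2 * (t * \<delta>) * D + (t * \<delta>)\<^sup>2"
    if "N \<noteq> 0" for N D
    using that by (simp add: field_simps power_mult_distrib)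
  moreover have "(norm (x - y))\<^sup>2 \<noteq> 0" using assms by simp
  ultimately show ?thesis
    unfolding cross_ratio_def square_ratio_def \<delta>_def[symmetric] by simp
qed

text \<open>The flow is the identity plus a map with Lipschitz constant t, so it distorts distances
  by factors between 1 - t and 1 + t.\<close>

lemma dist_ratio_bounds:
  assumes "x \<noteq> y"
  shows "(1 - t)\<^sup>2 \<le> 1 - 2 * t * cross_ratio R j x y + t\<^sup>2 * square_ratio R j x y"
    "1 - 2 * t * cross_ratio R j x y + t\<^sup>2 * square_ratio R j x y \<le> (1 + t)\<^sup>2"
proof -
  define \<delta> where "\<delta> = R * sin (x $ j / R) - R * sin (y $ j / R)"
  have n0: "norm (x - y) > 0" using assms by simp
  have d: "\<bar>\<delta>\<bar> \<le> norm (x - y)"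
    using sin_scaled_Lipschitz[of "x $ j" "y $ j"] component_le_norm_cart[of "x - y" j] by (simp add: \<delta>_def)
  have fd: "flow x - flow y = (x - y) - (t * \<delta>) *\<^sub>R axis j 1"
    by (simp add: flow_def \<delta>_def algebra_simps)
  have nd: "norm ((t * \<delta>) *\<^sub>R (axis j 1 :: real^3)) \<le> t * norm (x - y)"
    using d t by (simp add: abs_mult)
  have lo: "(1 - t) * norm (x - y) \<le> norm (flow x - flow y)"
    unfolding fd using nd norm_triangle_ineq2[of "x - y" "(t * \<delta>) *\<^sub>R axis j 1"] by (simp add: algebra_simps)
  have hi: "norm (flow x - flow y) \<le> (1 + t) * norm (x - y)"
    unfolding fd using nd norm_triangle_ineq4[of "x - y" "(t * \<delta>) *\<^sub>R axis j 1"] by (simp add: algebra_simps)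
  have "(norm (x - y))\<^sup>2 * (1 - t)\<^sup>2 \<le> (norm (flow x - flow y))\<^sup>2"
    using power_mono[OF lo, of 2] t by (simp add: power_mult_distrib mult.commute)
  then show "(1 - t)\<^sup>2 \<le> 1 - 2 * t * cross_ratio R j x y + t\<^sup>2 * square_ratio R j x y"
    unfolding norm_flow_diff[OF assms] using n0 by (simp add: mult_le_cancel_left_pos)
  have "(norm (flow x - flow y))\<^sup>2 \<le> (norm (x - y))\<^sup>2 * (1 + t)\<^sup>2"
    using power_mono[OF hi, of 2] by (simp add: power_mult_distrib mult.commute)
  then show "1 - 2 * t * cross_ratio R j x y + t\<^sup>2 * square_ratio R j x y \<le> (1 + t)\<^sup>2"
    unfolding norm_flow_diff[OF assms] using n0 by (simp add: mult_le_cancel_left_pos)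
qed

lemma ker_flow:
  assumes "x \<noteq> y"
  shows "ker (flow x - flow y) = ker (x - y) * (1 - 2 * t * cross_ratio R j x y + t\<^sup>2 * square_ratio R j x y) powr (- ((3 - \<beta>) / 2))"
proof -
  define m where "m = 1 - 2 * t * cross_ratio R j x y + t\<^sup>2 * square_ratio R j x y"
  have n0: "norm (x - y) > 0" using assms by simp
  have "0 < (1 - t)\<^sup>2" using t by simp
  then have m0: "m > 0" using dist_ratio_bounds(1)[OF assms] unfolding m_def[symmetric] by linarith
  have e: "norm z powr (3 - \<beta>) = ((norm z)\<^sup>2) powr ((3 - \<beta>) / 2)" for z :: "real^3"
  proof (cases "z = 0")
    case False
    then have "(norm z)\<^sup>2 = norm z powr 2" by (simp add: powr_numeral)
    moreover have "2 * ((3 - \<beta>) / 2) = 3 - \<beta>" by simp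
    ultimately show ?thesis by (simp only: powr_powr)
  qed simp
  show ?thesis
    unfolding ker_eq e[of "flow x - flow y"] e[of "x - y"] norm_flow_diff[OF assms] m_def[symmetric]
    using n0 m0 by (simp add: powr_mult powr_minus_divide)
qed

end

section \<open>The virial identity\<close>

text \<open>\<open>v\<close> is the gradient and \<open>w\<close> the Hessian of \<open>g\<close>.
  Its symmetry is encoded by the two assumptions \<open>v_w\<close> and \<open>v_w'\<close> on the
  same function \<open>w i k\<close>.\<close>

locale choquard = riesz \<beta> for \<beta> :: real +
  fixes g :: "real^3 \<Rightarrow> complex" and v :: "3 \<Rightarrow> real^3 \<Rightarrow> complex"
    and w :: "3 \<Rightarrow> 3 \<Rightarrow> real^3 \<Rightarrow> complex" and \<omega> :: real
  assumes g_cont: "continuous_on UNIV g" and g_L2: "g \<in> L2"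
    and v_L2: "v i \<in> L2" and g_v: "wderiv i g (v i)"
    and w_L2: "w i k \<in> L2" and v_w: "wderiv i (v k) (w i k)" and v_w': "wderiv k (v i) (w i k)"
    and equation: "AE x in lborel. - (\<Sum>k\<in>UNIV. w k k x) + of_real \<omega> * g x =
       of_real (convolution ker (\<lambda>y. norm (g y) powr pex) x) * of_real (norm (g x) powr (pex - 2)) * g x"
begin

definition N :: "real^3 \<Rightarrow> complex" where "N x = - (\<Sum>k\<in>UNIV. w k k x) + of_real \<omega> * g x"

text \<open>The generator \<xi> \<partial>_j + \<xi>'/2 of the L^2-isometric transport along the
  field \<xi>(x_j) e_j, applied to \<open>g\<close>; here \<xi>' is the cosine.\<close>

definition \<Lambda> :: "real \<Rightarrow> 3 \<Rightarrow> real^3 \<Rightarrow> complex" where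
  "\<Lambda> R j x = of_real (R * sin (x $ j / R)) * v j x + of_real (cos (x $ j / R) / 2) * g x"

lemma L2_uminus: "f \<in> L2 \<Longrightarrow> (\<lambda>x. - f x) \<in> L2"
  using L2_cmult[of f "-1"] by simp

lemma N_L2: "N \<in> L2"
proof -
  have "(\<lambda>x. w 1 1 x + w 2 2 x + w 3 3 x) \<in> L2"
    by (rule L2_add[OF L2_add[OF w_L2 w_L2] w_L2])
  moreover have "N = (\<lambda>x. - (w 1 1 x + w 2 2 x + w 3 3 x) + of_real \<omega> * g x)"
    by (simp only: fun_eq_iff N_def sum_3) simp
  ultimately show ?thesis by (simp only: L2_add[OF L2_uminus L2_cmult[OF g_L2]])
qed

lemma coordinate_measurable [measurable]: "(\<lambda>x::real^3. x $ k) \<in> borel_measurable borel"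
  by (intro borel_measurable_continuous_onI continuous_intros)

lemma weighted_L2:
  assumes "f \<in> L2"
  shows "(\<lambda>x. of_real (c * sin (x $ j / R)) * f x) \<in> L2" "(\<lambda>x. of_real (c * cos (x $ j / R)) * f x) \<in> L2"
  using assms by (auto intro!: L2_mult_bounded[where C="\<bar>c\<bar>"] simp: norm_mult mult_left_le abs_mult simp del: of_real_mult)

lemma \<Lambda>_L2: "\<Lambda> R j \<in> L2"
  using L2_add[OF weighted_L2(1)[OF v_L2, of R j R j] weighted_L2(2)[OF g_L2, of "1/2" j R]]
  by (simp add: \<Lambda>_def[abs_def])

lemma IBP_sin:
  assumes R: "R > 0" and f: "f \<in> L2" "f' \<in> L2" "wderiv i f f'" and h: "h \<in> L2" "h' \<in> L2" "wderiv i h h'"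
  shows "(LINT x|lborel. of_real (R * sin (x $ k / R)) * (f' x * h x)) =
     - (LINT x|lborel. of_real (R * sin (x $ k / R)) * (f x * h' x))
     - (if i = k then (LINT x|lborel. of_real (cos (x $ k / R)) * (f x * h x)) else 0)"
proof -
  have d: "deriv (\<lambda>s. R * sin (1 / R * s)) = (\<lambda>s. cos (s / R))"
    using R by (intro ext DERIV_imp_deriv) (auto intro!: derivative_eq_intros)
  have "(LINT x|lborel. of_real (R * sin (1 / R * x $ k)) * (f' x * h x)) =
     - (LINT x|lborel. of_real (R * sin (1 / R * x $ k)) * (f x * h' x))
     - (if i = k then (LINT x|lborel. of_real (deriv (\<lambda>s. R * sin (1 / R * s)) (x $ k)) * (f x * h x)) else 0)"
  proof (rule wderiv_IBP_weight[OF f h smooth_sin_cos(1), where A="max R 1"])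
    show "\<bar>deriv (\<lambda>s. R * sin (1 / R * s)) s\<bar> \<le> max R 1" for s unfolding d by (simp add: le_max_iff_disj)
  qed (use R in \<open>auto simp: abs_mult le_max_iff_disj mult_left_le\<close>)
  then show ?thesis unfolding d by simp
qed

lemma IBP_cos:
  assumes R: "R > 0" and f: "f \<in> L2" "f' \<in> L2" "wderiv i f f'" and h: "h \<in> L2" "h' \<in> L2" "wderiv i h h'"
  shows "(LINT x|lborel. of_real (cos (x $ k / R)) * (f' x * h x)) =
     - (LINT x|lborel. of_real (cos (x $ k / R)) * (f x * h' x))
     + (if i = k then (LINT x|lborel. of_real (sin (x $ k / R) / R) * (f x * h x)) else 0)"
proof -
  have d: "deriv (\<lambda>s. 1 * cos (1 / R * s)) = (\<lambda>s. - (sin (s / R) / R))"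
    using R by (intro ext DERIV_imp_deriv) (auto intro!: derivative_eq_intros)
  have "(LINT x|lborel. of_real (1 * cos (1 / R * x $ k)) * (f' x * h x)) =
     - (LINT x|lborel. of_real (1 * cos (1 / R * x $ k)) * (f x * h' x))
     - (if i = k then (LINT x|lborel. of_real (deriv (\<lambda>s. 1 * cos (1 / R * s)) (x $ k)) * (f x * h x)) else 0)"
  proof (rule wderiv_IBP_weight[OF f h smooth_sin_cos(2), where A="max (1 / R) 1"])
    show "\<bar>deriv (\<lambda>s. 1 * cos (1 / R * s)) s\<bar> \<le> max (1 / R) 1" for s
      unfolding d using R by (simp add: le_max_iff_disj divide_right_mono)
  qed (auto simp: le_max_iff_disj)
  then show ?thesis unfolding d by simp
qed

lemma weighted_integrable:
  assumes "f \<in> L2" "h \<in> L2"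
  shows "integrable lborel (\<lambda>x. of_real (R * sin (x $ j / R)) * (f x * h x))"
    "integrable lborel (\<lambda>x. of_real (cos (x $ j / R)) * (f x * h x))"
  using L2_mult_integrable[OF weighted_L2(1)[OF assms(1), of R j R] assms(2)]
    L2_mult_integrable[OF weighted_L2(2)[OF assms(1), of 1 j R] assms(2)]
  by (simp_all add: mult.assoc)

text \<open>Integrations by parts produce the terms \<open>S (v k) (w k j)\<close>, whose real part
  is minus half of \<open>C (v k) (v k)\<close> and cancels against the contribution of the term
  \<xi>' g/2. Only k = j leaves a remainder: the weighted gradient square, and a term from \<xi>''
  of order 1/R. The \<omega> part drops out since the generator is antisymmetric.\<close>

lemma virial_identity:
  assumes R: "R > 0"
  shows "Re (LINT x|lborel. N x * cnj (\<Lambda> R j x)) =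
    (LINT x|lborel. cos (x $ j / R) * (norm (v j x))\<^sup>2)
    - Re (LINT x|lborel. of_real (sin (x $ j / R)) * (v j x * cnj (g x))) / (2 * R)"
proof -
  let ?V = "(LINT x|lborel. N x * cnj (\<Lambda> R j x))"
  define S where "S f h = (LINT x|lborel. of_real (R * sin (x $ j / R)) * (f x * cnj (h x)))" for f h :: "real^3 \<Rightarrow> complex"
  define C where "C f h = (LINT x|lborel. of_real (cos (x $ j / R)) * (f x * cnj (h x)))" for f h :: "real^3 \<Rightarrow> complex"
  have int: "integrable lborel (\<lambda>x. of_real (R * sin (x $ j / R)) * (f x * cnj (h x)))"
    "integrable lborel (\<lambda>x. of_real (cos (x $ j / R)) * (f x * cnj (h x)))" if "f \<in> L2" "h \<in> L2" for f h
    using weighted_integrable[OF that(1) L2_cnj[OF that(2)]] by auto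
  define E where "E = (LINT x|lborel. of_real (sin (x $ j / R) / R) * (v j x * cnj (g x)))"
  have expand: "(LINT x|lborel. f x * cnj (\<Lambda> R j x)) = S f (v j) + C f g / 2" if "f \<in> L2" for f
  proof -
    have "(LINT x|lborel. f x * cnj (\<Lambda> R j x)) = (LINT x|lborel. of_real (R * sin (x $ j / R)) * (f x * cnj (v j x))
        + (of_real (cos (x $ j / R)) * (f x * cnj (g x))) / 2)"
      by (intro Bochner_Integration.integral_cong) (auto simp: \<Lambda>_def algebra_simps)
    also have "\<dots> = S f (v j) + C f g / 2"
      unfolding S_def C_def using int[OF that v_L2, of j] int[OF that g_L2] by simp
    finally show ?thesis .
  qed
  have cnj_S: "S h f = cnj (S f h)" for f h
    unfolding S_def by (subst Bochner_Integration.integral_cnj[symmetric]) (simp add: mult_ac)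
  have C_real: "C f f = of_real (LINT x|lborel. cos (x $ j / R) * (norm (f x))\<^sup>2)" for f
    unfolding C_def by (simp add: complex_norm_square[symmetric] flip: of_real_power of_real_mult integral_complex_of_real)
  have 1: "S (w k k) (v j) = - S (v k) (w k j) - (if k = j then C (v j) (v j) else 0)" for k
    using IBP_sin[OF R v_L2[of k] w_L2[of k k] v_w[of k k] L2_cnj[OF v_L2[of j]] L2_cnj[OF w_L2[of k j]]
        wderiv_cnj[OF v_w[of k j]], of j]
    unfolding S_def C_def by auto
  have 2: "C (w k k) g = - C (v k) (v k) + (if k = j then E else 0)" for k
    using IBP_cos[OF R v_L2[of k] w_L2[of k k] v_w[of k k] L2_cnj[OF g_L2] L2_cnj[OF v_L2[of k]]
        wderiv_cnj[OF g_v[of k]], of j]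
    unfolding C_def E_def by auto
  \<comment> \<open>Here \<open>w k j\<close> is read as the j-th derivative of \<open>v k\<close>,
    whereas in fact 1 it was the k-th derivative of \<open>v j\<close>: this is where symmetry of
    the Hessian enters.\<close>
  have 3: "2 * Re (S (v k) (w k j)) = - Re (C (v k) (v k))" for k
  proof -
    have "S (w k j) (v k) = - S (v k) (w k j) - C (v k) (v k)"
      using IBP_sin[OF R v_L2[of k] w_L2[of k j] v_w'[of j k] L2_cnj[OF v_L2[of k]] L2_cnj[OF w_L2[of k j]]
          wderiv_cnj[OF v_w'[of j k]], of j]
      unfolding S_def C_def by simp
    from arg_cong[OF this, of Re] show ?thesis by (simp add: cnj_S[of "w k j"])
  qed
  have 4: "2 * Re (S g (v j)) = - Re (C g g)"
  proof -
    have "S (v j) g = - S g (v j) - C g g"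
      using IBP_sin[OF R g_L2 v_L2[of j] g_v[of j] L2_cnj[OF g_L2] L2_cnj[OF v_L2[of j]]
          wderiv_cnj[OF g_v[of j]], of j]
      unfolding S_def C_def by simp
    from arg_cong[OF this, of Re] show ?thesis by (simp add: cnj_S[of "v j" g])
  qed
  have Li: "integrable lborel (\<lambda>x. f x * cnj (\<Lambda> R j x))" if "f \<in> L2" for f
    by (intro L2_mult_integrable L2_cnj \<Lambda>_L2 that)
  have "?V =
     (LINT x|lborel. - (\<Sum>k\<in>UNIV. w k k x * cnj (\<Lambda> R j x)) + of_real \<omega> * (g x * cnj (\<Lambda> R j x)))"
    by (intro Bochner_Integration.integral_cong) (auto simp: N_def algebra_simps sum_distrib_left)
  also have "\<dots> = - (\<Sum>k\<in>UNIV. LINT x|lborel. w k k x * cnj (\<Lambda> R j x)) + of_real \<omega> * (LINT x|lborel. g x * cnj (\<Lambda> R j x))"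
    using Li[OF w_L2] Li[OF g_L2] by (simp add: Bochner_Integration.integral_sum)
  also have "\<dots> = - (\<Sum>k\<in>UNIV. S (w k k) (v j) + C (w k k) g / 2) + of_real \<omega> * (S g (v j) + C g g / 2)"
    by (simp add: expand w_L2 g_L2)
  finally have "Re ?V =
     - (\<Sum>k\<in>UNIV. Re (S (w k k) (v j)) + Re (C (w k k) g) / 2) + \<omega> * (Re (S g (v j)) + Re (C g g) / 2)"
    by (simp add: Re_divide_numeral)
  also have "\<omega> * (Re (S g (v j)) + Re (C g g) / 2) = 0" using 4 by simp
  also have "(\<Sum>k\<in>UNIV. Re (S (w k k) (v j)) + Re (C (w k k) g) / 2) = (\<Sum>k\<in>UNIV. if k = j then - Re (C (v j) (v j)) + Re E / 2 else 0)"
  proof (intro sum.cong refl)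
    fix k
    show "Re (S (w k k) (v j)) + Re (C (w k k) g) / 2 = (if k = j then - Re (C (v j) (v j)) + Re E / 2 else 0)"
      using 3[of k] by (cases "k = j") (simp_all add: 1 2 field_simps)
  qed
  also have "\<dots> = - Re (C (v j) (v j)) + Re E / 2" by simp
  finally have "Re ?V = Re (C (v j) (v j)) - Re E / 2" by simp
  moreover have "E = (LINT x|lborel. of_real (sin (x $ j / R)) * (v j x * cnj (g x))) / of_real R"
    unfolding E_def by (simp flip: integral_divide_zero)
  ultimately show ?thesis by (simp add: C_real Re_divide_of_real)
qed

section \<open>The density |g|^p, its potential and its energy\<close>

definition f :: "real^3 \<Rightarrow> real" where "f x = norm (g x) powr pex"

definition U :: "real^3 \<Rightarrow> real" where "U x = convolution ker f x"

definition D :: real where "D = (LINT x|lborel. Re (N x * cnj (g x)))"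

lemma measurables [measurable]:
  "g \<in> borel_measurable borel" "f \<in> borel_measurable borel" "U \<in> borel_measurable borel"
  "N \<in> borel_measurable borel" "v j \<in> borel_measurable borel"
proof -
  show [measurable]: "g \<in> borel_measurable borel" using g_L2 by (rule L2_measurable)
  show [measurable]: "f \<in> borel_measurable borel" unfolding f_def by measurable
  show "U \<in> borel_measurable borel" unfolding U_def[abs_def] convolution_def by measurable
  show "N \<in> borel_measurable borel" using N_L2 by (rule L2_measurable)
  show "v j \<in> borel_measurable borel" using v_L2 by (rule L2_measurable)
qed

lemma f_nonneg: "f x \<ge> 0" by (simp add: f_def)

lemma U_nonneg: "U x \<ge> 0"
  unfolding U_def convolution_def by (intro integral_nonneg_AE) (auto simp: ker_nonneg f_nonneg)

text \<open>Valid at every point: finiteness of the convolution rules out the default value 0 of a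
  divergent Bochner integral.\<close>

lemma U_nn_integral: "(\<integral>\<^sup>+y. ennreal (ker (x - y)) * ennreal (f y) \<partial>lborel) = ennreal (U x)"
proof -
  have fin: "(\<integral>\<^sup>+y. ennreal (ker (x - y) * f y) \<partial>lborel) < \<infinity>"
    using ker_powr_integral_finite[OF g_cont g_L2, of x] by (simp add: f_def pex_def)
  have "integrable lborel (\<lambda>y. ker (x - y) * f y)"
    by (rule integrableI_bounded) (use fin in \<open>auto simp: abs_mult ker_nonneg f_nonneg\<close>)
  then have "(\<integral>\<^sup>+y. ennreal (ker (x - y) * f y) \<partial>lborel) = ennreal (U x)"
    unfolding U_def convolution_def by (intro nn_integral_eq_integral) (auto simp: ker_nonneg f_nonneg)
  then show ?thesis by (simp add: ennreal_mult ker_nonneg f_nonneg)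
qed

lemma energy_f:
  assumes [measurable]: "a \<in> borel_measurable borel" 
  shows "energy a (\<lambda>x. ennreal (f x)) = (\<integral>\<^sup>+x. a x * ennreal (U x) \<partial>lborel)"
  unfolding energy_def
proof (rule nn_integral_cong)
  fix x
  have "(\<integral>\<^sup>+y. ennreal (ker (x - y)) * a x * ennreal (f y) \<partial>lborel) = (\<integral>\<^sup>+y. a x * (ennreal (ker (x - y)) * ennreal (f y)) \<partial>lborel)"
    by (simp add: mult_ac)
  also have "\<dots> = a x * ennreal (U x)"
    unfolding U_nn_integral[symmetric] by (rule nn_integral_cmult) measurable
  finally show "(\<integral>\<^sup>+y. ennreal (ker (x - y)) * a x * ennreal (f y) \<partial>lborel) = a x * ennreal (U x)" .
qed

lemma N_eq: "AE x in lborel. N x = of_real (U x * norm (g x) powr (pex - 2)) * g x"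
  using equation unfolding U_def f_def[abs_def] N_def by simp

lemma N_pairing: "AE x in lborel. Re (N x * cnj (g x)) = U x * f x"
  using N_eq
proof eventually_elim
  case (elim x)
  \<comment> \<open>The exponent \<open>pex - 2\<close> is negative, but at zeros of
    \<open>g\<close> both sides are 0 because 0 \<open>powr\<close> anything is 0.\<close>
  have "norm (g x) powr (pex - 2) * (norm (g x))\<^sup>2 = f x"
    unfolding f_def by (cases "g x = 0") (simp_all add: powr_diff powr_numeral)
  moreover have "N x * cnj (g x) = of_real (U x * (norm (g x) powr (pex - 2) * (norm (g x))\<^sup>2))"
    unfolding elim using complex_norm_square[of "g x"] by (simp add: mult_ac)
  ultimately show ?case by simp
qed

text \<open>The equation itself gives finite energy: U f is almost everywhere the real part of a
  product of two \<open>L2\<close> functions, so the Hardy-Littlewood-Sobolev inequality is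
  bypassed.\<close>

lemma Uf_integrable: "integrable lborel (\<lambda>x. U x * f x)" and D_eq: "D = (LINT x|lborel. U x * f x)"
proof -
  have "integrable lborel (\<lambda>x. Re (N x * cnj (g x)))"
    by (intro integrable_Re L2_mult_integrable L2_cnj N_L2 g_L2)
  then show "integrable lborel (\<lambda>x. U x * f x)"
    using integrable_cong_AE[OF _ _ N_pairing] by simp
  show "D = (LINT x|lborel. U x * f x)" unfolding D_def
    by (rule integral_cong_AE) (use N_pairing in auto)
qed

lemma energy_ff: "energy (\<lambda>x. ennreal (f x)) (\<lambda>x. ennreal (f x)) = ennreal D"
proof -
  have "(\<integral>\<^sup>+x. ennreal (f x) * ennreal (U x) \<partial>lborel) = (\<integral>\<^sup>+x. ennreal (U x * f x) \<partial>lborel)"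
    by (simp add: ennreal_mult f_nonneg U_nonneg mult.commute)
  also have "\<dots> = ennreal D"
    unfolding D_eq by (intro nn_integral_eq_integral Uf_integrable) (auto simp: f_nonneg U_nonneg)
  finally show ?thesis by (simp add: energy_f)
qed

lemma D_nonneg: "D \<ge> 0"
  unfolding D_eq by (intro integral_nonneg_AE) (auto simp: f_nonneg U_nonneg)

end

text \<open>The exceptional null set must not depend on \<open>s\<close>, because \<open>s\<close> will be a function of \<open>x\<close>; this is where the
  continuity of \<open>g\<close> is used.\<close>
context choquard
begin

lemma g_difference_osc:
  assumes M: "M > 0"
  shows "AE x in lborel. \<forall>s. \<bar>s\<bar> \<le> M \<longrightarrow> ennreal (norm (g (x + s *\<^sub>R axis j 1) - g x - s *\<^sub>R v j x)) \<le> osc (v j) j M x"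
proof -
  \<comment> \<open>Countably many steps have one common null set; off it, continuity of
    \<open>g\<close> extends the bound from rational steps to the whole closed interval.\<close>
  have "AE x in lborel. \<forall>q::rat. \<bar>real_of_rat q\<bar> \<le> M \<longrightarrow>
     ennreal (norm (g (x + real_of_rat q *\<^sub>R axis j 1) - g x - real_of_rat q *\<^sub>R v j x)) \<le> osc (v j) j M x"
  proof (unfold AE_all_countable, rule allI)
    fix q :: rat
    show "AE x in lborel. \<bar>real_of_rat q\<bar> \<le> M \<longrightarrow>
     ennreal (norm (g (x + real_of_rat q *\<^sub>R axis j 1) - g x - real_of_rat q *\<^sub>R v j x)) \<le> osc (v j) j M x"
    proof (cases "\<bar>real_of_rat q\<bar> \<le> M")
      case True
      show ?thesis using wderiv_difference_osc[OF g_L2 v_L2 g_v True, of j] by eventually_elim simp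
    qed simp
  qed
  then show ?thesis
  proof eventually_elim
    case (elim x)
    show ?case
    proof (cases "osc (v j) j M x = top")
      case False
      define c where "c = enn2real (osc (v j) j M x)"
      have c: "osc (v j) j M x = ennreal c" "c \<ge> 0" using False by (auto simp: c_def less_top)
      let ?q = "\<lambda>s. norm (g (x + s *\<^sub>R axis j 1) - g x - s *\<^sub>R v j x)"
      have cont: "continuous_on UNIV ?q"
        by (intro continuous_intros continuous_on_compose2[OF g_cont]) auto
      have rat: "?q s \<le> c" if "s \<in> {- M<..<M} \<inter> \<rat>" for s
      proof -
        have "s \<in> \<rat>" using that by simp
        then obtain r where r: "s = real_of_rat r" by (rule Rats_cases)
        have "- M < real_of_rat r" "real_of_rat r < M" using that unfolding r by auto
        then have "\<bar>real_of_rat r\<bar> \<le> M" by linarith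
        then have "ennreal (?q s) \<le> ennreal c" using elim unfolding c(1) r by blast
        then show ?thesis using c(2) by (simp add: ennreal_le_iff)
      qed
      have "{- M..M} \<subseteq> closure ({- M<..<M} \<inter> \<rat>)"
      proof -
        have "closure ({- M<..<M} \<inter> \<rat>) = closure {- M<..<M}"
          by (rule closure_open_Int_superset) (auto simp: Rats_closure_real)
        then show ?thesis using M by simp
      qed
      moreover have "closure ({- M<..<M} \<inter> \<rat>) \<subseteq> {s. ?q s \<le> c}"
        using rat cont by (intro closure_minimal closed_Collect_le) auto
      ultimately have sub: "{- M..M} \<subseteq> {s. ?q s \<le> c}" by (rule order.trans)
      have "?q s \<le> c" if "\<bar>s\<bar> \<le> M" for s
      proof -
        have "s \<in> {- M..M}" using that by (auto simp: abs_le_iff)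
        then show ?thesis using sub by blast
      qed
      then show ?thesis unfolding c(1) by (auto intro: ennreal_leI)
    qed simp
  qed
qed

definition H :: "(real^3) \<times> (real^3) \<Rightarrow> real" where "H = (\<lambda>(x, y). ker (x - y) * f x * f y)"

lemma H_measurable [measurable]: "H \<in> borel_measurable (lborel \<Otimes>\<^sub>M lborel)"
  unfolding H_def by measurable

lemma H_nonneg: "H p \<ge> 0"
  by (auto simp: H_def ker_nonneg f_nonneg split: prod.split)

lemma H_nn_integral: "(\<integral>\<^sup>+p. ennreal (H p) \<partial>(lborel \<Otimes>\<^sub>M lborel)) = ennreal D"
proof -
  have "(\<integral>\<^sup>+p. ennreal (H p) \<partial>(lborel \<Otimes>\<^sub>M lborel)) = (\<integral>\<^sup>+x. \<integral>\<^sup>+y. ennreal (H (x, y)) \<partial>lborel \<partial>lborel)"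
    by (subst lborel.nn_integral_fst[symmetric]) auto
  also have "\<dots> = energy (\<lambda>x. ennreal (f x)) (\<lambda>x. ennreal (f x))"
    unfolding energy_def by (simp add: H_def ennreal_mult ker_nonneg f_nonneg)
  finally show ?thesis by (simp add: energy_ff)
qed

lemma H_integrable: "integrable (lborel \<Otimes>\<^sub>M lborel) H"
  by (rule integrableI_bounded) (auto simp: H_nonneg H_nn_integral)

lemma H_integral: "(LINT p|(lborel \<Otimes>\<^sub>M lborel). H p) = D"
  using nn_integral_eq_integral[OF H_integrable] H_nonneg D_nonneg
  by (simp add: H_nn_integral integral_nonneg_AE)

end

section \<open>The function transported by a shear as a competitor\<close>

locale choquard_shear = choquard \<beta> g v w \<omega> + riesz_shear \<beta> t R j
  for \<beta> :: real and g :: "real^3 \<Rightarrow> complex" and v :: "3 \<Rightarrow> real^3 \<Rightarrow> complex"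
    and w :: "3 \<Rightarrow> 3 \<Rightarrow> real^3 \<Rightarrow> complex" and \<omega> t R :: real and j :: 3 +
  assumes t_half: "t \<le> 1/2"
begin

text \<open>An exact isometry would carry the amplitude (Jacobian)^(-1/2). Its first-order part in t
  has the same generator and keeps the expansion polynomial.\<close>

definition u :: "real^3 \<Rightarrow> complex" where
  "u x = of_real (1 + t / 2 * cos (unflow x $ j / R)) * g (unflow x)"

definition ft :: "real^3 \<Rightarrow> real" where "ft x = norm (u x) powr pex"

definition K :: "(real^3) \<times> (real^3) \<Rightarrow> real" where
  "K = (\<lambda>(x, y). kfac t (cos (x $ j / R)) (cos (y $ j / R)) (cross_ratio R j x y) (square_ratio R j x y))"

definition Dt :: real where "Dt = (LINT p|(lborel \<Otimes>\<^sub>M lborel). K p * H p)"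

lemma u_measurable [measurable]: "u \<in> borel_measurable borel"
proof -
  have "(\<lambda>x. unflow x $ j) \<in> borel_measurable borel"
    using measurable_compose[OF unflow_measurable coordinate_measurable] .
  then show ?thesis unfolding u_def by measurable
qed

lemma ft_measurable [measurable]: "ft \<in> borel_measurable borel"
  unfolding ft_def by measurable

lemma ft_nonneg: "ft x \<ge> 0" by (simp add: ft_def)

lemma cos_factor: "0 < 1 + t / 2 * cos s" "1 + t / 2 * cos s \<le> 2"
proof -
  have "\<bar>t / 2 * cos s\<bar> \<le> t / 2" using t by (auto simp: abs_mult mult_left_le)
  then show "0 < 1 + t / 2 * cos s" "1 + t / 2 * cos s \<le> 2" using t by linarith+
qed

lemma u_flow: "u (flow x) = of_real (1 + t / 2 * cos (x $ j / R)) * g x"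
  by (simp add: u_def unflow_flow)

lemma ft_flow: "ft (flow x) = (1 + t / 2 * cos (x $ j / R)) powr pex * f x"
  using cos_factor(1)[of "x $ j / R"]
  unfolding ft_def u_flow f_def norm_mult norm_of_real by (simp add: powr_mult)

lemma u_L2: "u \<in> L2"
proof -
  have "(\<integral>\<^sup>+x. ennreal ((norm (u x))\<^sup>2) \<partial>lborel) = (\<integral>\<^sup>+x. ennreal (jac x) * ennreal ((norm (u (flow x)))\<^sup>2) \<partial>lborel)"
    by (rule nn_integral_flow) measurable
  also have "\<dots> \<le> (\<integral>\<^sup>+x. ennreal 8 * ennreal ((norm (g x))\<^sup>2) \<partial>lborel)"
  proof (rule nn_integral_mono)
    fix x
    have "\<bar>t * cos (x $ j / R)\<bar> \<le> 1" using t by (auto simp: abs_mult intro: mult_le_one)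
    then have "jac x \<le> 2" by (simp add: jac_def abs_le_iff)
    moreover have "(norm (u (flow x)))\<^sup>2 \<le> 4 * (norm (g x))\<^sup>2"
    proof -
      have "norm (u (flow x)) \<le> 2 * norm (g x)"
        unfolding u_flow norm_mult norm_of_real using cos_factor[of "x $ j / R"]
        by (intro mult_right_mono) auto
      from power_mono[OF this, of 2] show ?thesis by (simp add: power_mult_distrib)
    qed
    ultimately have "jac x * (norm (u (flow x)))\<^sup>2 \<le> 2 * (4 * (norm (g x))\<^sup>2)"
      using jac_pos[of x] by (intro mult_mono) auto
    then show "ennreal (jac x) * ennreal ((norm (u (flow x)))\<^sup>2) \<le> ennreal 8 * ennreal ((norm (g x))\<^sup>2)"
      using jac_pos[of x] by (subst (1 2) ennreal_mult[symmetric]) (auto intro!: ennreal_leI)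
  qed
  also have "\<dots> = ennreal 8 * (\<integral>\<^sup>+x. ennreal ((norm (g x))\<^sup>2) \<partial>lborel)" by (rule nn_integral_cmult) measurable
  also have "\<dots> < \<infinity>" using g_L2 by (auto simp: L2_iff integrable_iff_bounded ennreal_mult_less_top)
  finally show ?thesis unfolding L2_iff by (auto intro: integrableI_bounded)
qed

lemma K_nonneg: "K p \<ge> 0"
proof -
  have "0 \<le> 1 - t * cos s" for s
  proof -
    have "\<bar>t * cos s\<bar> \<le> 1" using t by (auto simp: abs_mult intro: mult_le_one)
    then show ?thesis by (simp add: abs_le_iff)
  qed
  then show ?thesis by (auto simp: K_def kfac_def split: prod.split)
qed

lemma K_bound: "fst p \<noteq> snd p \<Longrightarrow> \<bar>K p - 1\<bar> \<le> 1022 * t"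
  using kfac_bound(1)[OF t(1) t_half _ _ dist_ratio_bounds] by (auto simp: K_def split: prod.split)

text \<open>The bound on \<open>K\<close> covers only distinct points; on the diagonal
  \<open>H\<close> vanishes because \<open>ker\<close> has the default value 0 at the
  origin.\<close>

lemma H_diag: "fst p = snd p \<Longrightarrow> H p = 0"
  by (cases p) (simp add: H_def ker_eq)

lemma K_measurable [measurable]: "K \<in> borel_measurable (lborel \<Otimes>\<^sub>M lborel)"
  unfolding K_def kfac_def cross_ratio_def square_ratio_def by measurable

lemma KH_bound: "\<bar>(K p - 1) * H p\<bar> \<le> 1022 * t * H p"
proof (cases "fst p = snd p")
  case False
  then show ?thesis using K_bound[OF False] H_nonneg[of p] by (simp add: abs_mult mult_right_mono)
qed (simp add: H_diag)

lemma KH_integrable: "integrable (lborel \<Otimes>\<^sub>M lborel) (\<lambda>p. K p * H p)"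
proof -
  have "integrable (lborel \<Otimes>\<^sub>M lborel) (\<lambda>p. (K p - 1) * H p)"
    by (rule Bochner_Integration.integrable_bound[OF integrable_mult_right[OF H_integrable, of "1022 * t"]])
       (use KH_bound H_nonneg t in \<open>auto simp: abs_mult\<close>)
  from Bochner_Integration.integrable_add[OF this H_integrable] show ?thesis by (simp add: algebra_simps)
qed

lemma Dt_diff: "Dt - D = (LINT p|(lborel \<Otimes>\<^sub>M lborel). (K p - 1) * H p)"
  unfolding Dt_def H_integral[symmetric] using KH_integrable H_integrable
  by (subst Bochner_Integration.integral_diff[symmetric]) (auto simp: algebra_simps)

text \<open>Changing variables by the flow in both integrals returns the density \<open>H\<close>;
  the two Jacobians, the two amplitudes and the distortion of the kernel collect into
  \<open>K\<close>.\<close>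

lemma energy_ft: "energy (\<lambda>x. ennreal (ft x)) (\<lambda>x. ennreal (ft x)) = ennreal Dt"
proof -
  let ?E = "\<lambda>x. (\<integral>\<^sup>+y. ennreal (ker (flow x - y)) * ennreal (ft (flow x)) * ennreal (ft y) \<partial>lborel)"
  let ?L = "\<lambda>x y. (ennreal (ker (flow x - flow y)) * ennreal (ft (flow x)) * ennreal (ft (flow y)))"
  have "energy (\<lambda>x. ennreal (ft x)) (\<lambda>x. ennreal (ft x)) =
     (\<integral>\<^sup>+x. ennreal (jac x) * (?E x) \<partial>lborel)"
    unfolding energy_def by (rule nn_integral_flow) measurable
  also have "\<dots> = (\<integral>\<^sup>+x. \<integral>\<^sup>+y. ennreal (K (x, y) * H (x, y)) \<partial>lborel \<partial>lborel)"
  proof (rule nn_integral_cong)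
    fix x
    have "(?E x) =
      (\<integral>\<^sup>+y. ennreal (jac y) * (?L x y) \<partial>lborel)"
      by (rule nn_integral_flow) measurable
    then have "ennreal (jac x) * (?E x) =
      (\<integral>\<^sup>+y. ennreal (jac x) * (ennreal (jac y) * (?L x y)) \<partial>lborel)"
      by (simp only:) (rule nn_integral_cmult[symmetric], measurable)
    also have "\<dots> = (\<integral>\<^sup>+y. ennreal (K (x, y) * H (x, y)) \<partial>lborel)"
    proof (rule nn_integral_cong)
      fix y
      have "jac x * (jac y * (ker (flow x - flow y) * ft (flow x) * ft (flow y))) = K (x, y) * H (x, y)"
      proof (cases "x = y")
        case False
        show ?thesis unfolding ker_flow[OF False] ft_flow K_def H_def kfac_def jac_def by (simp add: mult_ac)
      qed (simp add: H_def ker_eq)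
      then show "ennreal (jac x) * (ennreal (jac y) * (?L x y)) =
         ennreal (K (x, y) * H (x, y))"
        using jac_pos[of x] jac_pos[of y] ker_nonneg ft_nonneg by (simp flip: ennreal_mult)
    qed
    finally show "ennreal (jac x) * (?E x) =
      (\<integral>\<^sup>+y. ennreal (K (x, y) * H (x, y)) \<partial>lborel)" .
  qed
  also have "\<dots> = (\<integral>\<^sup>+p. ennreal (K p * H p) \<partial>(lborel \<Otimes>\<^sub>M lborel))"
    by (subst lborel.nn_integral_fst[symmetric]) auto
  also have "\<dots> = ennreal Dt"
    unfolding Dt_def by (intro nn_integral_eq_integral KH_integrable) (auto simp: K_nonneg H_nonneg)
  finally show ?thesis .
qed

lemma Dt_nonneg: "Dt \<ge> 0"
  unfolding Dt_def by (intro integral_nonneg_AE) (auto simp: K_nonneg H_nonneg)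

text \<open>The integral is the mixed energy of \<open>ft\<close> and \<open>f\<close>, which
  polarization bounds by the mean of the two pure energies.\<close>

lemma riesz_pairing_ft: "integrable lborel (\<lambda>x. U x * ft x)" "(LINT x|lborel. U x * ft x) \<le> (Dt + D) / 2"
proof -
  let ?I = "(\<integral>\<^sup>+x. ennreal (U x * ft x) \<partial>lborel)"
  let ?J = "(LINT x|lborel. U x * ft x)"
  have nn: "?I = energy (\<lambda>x. ennreal (ft x)) (\<lambda>x. ennreal (f x))"
    by (subst energy_f) (auto simp: ennreal_mult U_nonneg ft_nonneg mult.commute)
  have "2 * energy (\<lambda>x. ennreal (ft x)) (\<lambda>x. ennreal (f x)) \<le> ennreal (Dt + D)"
    using energy_polarization[of "\<lambda>x. ennreal (ft x)" "\<lambda>x. ennreal (f x)"]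
    by (simp add: energy_ft energy_ff Dt_nonneg D_nonneg)
  then have le: "2 * ?I \<le> ennreal (Dt + D)" by (simp add: nn)
  then have "2 * ?I < top" by (rule le_less_trans) simp
  then have "?I < \<infinity>" by (auto simp: ennreal_mult_less_top)
  then show i: "integrable lborel (\<lambda>x. U x * ft x)"
    by (intro integrableI_bounded) (auto simp: U_nonneg ft_nonneg abs_mult)
  have "?I = ennreal ?J"
    by (intro nn_integral_eq_integral i) (auto simp: U_nonneg ft_nonneg)
  moreover have "?J \<ge> 0"
    by (intro integral_nonneg_AE) (auto simp: U_nonneg ft_nonneg)
  ultimately have "ennreal (2 * ?J) \<le> ennreal (Dt + D)"
    using le by (simp add: ennreal_mult)
  then show "?J \<le> (Dt + D) / 2"
    using Dt_nonneg D_nonneg by (subst (asm) ennreal_le_iff) auto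
qed

text \<open>Young's inequality gives the pointwise bound U ((1 - 1/p) f + ft/p). After integration,
  \<open>riesz_pairing_ft\<close> turns this into D + (Dt - D) / (2 p), and D is exactly the pairing
  of \<open>N\<close> with \<open>g\<close>.\<close>

lemma variation_le: "Re (LINT x|lborel. N x * cnj (u x - g x)) \<le> (Dt - D) / (2 * pex)"
proof -
  have p: "pex > 1" using pex_bounds by simp
  let ?B = "\<lambda>x. (1 - 1 / pex) * (U x * f x) + (1 / pex) * (U x * ft x)"
  let ?V = "(LINT x|lborel. N x * cnj (u x))"
  have Ni: "integrable lborel (\<lambda>x. N x * cnj (u x))" "integrable lborel (\<lambda>x. N x * cnj (g x))"
    by (intro L2_mult_integrable L2_cnj N_L2 u_L2 g_L2)+
  have "Re ?V = (LINT x|lborel. Re (N x * cnj (u x)))"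
    by (rule integral_Re[OF Ni(1), symmetric])
  also have "\<dots> \<le> (LINT x|lborel. (?B x))"
  proof (rule integral_mono_AE)
    show "integrable lborel (\<lambda>x. Re (N x * cnj (u x)))" by (rule integrable_Re[OF Ni(1)])
    show "integrable lborel (\<lambda>x. (?B x))"
      using Uf_integrable riesz_pairing_ft(1) by auto
    show "AE x in lborel. Re (N x * cnj (u x)) \<le> (?B x)"
      using N_eq
    proof eventually_elim
      case (elim x)
      \<comment> \<open>The exponent conjugate to p; since (p - 1) q = p, the first factor returns
        to f.\<close>
      define q where "q = pex / (pex - 1)"
      have q: "q > 1" "1 / q + 1 / pex = 1" using p by (auto simp: q_def field_simps)
      have "Re (N x * cnj (u x)) \<le> norm (N x * cnj (u x))" by (rule complex_Re_le_cmod)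
      also have "\<dots> = U x * (norm (g x) powr (pex - 1) * norm (u x))"
      proof -
        have "norm (g x) powr (pex - 2) * norm (g x) = norm (g x) powr (pex - 1)"
          by (cases "g x = 0") (simp_all add: powr_diff powr_numeral power2_eq_square)
        moreover have "norm (N x) = U x * (norm (g x) powr (pex - 2) * norm (g x))"
          unfolding elim norm_mult norm_of_real using U_nonneg[of x] by (simp add: abs_mult)
        ultimately show ?thesis by (simp add: norm_mult)
      qed
      also have "norm (g x) powr (pex - 1) * norm (u x) \<le> (norm (g x) powr (pex - 1)) powr q / q + norm (u x) powr pex / pex"
        by (rule Youngs_inequality) (use p q in auto)
      also have "(norm (g x) powr (pex - 1)) powr q = f x"
        using p by (simp add: powr_powr q_def f_def)
      also have "f x / q + norm (u x) powr pex / pex = (1 - 1 / pex) * f x + (1 / pex) * ft x"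
        using p by (simp add: q_def ft_def field_simps)
      finally have "Re (N x * cnj (u x)) \<le> U x * ((1 - 1 / pex) * f x + (1 / pex) * ft x)"
        using U_nonneg[of x] by (simp add: mult_left_mono)
      then show ?case by (simp add: distrib_left mult_ac)
    qed
  qed
  also have "\<dots> = (1 - 1 / pex) * D + (1 / pex) * (LINT x|lborel. U x * ft x)"
    unfolding D_eq using Uf_integrable riesz_pairing_ft(1) by simp
  also have "\<dots> \<le> (1 - 1 / pex) * D + (1 / pex) * ((Dt + D) / 2)"
    using riesz_pairing_ft(2) p by (intro add_left_mono mult_left_mono) auto
  also have "\<dots> = D + (Dt - D) / (2 * pex)" using p by (simp add: field_simps)
  finally have "Re ?V \<le> D + (Dt - D) / (2 * pex)" .
  moreover have "(LINT x|lborel. N x * cnj (u x - g x)) = ?V - (LINT x|lborel. N x * cnj (g x))"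
    using Ni by (simp add: right_diff_distrib)
  moreover have "Re (LINT x|lborel. N x * cnj (g x)) = D"
    unfolding D_def by (rule integral_Re[OF Ni(2), symmetric])
  ultimately show ?thesis by simp
qed

text \<open>With y = unflow x, the point moves by s = t \<xi>(y_j), at most t R. The Taylor
  remainder is bounded by \<open>osc\<close>; passing from y_j to x_j in \<xi> and \<xi>', and the
  product of amplitude and displacement, cost only t^2.\<close>

lemma u_expansion:
  "AE x in lborel. ennreal (norm (u x - g x - t *\<^sub>R \<Lambda> R j x)) \<le>
     2 * osc (v j) j (t * R) x + ennreal (t\<^sup>2 * (2 * R * norm (v j x) + norm (g x)))"
proof -
  let ?E = "\<lambda>x. (t\<^sup>2 * (2 * R * norm (v j x) + norm (g x)))"
  have tR: "t * R > 0" using t R by simp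
  show ?thesis using g_difference_osc[OF tR, of j]
  proof eventually_elim
    case (elim x)
    define y where "y = unflow x"
    define s where "s = t * (R * sin (y $ j / R))"
    have xy: "y = x + s *\<^sub>R axis j 1"
    proof -
      have "x = flow y" by (simp add: y_def flow_unflow)
      then show ?thesis by (simp add: flow_def s_def)
    qed
    have yx: "y $ j - x $ j = s" unfolding xy by simp
    have s_le: "\<bar>s\<bar> \<le> t * R"
      unfolding s_def using t R by (auto simp: abs_mult intro!: mult_left_mono mult_left_le)
    define q where "q = g y - g x - s *\<^sub>R v j x"
    have q: "ennreal (norm q) \<le> osc (v j) j (t * R) x"
      using elim s_le unfolding q_def xy by blast
    let ?C = "\<lambda>z. cos (z $ j / R)"
    have 1: "\<bar>s - t * (R * sin (x $ j / R))\<bar> \<le> t * (t * R)"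
    proof -
      have "s - t * (R * sin (x $ j / R)) = t * (R * sin (y $ j / R) - R * sin (x $ j / R))"
        by (simp add: s_def algebra_simps)
      then have "\<bar>s - t * (R * sin (x $ j / R))\<bar> = t * \<bar>R * sin (y $ j / R) - R * sin (x $ j / R)\<bar>"
        using t by (simp add: abs_mult)
      also have "\<dots> \<le> t * \<bar>y $ j - x $ j\<bar>"
        using sin_scaled_Lipschitz t by (intro mult_left_mono) auto
      also have "\<dots> \<le> t * (t * R)" unfolding yx using s_le t by (intro mult_left_mono) auto
      finally show ?thesis .
    qed
    have 2: "\<bar>?C y - ?C x\<bar> \<le> t"
    proof -
      have "\<bar>cos a - cos b\<bar> \<le> \<bar>a - b\<bar>" for a b :: real
      proof -
        have "\<bar>cos a - cos b\<bar> = 2 * (\<bar>sin ((a + b) / 2)\<bar> * \<bar>sin ((b - a) / 2)\<bar>)"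
          by (simp add: cos_diff_cos abs_mult)
        also have "\<dots> \<le> 2 * (1 * \<bar>(b - a) / 2\<bar>)"
          by (intro mult_left_mono mult_mono abs_sin_x_le_abs_x) auto
        finally show ?thesis by simp
      qed
      from this[of "y $ j / R" "x $ j / R"] have "\<bar>?C y - ?C x\<bar> \<le> \<bar>s\<bar> / R"
        using R yx by (simp add: diff_divide_distrib[symmetric])
      also have "\<dots> \<le> t" using s_le R by (simp add: pos_divide_le_eq)
      finally show ?thesis .
    qed
    \<comment> \<open>Exact algebra: the Taylor remainder q, the change of the displacement, the
      change of the cosine, and the second-order cross term.\<close>
    have "u x - g x - t *\<^sub>R \<Lambda> R j x =
       of_real (1 + t / 2 * ?C y) * q + of_real (s - t * (R * sin (x $ j / R))) * v j x
       + of_real (t / 2 * (?C y - ?C x)) * g x + of_real (t / 2 * ?C y * s) * v j x"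
    proof -
      have e: "(1 + \<tau> / 2 * c) * gy - gx - \<tau> * (\<xi> * vx + d / 2 * gx) =
        (1 + \<tau> / 2 * c) * (gy - gx - \<sigma> * vx) + (\<sigma> - \<tau> * \<xi>) * vx + \<tau> / 2 * (c - d) * gx + \<tau> / 2 * c * \<sigma> * vx"
        for \<tau> c d gy gx \<xi> vx \<sigma> :: complex
        by (simp add: field_simps)
      show ?thesis
        unfolding u_def y_def[symmetric] \<Lambda>_def q_def scaleR_conv_of_real
        using e[of "of_real t" "of_real (?C y)" "g y" "g x" "of_real (R * sin (x $ j / R))" "v j x" "of_real (?C x)" "of_real s"]
        by simp
    qed
    also have "norm \<dots> \<le> norm (of_real (1 + t / 2 * ?C y) * q) + norm (of_real (s - t * (R * sin (x $ j / R))) * v j x)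
       + norm (of_real (t / 2 * (?C y - ?C x)) * g x) + norm (of_real (t / 2 * ?C y * s) * v j x)"
      by (intro norm_triangle_le add_mono order.refl)
    also have "\<dots> \<le> 2 * norm q + t * (t * R) * norm (v j x) + t / 2 * t * norm (g x) + t / 2 * 1 * (t * R) * norm (v j x)"
      unfolding norm_mult norm_of_real abs_mult
      using cos_factor[of "y $ j / R"] 1 2 s_le t
      by (intro add_mono mult_right_mono mult_mono) (auto simp: abs_mult)
    also have "\<dots> \<le> 2 * norm q + t\<^sup>2 * (2 * R * norm (v j x) + norm (g x))"
    proof -
      have "0 \<le> t\<^sup>2 * R * norm (v j x)" "0 \<le> t\<^sup>2 * norm (g x)" using R by auto
      then show ?thesis by (simp add: power2_eq_square algebra_simps)
    qed
    finally have "ennreal (norm (u x - g x - t *\<^sub>R \<Lambda> R j x)) \<le> ennreal (2 * norm q + t\<^sup>2 * (2 * R * norm (v j x) + norm (g x)))"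
      by (rule ennreal_leI)
    also have "\<dots> = 2 * ennreal (norm q) + ennreal (?E x)"
      using R by (subst ennreal_plus) (auto simp: ennreal_mult)
    also have "\<dots> \<le> 2 * osc (v j) j (t * R) x + ennreal (?E x)"
      using q by (intro add_right_mono mult_left_mono) auto
    finally show ?case .
  qed
qed

end

context choquard
begin

definition err :: "real \<Rightarrow> 3 \<Rightarrow> real" where
  "err R j = (LINT x|lborel. norm (N x) * (2 * R * norm (v j x) + norm (g x)))"

lemma err_integrable: "integrable lborel (\<lambda>x. norm (N x) * (2 * R * norm (v j x) + norm (g x)))"
proof -
  have "integrable lborel (\<lambda>x. 2 * R * (norm (N x) * norm (v j x)) + norm (N x) * norm (g x))"
    by (intro Bochner_Integration.integrable_add integrable_mult_right L2_norm_mult_integrable N_L2 v_L2 g_L2)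
  then show ?thesis by (simp add: algebra_simps)
qed

end

context choquard_shear
begin

text \<open>\<open>variation_le\<close> divided by t, after u - g has been replaced by t times the
  generator. The replacement costs \<open>2 * e * R\<close> from the oscillation and
  \<open>t * err R j\<close> from the quadratic terms; the former is made small through the choice
  of e.\<close>

lemma virial_le:
  assumes small: "(\<integral>\<^sup>+x. ennreal (norm (N x)) * osc (v j) j (t * R) x \<partial>lborel) \<le> ennreal (e * (t * R))" and e: "e > 0"
  shows "Re (LINT x|lborel. N x * cnj (\<Lambda> R j x)) \<le>
    2 * e * R + t * err R j + (LINT p|(lborel \<Otimes>\<^sub>M lborel). (K p - 1) / t * H p) / (2 * pex)"
proof -
  let ?r = "\<lambda>x. u x - g x - t *\<^sub>R \<Lambda> R j x"
  let ?e = "\<lambda>x. (norm (N x) * (2 * R * norm (v j x) + norm (g x)))"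
  let ?Q = "(LINT p|(lborel \<Otimes>\<^sub>M lborel). (K p - 1) / t * H p)"
  let ?O = "(\<integral>\<^sup>+x. ennreal (norm (N x)) * osc (v j) j (t * R) x \<partial>lborel)"
  have p: "pex > 0" using pex_bounds by simp
  have rL2: "?r \<in> L2"
    unfolding scaleR_conv_of_real by (intro L2_diff L2_cmult u_L2 g_L2 \<Lambda>_L2)
  have i: "integrable lborel (\<lambda>x. N x * cnj (u x - g x))" "integrable lborel (\<lambda>x. N x * cnj (\<Lambda> R j x))"
    "integrable lborel (\<lambda>x. N x * cnj (?r x))"
    by (intro L2_mult_integrable L2_cnj L2_diff N_L2 u_L2 g_L2 \<Lambda>_L2 rL2)+
  have err0: "err R j \<ge> 0" unfolding err_def using R by (intro integral_nonneg_AE) auto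
  have [measurable]: "?r \<in> borel_measurable borel" using rL2 by (rule L2_measurable)
  have "ennreal (norm (LINT x|lborel. N x * cnj (?r x))) \<le> (\<integral>\<^sup>+x. ennreal (norm (N x * cnj (?r x))) \<partial>lborel)"
    by (rule integral_norm_bound_ennreal[OF i(3)])
  also have "\<dots> \<le> (\<integral>\<^sup>+x. 2 * (ennreal (norm (N x)) * osc (v j) j (t * R) x)
      + ennreal (t\<^sup>2 * (?e x)) \<partial>lborel)"
  proof (rule nn_integral_mono_AE)
    show "AE x in lborel. ennreal (norm (N x * cnj (?r x))) \<le> 2 * (ennreal (norm (N x)) * osc (v j) j (t * R) x)
      + ennreal (t\<^sup>2 * (?e x))"
      using u_expansion
    proof eventually_elim
      case (elim x)
      have "ennreal (norm (N x * cnj (?r x))) = ennreal (norm (N x)) * ennreal (norm (?r x))"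
        by (simp only: norm_mult complex_mod_cnj ennreal_mult norm_ge_zero)
      also have "\<dots> \<le> ennreal (norm (N x)) * (2 * osc (v j) j (t * R) x + ennreal (t\<^sup>2 * (2 * R * norm (v j x) + norm (g x))))"
        by (intro mult_left_mono elim) simp
      also have "\<dots> = 2 * (ennreal (norm (N x)) * osc (v j) j (t * R) x)
         + ennreal (norm (N x)) * ennreal (t\<^sup>2 * (2 * R * norm (v j x) + norm (g x)))"
        by (simp only: distrib_left mult.left_commute)
      also have "ennreal (norm (N x)) * ennreal (t\<^sup>2 * (2 * R * norm (v j x) + norm (g x))) =
         ennreal (t\<^sup>2 * (?e x))"
        using R by (subst ennreal_mult[symmetric]) (auto simp: mult_ac)
      finally show ?case .
    qed
  qed
  also have "\<dots> = 2 * ?O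
      + (\<integral>\<^sup>+x. ennreal (t\<^sup>2 * (?e x)) \<partial>lborel)"
    by (subst nn_integral_add) (auto simp: nn_integral_cmult)
  also have "(\<integral>\<^sup>+x. ennreal (t\<^sup>2 * (?e x)) \<partial>lborel) = ennreal (t\<^sup>2 * err R j)"
    unfolding err_def using err_integrable R
    by (subst nn_integral_eq_integral) auto
  also have "2 * ?O + ennreal (t\<^sup>2 * err R j)
      \<le> 2 * ennreal (e * (t * R)) + ennreal (t\<^sup>2 * err R j)"
    by (intro add_right_mono mult_left_mono small) auto
  also have "\<dots> = ennreal (2 * (e * (t * R)) + t\<^sup>2 * err R j)"
    using e t R err0 by (simp add: ennreal_mult)
  finally have "norm (LINT x|lborel. N x * cnj (?r x)) \<le> 2 * (e * (t * R)) + t\<^sup>2 * err R j"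
    using e t R err0 by (subst (asm) ennreal_le_iff) auto
  moreover have "(LINT x|lborel. N x * cnj (?r x)) =
     (LINT x|lborel. N x * cnj (u x - g x)) - of_real t * (LINT x|lborel. N x * cnj (\<Lambda> R j x))"
  proof -
    have "(LINT x|lborel. N x * cnj (?r x)) = (LINT x|lborel. N x * cnj (u x - g x) - of_real t * (N x * cnj (\<Lambda> R j x)))"
      by (intro Bochner_Integration.integral_cong) (auto simp: scaleR_conv_of_real algebra_simps)
    also have "\<dots> = (LINT x|lborel. N x * cnj (u x - g x)) - (LINT x|lborel. of_real t * (N x * cnj (\<Lambda> R j x)))"
      by (intro Bochner_Integration.integral_diff i integrable_mult_right)
    finally show ?thesis by simp
  qed
  ultimately have "norm ((LINT x|lborel. N x * cnj (u x - g x)) - of_real t * (LINT x|lborel. N x * cnj (\<Lambda> R j x)))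
     \<le> 2 * (e * (t * R)) + t\<^sup>2 * err R j" by simp
  then have "\<bar>Re ((LINT x|lborel. N x * cnj (u x - g x)) - of_real t * (LINT x|lborel. N x * cnj (\<Lambda> R j x)))\<bar>
     \<le> 2 * (e * (t * R)) + t\<^sup>2 * err R j" using abs_Re_le_cmod order.trans by blast
  then have "t * Re (LINT x|lborel. N x * cnj (\<Lambda> R j x)) \<le> Re (LINT x|lborel. N x * cnj (u x - g x)) + (2 * (e * (t * R)) + t\<^sup>2 * err R j)"
    by (simp add: abs_le_iff)
  also have "\<dots> \<le> (Dt - D) / (2 * pex) + (2 * (e * (t * R)) + t\<^sup>2 * err R j)"
    by (intro add_right_mono variation_le)
  also have "Dt - D = t * ?Q"
    unfolding Dt_diff using t by (subst integral_mult_right_zero[symmetric]) simp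
  also have "t * ?Q / (2 * pex) + (2 * (e * (t * R)) + t\<^sup>2 * err R j)
     = t * (2 * e * R + t * err R j + ?Q / (2 * pex))"
    by (simp add: algebra_simps power2_eq_square)
  finally show ?thesis using t by simp
qed

text \<open>The bound is uniform in t and serves as the dominating function when t tends to
  0.\<close>

lemma K_quotient_bound: "\<bar>(K p - 1) / t * H p\<bar> \<le> 1022 * H p"
proof -
  have "\<bar>(K p - 1) / t * H p\<bar> = \<bar>(K p - 1) * H p\<bar> / t" using t by (simp add: abs_mult)
  also have "\<dots> \<le> 1022 * t * H p / t" using KH_bound[of p] t by (intro divide_right_mono) auto
  finally show ?thesis using t by simp
qed

end

section \<open>The limits t to 0 and then R to infinity\<close>

context choquard
begin

text \<open>The derivative of \<open>K\<close> in t at 0, as computed in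
  \<open>kfac_tendsto\<close>.\<close>

definition Kd :: "real \<Rightarrow> 3 \<Rightarrow> (real^3) \<times> (real^3) \<Rightarrow> real" where
  "Kd R j = (\<lambda>(x, y). (pex / 2 - 1) * (cos (x $ j / R) + cos (y $ j / R)) + (3 - \<beta>) * cross_ratio R j x y)"

lemma Kd_measurable [measurable]: "Kd R j \<in> borel_measurable (lborel \<Otimes>\<^sub>M lborel)"
  unfolding Kd_def cross_ratio_def by measurable

lemma virial_le_limit:
  assumes R: "R > 0"
  shows "Re (LINT x|lborel. N x * cnj (\<Lambda> R j x)) \<le> (LINT p|(lborel \<Otimes>\<^sub>M lborel). Kd R j p * H p) / (2 * pex)"
proof (rule field_le_epsilon)
  fix e0 :: real assume e0: "e0 > 0"
  \<comment> \<open>Chosen so that the error \<open>2 * e * R\<close> of \<open>virial_le\<close> is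
    exactly e0; R is fixed here.\<close>
  define e where "e = e0 / (2 * R)"
  have e: "e > 0" using e0 R by (simp add: e_def)
  let ?J = "(LINT p|(lborel \<Otimes>\<^sub>M lborel). Kd R j p * H p)"
  let ?V = "Re (LINT x|lborel. N x * cnj (\<Lambda> R j x))"
  \<comment> \<open>The offset 3 keeps every parameter below 1/2, as \<open>choquard_shear\<close>
    demands.\<close>
  define s where "s n = 1 / (real n + 3)" for n :: nat
  have s: "0 < s n" "s n < 1" "s n \<le> 1/2" for n by (auto simp: s_def divide_simps)
  have s0: "s \<longlonglongrightarrow> 0" unfolding s_def by real_asymp
  define Q where "Q n = (\<lambda>(x, y). (kfac (s n) (cos (x $ j / R)) (cos (y $ j / R)) (cross_ratio R j x y) (square_ratio R j x y) - 1) / s n)"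
    for n and x y :: "real^3"
  have sh: "choquard_shear \<beta> g v w \<omega> (s n) R" for n
    using s R by unfold_locales auto
  have Q: "Q n p = (choquard_shear.K \<beta> (s n) R j p - 1) / s n" for n p
    by (cases p) (simp add: Q_def choquard_shear.K_def[OF sh])
  have lim: "(\<lambda>n. LINT p|(lborel \<Otimes>\<^sub>M lborel). Q n p * H p) \<longlonglongrightarrow> ?J"
  proof (rule integral_dominated_convergence[where w="\<lambda>p. 1022 * H p"])
    show "integrable (lborel \<Otimes>\<^sub>M lborel) (\<lambda>p. 1022 * H p)" using H_integrable by simp
    show "(\<lambda>p. Kd R j p * H p) \<in> borel_measurable (lborel \<Otimes>\<^sub>M lborel)" by measurable
    show "(\<lambda>p. Q n p * H p) \<in> borel_measurable (lborel \<Otimes>\<^sub>M lborel)" for n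
      unfolding Q using choquard_shear.K_measurable[OF sh] by measurable
    show "AE p in lborel \<Otimes>\<^sub>M lborel. norm (Q n p * H p) \<le> 1022 * H p" for n
      unfolding Q real_norm_def by (intro AE_I2 choquard_shear.K_quotient_bound[OF sh])
    have "filterlim s (at_right 0) sequentially"
      using s0 s(1) by (intro filterlim_at_withinI) (auto simp: less_imp_neq[symmetric])
    then have "(\<lambda>n. Q n p) \<longlonglongrightarrow> Kd R j p" for p
      unfolding Q_def Kd_def by (cases p) (auto intro: filterlim_compose[OF kfac_tendsto])
    then show "AE p in lborel \<Otimes>\<^sub>M lborel. (\<lambda>n. Q n p * H p) \<longlonglongrightarrow> Kd R j p * H p"
      by (intro AE_I2 tendsto_mult tendsto_const) auto
  qed
  obtain d where d: "d > 0" "\<And>M. 0 < M \<Longrightarrow> M < d \<Longrightarrow>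
     (\<integral>\<^sup>+x. ennreal (norm (N x)) * osc (v j) j M x \<partial>lborel) \<le> ennreal (e * M)"
    using osc_pairing_small[OF v_L2 N_L2 e, of j j] by blast
  have "(\<lambda>n. s n * R) \<longlonglongrightarrow> 0 * R" by (intro tendsto_intros s0)
  then have ev: "eventually (\<lambda>n. s n * R < d) sequentially" using d(1) by (intro order_tendstoD(2)) auto
  have "(\<lambda>n. 2 * e * R + s n * err R j + (LINT p|(lborel \<Otimes>\<^sub>M lborel). Q n p * H p) / (2 * pex)) \<longlonglongrightarrow>
     2 * e * R + 0 * err R j + ?J / (2 * pex)"
    using pex_bounds by (intro tendsto_intros s0 lim) auto
  then have "?V \<le>
     2 * e * R + 0 * err R j + ?J / (2 * pex)"
  proof (rule tendsto_lowerbound)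
    show "eventually (\<lambda>n. ?V \<le>
       2 * e * R + s n * err R j + (LINT p|(lborel \<Otimes>\<^sub>M lborel). Q n p * H p) / (2 * pex)) sequentially"
      using ev
    proof eventually_elim
      case (elim n)
      show ?case unfolding Q
        by (rule choquard_shear.virial_le[OF sh _ e]) (use elim s R in \<open>auto intro!: d(2)\<close>)
    qed
  qed simp
  also have "2 * e * R = e0" using R by (simp add: e_def)
  finally show "?V \<le> ?J / (2 * pex) + e0"
    by simp
qed

lemma cross_ratio_bound:
  assumes "R > 0"
  shows "\<bar>cross_ratio R j x y\<bar> \<le> 1"
proof (cases "x = y")
  case False
  \<comment> \<open>Any parameter strictly between 0 and 1 would serve: only the Lipschitz bound for
    the scaled sine is borrowed.\<close>
  interpret shear "1/2" R j using assms by unfold_locales auto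
  have "\<bar>(R * sin (x $ j / R) - R * sin (y $ j / R)) * (x $ j - y $ j)\<bar> \<le> norm (x - y) * norm (x - y)"
    unfolding abs_mult[of "_ - _"]
    using sin_scaled_Lipschitz[of "x $ j" "y $ j"] component_le_norm_cart[of "x - y" j]
    by (intro mult_mono) auto
  then show ?thesis using False by (simp add: cross_ratio_def power2_eq_square)
qed (simp add: cross_ratio_def)

lemma sin_scaled_tendsto: "(\<lambda>n. (real n + 1) * sin (a / (real n + 1))) \<longlonglongrightarrow> a"
  by real_asymp

lemma cos_scaled_tendsto: "(\<lambda>n. cos (a / (real n + 1))) \<longlonglongrightarrow> 1"
  by real_asymp

text \<open>The shears turn into a dilation: the cosines tend to 1 and the cross ratios sum to 1.
  The limit is 3 p - 3 - \<beta>, which is 0 for the critical exponent.\<close>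

lemma Kd_sum_tendsto:
  assumes "fst p \<noteq> snd p"
  shows "(\<lambda>n. \<Sum>j\<in>UNIV. Kd (real n + 1) j p) \<longlonglongrightarrow> 0"
proof -
  obtain x y where p: "p = (x, y)" by (cases p)
  have xy: "norm (x - y) \<noteq> 0" using assms by (simp add: p)
  have "(\<lambda>n. \<Sum>j\<in>UNIV. Kd (real n + 1) j p) \<longlonglongrightarrow>
     (\<Sum>j\<in>UNIV. (pex / 2 - 1) * (1 + 1) + (3 - \<beta>) * ((x $ j - y $ j) * (x $ j - y $ j) / (norm (x - y))\<^sup>2))"
    unfolding p Kd_def cross_ratio_def prod.case
    by (intro tendsto_intros sin_scaled_tendsto cos_scaled_tendsto) (use xy in auto)
  also have "(\<Sum>j\<in>UNIV. (pex / 2 - 1) * (1 + 1) + (3 - \<beta>) * ((x $ j - y $ j) * (x $ j - y $ j) / (norm (x - y))\<^sup>2)) =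
     3 * ((pex / 2 - 1) * (1 + 1)) + (3 - \<beta>) * ((\<Sum>j\<in>UNIV. (x $ j - y $ j) * (x $ j - y $ j)) / (norm (x - y))\<^sup>2)"
    by (simp add: sum.distrib sum_distrib_left sum_divide_distrib)
  also have "(\<Sum>j\<in>UNIV. (x $ j - y $ j) * (x $ j - y $ j)) = (norm (x - y))\<^sup>2"
    by (simp add: power2_norm_eq_inner inner_vec_def)
  also have "3 * ((pex / 2 - 1) * (1 + 1)) + (3 - \<beta>) * ((norm (x - y))\<^sup>2 / (norm (x - y))\<^sup>2) = 0"
    using xy by (simp add: pex_def field_simps)
  finally show ?thesis .
qed

lemma Kd_bound: "R > 0 \<Longrightarrow> \<bar>Kd R j p\<bar> \<le> 5"
proof -
  assume R: "R > 0"
  obtain x y where p: "p = (x, y)" by (cases p)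
  have "\<bar>Kd R j p\<bar> \<le> \<bar>pex / 2 - 1\<bar> * \<bar>cos (x $ j / R) + cos (y $ j / R)\<bar> + \<bar>3 - \<beta>\<bar> * \<bar>cross_ratio R j x y\<bar>"
    unfolding p Kd_def prod.case abs_mult[symmetric] by (rule abs_triangle_ineq)
  also have "\<dots> \<le> 1 * 2 + 3 * 1"
  proof (intro add_mono mult_mono)
    show "\<bar>cos (x $ j / R) + cos (y $ j / R)\<bar> \<le> 2"
      using abs_cos_le_one[of "x $ j / R"] abs_cos_le_one[of "y $ j / R"] by linarith
  qed (use pex_bounds beta cross_ratio_bound[OF R] in auto)
  finally show ?thesis by simp
qed

text \<open>Only the sum of the three \<open>Kd\<close> vanishes in the limit, so the inequalities
  for the single directions are added first. On the left the weights tend to 1 and the sine term is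
  O(1/R), leaving the full Dirichlet integral.\<close>

lemma gradient_zero: "AE x in lborel. v j x = 0"
proof -
  let ?R = "\<lambda>n::nat. real n + 1"
  let ?S = "\<lambda>n j. (LINT x|lborel. of_real (sin (x $ j / ?R n)) * (v j x * cnj (g x)))"
  let ?P = "lborel \<Otimes>\<^sub>M lborel :: ((real^3) \<times> (real^3)) measure"
  have vi: "integrable lborel (\<lambda>x. (norm (v j x))\<^sup>2)" for j using v_L2 by (simp add: L2_iff)
  have KH: "integrable ?P (\<lambda>p. Kd (?R n) j p * H p)" for n j
    by (rule Bochner_Integration.integrable_bound[OF integrable_mult_right[OF H_integrable, of 5]])
       (auto simp: abs_mult H_nonneg intro!: mult_right_mono Kd_bound)
  define L where "L n = (\<Sum>j\<in>UNIV. (LINT x|lborel. cos (x $ j / ?R n) * (norm (v j x))\<^sup>2)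
    - Re (?S n j) / (2 * ?R n))" for n
  have le: "L n \<le> (LINT p|?P. (\<Sum>j\<in>UNIV. Kd (?R n) j p) * H p) / (2 * pex)" for n
  proof -
    have "L n \<le> (\<Sum>j\<in>UNIV. (LINT p|?P. Kd (?R n) j p * H p) / (2 * pex))"
      unfolding L_def
      by (intro sum_mono) (subst virial_identity[symmetric], use virial_le_limit in auto)
    also have "\<dots> = (\<Sum>j\<in>UNIV. LINT p|?P. Kd (?R n) j p * H p) / (2 * pex)" by (simp add: sum_divide_distrib)
    also have "(\<Sum>j\<in>UNIV. LINT p|?P. Kd (?R n) j p * H p) = (LINT p|?P. (\<Sum>j\<in>UNIV. Kd (?R n) j p * H p))"
      using KH by (intro Bochner_Integration.integral_sum[symmetric])
    finally show ?thesis by (simp add: sum_distrib_right)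
  qed
  have rhs: "(\<lambda>n. LINT p|?P. (\<Sum>j\<in>UNIV. Kd (?R n) j p) * H p) \<longlonglongrightarrow> (LINT p|?P. 0)"
  proof (rule integral_dominated_convergence[where w="\<lambda>p. 15 * H p"])
    show "integrable ?P (\<lambda>p. 15 * H p)" using H_integrable by simp
    show "(\<lambda>p. (\<Sum>j\<in>UNIV. Kd (?R n) j p) * H p) \<in> borel_measurable ?P" for n by measurable
    show "AE p in ?P. (\<lambda>n. (\<Sum>j\<in>UNIV. Kd (?R n) j p) * H p) \<longlonglongrightarrow> 0"
    proof (rule AE_I2)
      fix p show "(\<lambda>n. (\<Sum>j\<in>UNIV. Kd (?R n) j p) * H p) \<longlonglongrightarrow> 0"
      proof (cases "fst p = snd p")
        case True
        obtain x where "p = (x, x)" using True by (cases p) auto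
        then show ?thesis by (simp add: H_def ker_eq)
      next
        case False
        from tendsto_mult_right[OF Kd_sum_tendsto[OF False], of "H p"] show ?thesis by simp
      qed
    qed
    show "AE p in ?P. norm ((\<Sum>j\<in>UNIV. Kd (?R n) j p) * H p) \<le> 15 * H p" for n
    proof (rule AE_I2)
      fix p
      have "\<bar>\<Sum>j\<in>UNIV. Kd (?R n) j p\<bar> \<le> (\<Sum>j\<in>(UNIV::3 set). 5)"
        by (rule order.trans[OF sum_abs]) (intro sum_mono Kd_bound, simp)
      then show "norm ((\<Sum>j\<in>UNIV. Kd (?R n) j p) * H p) \<le> 15 * H p"
        using H_nonneg[of p] by (simp add: abs_mult mult_right_mono)
    qed
  qed simp
  have lhs: "L \<longlonglongrightarrow> (\<Sum>j\<in>UNIV. (LINT x|lborel. (norm (v j x))\<^sup>2) - 0)"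
    unfolding L_def
  proof (intro tendsto_sum tendsto_diff)
    fix j
    show "(\<lambda>n. LINT x|lborel. cos (x $ j / ?R n) * (norm (v j x))\<^sup>2) \<longlonglongrightarrow> (LINT x|lborel. (norm (v j x))\<^sup>2)"
    proof (rule integral_dominated_convergence[OF _ _ vi[of j]])
      show "AE x in lborel. (\<lambda>n. cos (x $ j / ?R n) * (norm (v j x))\<^sup>2) \<longlonglongrightarrow> (norm (v j x))\<^sup>2"
        using tendsto_mult_right[OF cos_scaled_tendsto] by (intro AE_I2) force
      show "AE x in lborel. norm (cos (x $ j / ?R n) * (norm (v j x))\<^sup>2) \<le> (norm (v j x))\<^sup>2" for n
        by (intro AE_I2) (auto simp: abs_mult intro!: mult_left_le_one_le)
    qed measurable
    define B where "B = (LINT x|lborel. norm (v j x) * norm (g x))"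
    have b: "\<bar>Re (?S n j)\<bar> \<le> B" for n
    proof -
      have "\<bar>Re (?S n j)\<bar>
         \<le> norm (?S n j)" by (rule abs_Re_le_cmod)
      also have "\<dots> \<le> B" unfolding B_def
        by (rule Bochner_Integration.integral_norm_bound_integral)
           (auto simp: norm_mult intro!: mult_left_le_one_le L2_norm_mult_integrable v_L2 g_L2 
              L2_mult_integrable[OF weighted_L2(1)[OF v_L2, of 1, simplified] L2_cnj[OF g_L2], unfolded mult.assoc])
      finally show ?thesis .
    qed
    have "(\<lambda>n. B / (2 * ?R n)) \<longlonglongrightarrow> 0" by real_asymp
    then show "(\<lambda>n. Re (?S n j) / (2 * ?R n)) \<longlonglongrightarrow> 0"
    proof (rule Lim_null_comparison[rotated])
      show "eventually (\<lambda>n. norm (Re (?S n j) / (2 * ?R n)) \<le> B / (2 * ?R n)) sequentially"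
        using b by (intro always_eventually allI) (simp add: divide_right_mono)
    qed
  qed
  have "(\<lambda>n. (LINT p|?P. (\<Sum>j\<in>UNIV. Kd (?R n) j p) * H p) / (2 * pex)) \<longlonglongrightarrow> 0 / (2 * pex)"
    using rhs pex_bounds by (intro tendsto_intros) auto
  with lhs have "(\<Sum>j\<in>UNIV. (LINT x|lborel. (norm (v j x))\<^sup>2) - 0) \<le> 0 / (2 * pex)"
    by (rule LIMSEQ_le) (use le in auto)
  then have "(\<Sum>j\<in>UNIV. LINT x|lborel. (norm (v j x))\<^sup>2) \<le> 0" by simp
  moreover have nn: "(LINT x|lborel. (norm (v j x))\<^sup>2) \<ge> 0" for j by simp
  ultimately have "(\<Sum>j\<in>UNIV. LINT x|lborel. (norm (v j x))\<^sup>2) = 0"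
    using sum_nonneg[of UNIV "\<lambda>j. LINT x|lborel. (norm (v j x))\<^sup>2"] by (intro order.antisym) auto
  then have "(LINT x|lborel. (norm (v j x))\<^sup>2) = 0"
    using sum_nonneg_eq_0_iff[of UNIV "\<lambda>j. LINT x|lborel. (norm (v j x))\<^sup>2"] nn by simp
  then have "AE x in lborel. (norm (v j x))\<^sup>2 = 0"
    using integral_nonneg_eq_0_iff_AE[OF vi[of j]] by simp
  then show ?thesis by eventually_elim simp
qed

text \<open>A vanishing weak derivative makes \<open>g\<close> invariant along each axis, first
  almost everywhere by \<open>wderiv_line\<close> and then everywhere by continuity. Three moves
  along the axes lead from 0 to any point.\<close>

lemma g_constant: "g x = g 0"
proof -
  have inv: "g (x + s *\<^sub>R axis j 1) = g x" for x s j
  proof -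
    have w0: "wderiv j g (\<lambda>_. 0)"
      unfolding wderiv_def
    proof
      fix h assume h: "h \<in> test_factors"
      have [measurable]: "tensor h \<in> borel_measurable borel" using h by (rule tensor_measurable)
      have "(LINT x|lborel. v j x * of_real (tensor h x)) = (LINT x|lborel. 0 * of_real (tensor h x))"
        by (rule integral_cong_AE) (use gradient_zero[of j] in \<open>auto elim: eventually_mono\<close>)
      then show "(LINT x|lborel. g x * of_real (tensor (dfactor j h) x)) = - (LINT x|lborel. 0 * of_real (tensor h x))"
        using g_v[of j] h by (simp add: wderiv_def)
    qed
    have z: "(\<lambda>_. 0) \<in> L2" by (simp add: L2_iff)
    have *: "g (x + s *\<^sub>R axis j 1) = g x" if "s \<ge> 0" for x s
    proof -
      have "continuous_on UNIV (\<lambda>x. g (x + s *\<^sub>R axis j 1) - g x)"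
        by (intro continuous_intros continuous_on_compose2[OF g_cont] g_cont) auto
      moreover have "AE x in lborel. g (x + s *\<^sub>R axis j 1) - g x = 0"
        using wderiv_line[OF g_L2 z w0 that] by eventually_elim simp
      ultimately show ?thesis using continuous_AE_zero by force
    qed
    show ?thesis using *[of s x] *[of "- s" "x + s *\<^sub>R axis j 1"] by (cases "s \<ge> 0") auto
  qed
  have "x = 0 + (x $ 1) *\<^sub>R axis 1 1 + (x $ 2) *\<^sub>R axis 2 1 + (x $ 3) *\<^sub>R axis 3 1"
    by (simp add: vec_eq_iff forall_3 axis_def)
  then show ?thesis by (metis inv)
qed

end

section \<open>Reduction to the regular case\<close>

lemma wderiv_AE_cong:
  assumes "wderiv i f v" "AE x in lborel. g x = f x"
    and [measurable]: "f \<in> borel_measurable borel" "g \<in> borel_measurable borel"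
  shows "wderiv i g v"
  unfolding wderiv_def
proof
  fix h assume h: "h \<in> test_factors"
  have [measurable]: "tensor (dfactor i h) \<in> borel_measurable borel"
    using h by (intro tensor_measurable dfactor_test_factors)
  have "(LINT x|lborel. g x * of_real (tensor (dfactor i h) x)) = (LINT x|lborel. f x * of_real (tensor (dfactor i h) x))"
    by (rule integral_cong_AE) (use assms(2) in \<open>auto elim: eventually_mono\<close>)
  then show "(LINT x|lborel. g x * of_real (tensor (dfactor i h) x)) = - (LINT x|lborel. v x * of_real (tensor h x))"
    using assms(1) h by (simp add: wderiv_def)
qed

text \<open>Multiplying g - h by 4 \<pi> |x| exp (sqrt l |x|) gives a continuous function that is
  almost everywhere q, yet vanishes at the origin.\<close>

lemma green_not_continuous:
  assumes "continuous_on UNIV g" "continuous_on UNIV h" "AE x in lborel. g x = h x + q * green l x"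
  shows "q = 0"
proof -
  define F where "F x = (g x - h x) * of_real (4 * pi * norm x * exp (sqrt l * norm x)) - q" for x
  have "continuous_on UNIV F" unfolding F_def by (intro continuous_intros assms)
  moreover have "AE x in lborel. F x = 0"
    using assms(3) AE_lborel_singleton[of "0::real^3"]
  proof eventually_elim
    case (elim x)
    have "green l x * of_real (4 * pi * norm x * exp (sqrt l * norm x)) = 1"
      using elim(2) unfolding green_def of_real_mult[symmetric]
      by (simp add: exp_minus field_simps)
    then show ?case unfolding F_def elim(1) by (simp add: mult.assoc)
  qed
  ultimately have "F 0 = 0" by (rule continuous_AE_zero)
  then show ?thesis by (simp add: F_def)
qed

theorem proposition1p4:
  fixes \<alpha> \<beta> p l :: real and q :: complex and u \<phi> :: "real^3 \<Rightarrow> complex"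
  assumes "0 < \<beta>" and "\<beta> < 3" and "p = (3 + \<beta>) / 3" and "\<alpha> \<ge> 0"
    and "(\<phi>, q, l) \<in> T \<alpha>"
    and "AE x in lborel. u x = \<phi> x + q * green l x"
    and "bound_state \<alpha> \<beta> p u"
    and "q = 0 \<or> (AE x in lborel. \<phi> x = 0)"
  shows "AE x in lborel. u x = 0"
proof -
  interpret riesz \<beta> using assms(1,2) by unfold_locales
  obtain g where g: "continuous_on UNIV g" "AE y in lborel. g y = \<phi> y"
    "g 0 = of_real (\<alpha> + sqrt l / (4 * pi)) * q" and l: "l > 0"
    using assms(5) by (auto simp: T_def has_point_value_def)
  have q: "q = 0"
    using assms(8)
  proof
    assume "AE x in lborel. \<phi> x = 0"
    then have "AE x in lborel. g x = 0" using g(2) by eventually_elim simp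
    then have "g 0 = 0" by (rule continuous_AE_zero[OF g(1)])
    \<comment> \<open>Strict positivity needs \<alpha> >= 0; for a negative \<alpha> the factor
      could vanish and q would remain free.\<close>
    moreover have "\<alpha> + sqrt l / (4 * pi) > 0" using assms(4) l by (intro add_nonneg_pos) auto
    ultimately show ?thesis using g(3) by (metis less_irrefl mult_eq_0_iff of_real_eq_0_iff)
  qed
  have ug: "AE x in lborel. u x = g x" using assms(6) g(2) by eventually_elim (simp add: q)
  obtain \<omega> where \<omega>: "AE x in lborel. op_H \<alpha> u x + of_real \<omega> * u x
        - of_real (convolution (riesz_potential \<beta>) (\<lambda>y. norm (u y) powr p) x)
          * of_real (norm (u x) powr (p - 2)) * u x = 0"
    and u: "u \<in> Dom_H \<alpha>"
    using assms(7) by (auto simp: bound_state_def)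
  have u_L2: "u \<in> L2" using u by (simp add: Dom_H_def)
  have g_L2: "g \<in> L2"
    by (rule L2_AE_cong[OF u_L2 borel_measurable_continuous_onI[OF g(1)]]) (use ug in \<open>auto elim: eventually_mono\<close>)
  have [measurable]: "u \<in> borel_measurable borel" "g \<in> borel_measurable borel"
    using u_L2 g_L2 by (auto intro: L2_measurable)
  \<comment> \<open>The operator acts through its own chosen representation of \<open>u\<close>,
    which may differ from the given one; it too must have a zero coefficient of the Green
    function.\<close>
  define t where "t = (SOME t. t \<in> T \<alpha> \<and> represents t u)"
  have t: "t \<in> T \<alpha> \<and> represents t u"
    unfolding t_def by (rule someI_ex) (use u in \<open>auto simp: Dom_H_def\<close>)
  obtain \<psi> r m where trm: "t = (\<psi>, r, m)" by (cases t)
  obtain h where h: "continuous_on UNIV h" "AE y in lborel. h y = \<psi> y" and \<psi>: "\<psi> \<in> H2"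
    using t by (auto simp: trm T_def has_point_value_def)
  have rep: "AE x in lborel. u x = \<psi> x + r * green m x" using t by (simp add: trm represents_def)
  have r: "r = 0"
  proof (rule green_not_continuous[OF g(1) h(1)])
    show "AE x in lborel. g x = h x + r * green m x"
      using ug h(2) rep by eventually_elim simp
  qed
  have g\<psi>: "AE x in lborel. g x = \<psi> x" using ug rep by eventually_elim (simp add: r)
  have op: "op_H \<alpha> u x = - (\<Sum>k\<in>UNIV. weak_deriv [k, k] \<psi> x)" for x
    unfolding op_H_def t_def[symmetric] trm by (simp add: r laplacian_def)
  have [measurable]: "\<psi> \<in> borel_measurable borel" using \<psi> by (simp add: H2_def L2_def)
  \<comment> \<open>The derivatives are taken from \<psi> and not from \<open>g\<close>, since
    \<open>op_H\<close> contains the weak derivatives selected for \<psi>; the locale needs them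
    only as weak derivatives of \<open>g\<close>, which equals \<psi> almost everywhere.\<close>
  obtain v where v: "\<And>i. v i \<in> L2" "\<And>i. wderiv i \<psi> (v i)"
    and w: "\<And>i j. weak_deriv [i, j] \<psi> \<in> L2" "\<And>i j. wderiv i (v j) (weak_deriv [i, j] \<psi>)"
      "\<And>i j. wderiv j (v i) (weak_deriv [i, j] \<psi>)"
    using H2_weak_derivs[OF \<psi>] by blast
  \<comment> \<open>Equality at every x, because the integral ignores the null set on which
    \<open>u\<close> and \<open>g\<close> differ.\<close>
  have conv: "convolution ker (\<lambda>y. norm (u y) powr p) x = convolution ker (\<lambda>y. norm (g y) powr pex) x" for x
    unfolding convolution_def
    unfolding assms(3) pex_def[symmetric]
    by (rule integral_cong_AE) (use ug in \<open>auto elim: eventually_mono\<close>)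
  interpret choquard \<beta> g v "\<lambda>i j. weak_deriv [i, j] \<psi>" \<omega>
  proof unfold_locales
    show "AE x in lborel. - (\<Sum>k\<in>UNIV. weak_deriv [k, k] \<psi> x) + of_real \<omega> * g x =
       of_real (convolution ker (\<lambda>y. norm (g y) powr pex) x) * of_real (norm (g x) powr (pex - 2)) * g x"
      using \<omega> ug
    proof eventually_elim
      case (elim x)
      then show ?case unfolding op conv by (simp add: assms(3) pex_def)
    qed
    show "wderiv i g (v i)" for i by (rule wderiv_AE_cong[OF v(2) g\<psi>]) measurable
  qed (use g(1) g_L2 v w in auto)
  \<comment> \<open>The constant is the value at the origin, and the boundary condition with q = 0
    makes that value 0.\<close>
  show ?thesis using ug
  proof eventually_elim
    case (elim x)
    then show ?case using g_constant[of x] g(3) q by simp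
  qed
qed

end
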